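(* Let $\widehat\gamma=(\gamma_2,\gamma_3,\gamma_5,\dots)$ be a sequence of complex numbers indexed by the primes, and let $D_0^{\widehat\gamma}$ be the adelic fractional operator on $\Phi(\widetilde{\mathbb A})$. Let $m$ be a prime and let $$\widetilde\Psi_\alpha(x')=\prod_{2\le q\le m}q^{j_q/2}\chi_q\Big(\frac{k_q}{q}(q^{-j_q}x_q-a_q)\Big)\Omega\big(|q^{-j_q}x_q-a_q|_q\big)\prod_{q>m}\Omega(|x_q|_q),\qquad x'\in\widetilde{\mathbb A},$$ where $k_q\in\{1,\dots,q-1\}$, $j_q\in\{0,1,2,\dots\}$, $a_q\in I_q$ for each prime $q\le m$. Then $\widetilde\Psi_\alpha$ is an eigenfunction of $D_0^{\widehat\gamma}$: $$D_0^{\widehat\gamma}\widetilde\Psi_\alpha=\Big(\prod_{2\le q\le m}q^{\gamma_q(j_q+1)}\Big)\widetilde\Psi_\alpha,$$ the product being over primes $q$.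
   Context: Throughout $p,q,m$ denote primes. $\mathbb Q_p$, $|\cdot|_p$, $\mathbb Z_p$: $p$-adic numbers, norm, integers; $\chi_p(x)=e^{2\pi i\{x\}_p}$ with $\{x\}_p$ the $p$-adic fractional part; $\Omega$ is the characteristic function of $[0,1]$. $I_q\subset\mathbb Q_q$ is the set of finite sums $a_{-\gamma}q^{-\gamma}+\dots+a_{-1}q^{-1}$, $a_i\in\{0,\dots,q-1\}$ (including $0$). $\widetilde{\mathbb A}$ is the ring of finite adeles (sequences $x'=(x_2,x_3,x_5,\dots)$, $x_p\in\mathbb Q_p$, $x_p\in\mathbb Z_p$ for almost all $p$) with Haar measure giving $\prod_p\mathbb Z_p$ measure 1. $F[\varphi](\xi')=\int_{\widetilde{\mathbb A}}\prod_p\chi_p(\xi_px_p)\varphi(x')\,dx'$. Let $\mathcal D(\mathbb Q_p)$ be the space of locally constant compactly supported complex functions on $\mathbb Q_p$. For a prime $m$, $\Psi^{[m]}(\widetilde{\mathbb A})$ is the space of finite linear combinations of functions $\prod_p\eta_p(\xi_p)$ with $\eta_p\in\mathcal D(\mathbb Q_p)$, $\eta_p(\xi_p)=\Omega(|\xi_p|_p)$ for $p>m$, that vanish when $\xi_r=0$ for any prime $r\le m$. Put $\Phi^{[m]}(\widetilde{\mathbb A})=F[\Psi^{[m]}(\widetilde{\mathbb A})]$; $\Phi(\widetilde{\mathbb A})$ is the span of all $\Phi^{[m]}(\widetilde{\mathbb A})$. $D_0^{\widehat\gamma}$ is defined on each $\Phi^{[m]}(\widetilde{\mathbb A})$ by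 $D_0^{\widehat\gamma}\zeta=F^{-1}\big[|\cdot|^{\widehat\gamma}_{0(m)}F[\zeta]\big]$ with $|\xi'|^{\widehat\gamma}_{0(m)}=\prod_{q\le m}|\xi_q|_q^{\gamma_q}\prod_{q>m}\Omega(|\xi_q|_q)$ (the product with $F[\zeta]$ being $0$ where some $\xi_q=0$, $q\le m$), and extended linearly. *)

theory Defs
  imports
    "HOL-Analysis.Analysis"
    "HOL-Algebra.QuotRing"
    "HOL-Computational_Algebra.Primes"
begin

section \<open>The field of p-adic numbers\<close>

definition padic_abs :: "nat \<Rightarrow> rat \<Rightarrow> real" where
  "padic_abs p r = (if r = 0 then 0 else
     real p powi (int (multiplicity (int p) (snd (quotient_of r)))
                - int (multiplicity (int p) (fst (quotient_of r)))))"

definition padic_Cauchy :: "nat \<Rightarrow> (nat \<Rightarrow> rat) \<Rightarrow> bool" where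
  "padic_Cauchy p X \<longleftrightarrow> (\<forall>e>0. \<exists>N. \<forall>i\<ge>N. \<forall>k\<ge>N. padic_abs p (X i - X k) < e)"

definition padic_Cauchy_ring :: "nat \<Rightarrow> (nat \<Rightarrow> rat) ring" where
  "padic_Cauchy_ring p =
     \<lparr>carrier = {X. padic_Cauchy p X}, mult = (\<lambda>X Y n. X n * Y n), one = (\<lambda>_. 1),
      zero = (\<lambda>_. 0), add = (\<lambda>X Y n. X n + Y n)\<rparr>"

definition padic_null :: "nat \<Rightarrow> (nat \<Rightarrow> rat) set" where
  "padic_null p = {X. (\<lambda>n. padic_abs p (X n)) \<longlonglongrightarrow> 0}"

text \<open>
  As \<open>p\<close> has to range over all primes inside a single adele, the field of p-adic numbers is a
  ring structure depending on \<open>p\<close> (the completion of the rationals), not a type.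
\<close>

definition Qp :: "nat \<Rightarrow> (nat \<Rightarrow> rat) set ring" where
  "Qp p = padic_Cauchy_ring p Quot padic_null p"

definition padic_of_rat :: "nat \<Rightarrow> rat \<Rightarrow> (nat \<Rightarrow> rat) set" where
  "padic_of_rat p r = padic_null p +>\<^bsub>padic_Cauchy_ring p\<^esub> (\<lambda>_. r)"

definition padic_norm :: "nat \<Rightarrow> (nat \<Rightarrow> rat) set \<Rightarrow> real" where
  "padic_norm p x = (THE l. \<forall>X\<in>x. (\<lambda>n. padic_abs p (X n)) \<longlonglongrightarrow> l)"

definition Zp :: "nat \<Rightarrow> (nat \<Rightarrow> rat) set set" where
  "Zp p = {x \<in> carrier (Qp p). padic_norm p x \<le> 1}"

definition Qp_dist :: "nat \<Rightarrow> (nat \<Rightarrow> rat) set \<Rightarrow> (nat \<Rightarrow> rat) set \<Rightarrow> real" where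
  "Qp_dist p x y =
     (if x \<in> carrier (Qp p) \<and> y \<in> carrier (Qp p) then padic_norm p (x \<ominus>\<^bsub>Qp p\<^esub> y) else 0)"

definition Qp_topology :: "nat \<Rightarrow> (nat \<Rightarrow> rat) set topology" where
  "Qp_topology p = Metric_space.mtopology (carrier (Qp p)) (Qp_dist p)"

definition digit_fractions :: "nat \<Rightarrow> rat set" where
  "digit_fractions p = {(\<Sum>i=1..n. of_nat (d i) / of_nat p ^ i) | d n. \<forall>i. d i < p}"

definition padic_I :: "nat \<Rightarrow> (nat \<Rightarrow> rat) set set" where
  "padic_I p = padic_of_rat p ` digit_fractions p"

text \<open>
  The negative-exponent part of the canonical expansion of \<open>x\<close> is the unique digit fraction that
  differs from \<open>x\<close> by a p-adic integer.
\<close>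

definition padic_frac :: "nat \<Rightarrow> (nat \<Rightarrow> rat) set \<Rightarrow> rat" where
  "padic_frac p x =
     (THE r. r \<in> digit_fractions p \<and> x \<ominus>\<^bsub>Qp p\<^esub> padic_of_rat p r \<in> Zp p)"

definition padic_char :: "nat \<Rightarrow> (nat \<Rightarrow> rat) set \<Rightarrow> complex" where
  "padic_char p x = exp (2 * of_real pi * \<i> * of_rat (padic_frac p x))"

definition Omega :: "real \<Rightarrow> complex" where
  "Omega = indicator {0..1}"


subsection \<open>Basic properties\<close>

lemma padic_abs_0 [simp]: "padic_abs p 0 = 0"
  by (simp add: padic_abs_def)

lemma padic_abs_of_int_div:
  assumes p: "prime p" and "a \<noteq> 0" "b \<noteq> 0"
  shows "padic_abs p (of_int a / of_int b) =
           real p powi (int (multiplicity (int p) b) - int (multiplicity (int p) a))"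
proof -
  obtain c d where cd: "quotient_of (of_int a / of_int b) = (c, d)" by force
  have d: "d > 0" using quotient_of_denom_pos[OF cd] .
  have eq: "(of_int a / of_int b :: rat) = of_int c / of_int d" using quotient_of_div[OF cd] .
  have c: "c \<noteq> 0" using eq assms by auto
  have "(of_int (a * d) :: rat) = of_int (c * b)"
    using eq assms d by (simp add: field_simps)
  then have e: "a * d = c * b" by (simp only: of_int_eq_iff)
  have pe: "prime_elem (int p)" using p by simp
  have "multiplicity (int p) (a * d) = multiplicity (int p) (c * b)" using e by simp
  then have "multiplicity (int p) a + multiplicity (int p) d
      = multiplicity (int p) c + multiplicity (int p) b"
    using assms c d by (simp add: prime_elem_multiplicity_mult_distrib[OF pe])
  then have "int (multiplicity (int p) d) - int (multiplicity (int p) c)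
     = int (multiplicity (int p) b) - int (multiplicity (int p) a)" by linarith
  then show ?thesis using cd assms by (simp add: padic_abs_def)
qed

lemma rat_int_div: obtains a b where "(r::rat) = of_int a / of_int b" "b \<noteq> 0"
proof -
  obtain a b where ab: "quotient_of r = (a, b)" by force
  show ?thesis
    using that[of a b] quotient_of_div[OF ab] quotient_of_denom_pos[OF ab] by simp
qed

lemma padic_abs_nonneg [simp]: "padic_abs p r \<ge> 0"
  by (simp add: padic_abs_def)

lemma padic_abs_eq_0 [simp]: "prime p \<Longrightarrow> padic_abs p r = 0 \<longleftrightarrow> r = 0"
  by (auto simp: padic_abs_def power_int_eq_0_iff dest: prime_gt_0_nat)

lemma padic_abs_mult:
  assumes p: "prime p" shows "padic_abs p (r * s) = padic_abs p r * padic_abs p s"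
proof (cases "r = 0 \<or> s = 0")
  case False
  obtain a b c d where r: "r = of_int a / of_int b" "b \<noteq> 0" and s: "s = of_int c / of_int d" "d \<noteq> 0"
    by (metis rat_int_div)
  with False have nz: "a \<noteq> 0" "c \<noteq> 0" by auto
  have rs: "r * s = of_int (a * c) / of_int (b * d)" using r s by simp
  have pe: "prime_elem (int p)" using p by simp
  have p0: "real p \<noteq> 0" using prime_gt_0_nat[OF p] by simp
  have "int (multiplicity (int p) (b * d)) - int (multiplicity (int p) (a * c)) =
      (int (multiplicity (int p) b) - int (multiplicity (int p) a)) +
      (int (multiplicity (int p) d) - int (multiplicity (int p) c))"
    using r s nz by (simp add: prime_elem_multiplicity_mult_distrib[OF pe])
  moreover have "padic_abs p (r * s) =
      real p powi (int (multiplicity (int p) (b * d)) - int (multiplicity (int p) (a * c)))"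
    unfolding rs by (rule padic_abs_of_int_div[OF p]) (use r s nz in auto)
  ultimately show ?thesis
    using p0 r s nz by (simp add: power_int_add padic_abs_of_int_div[OF p])
qed auto

lemma padic_abs_1 [simp]: "prime p \<Longrightarrow> padic_abs p 1 = 1"
  using padic_abs_of_int_div[of p 1 1] by simp

lemma padic_abs_minus [simp]:
  assumes p: "prime p" shows "padic_abs p (- r) = padic_abs p r"
proof -
  have "padic_abs p (-1) = 1" using padic_abs_of_int_div[of p "-1" 1] p
    by (simp add: multiplicity_unit_right)
  then show ?thesis using padic_abs_mult[OF p, of "-1" r] by simp
qed

lemma padic_abs_add:
  assumes p: "prime p" shows "padic_abs p (r + s) \<le> max (padic_abs p r) (padic_abs p s)"
proof (cases "r = 0 \<or> s = 0 \<or> r + s = 0")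
  case True
  then show ?thesis by (auto simp: max_def)
next
  case False
  obtain a b c d where r: "r = of_int a / of_int b" "b \<noteq> 0" and s: "s = of_int c / of_int d" "d \<noteq> 0"
    by (metis rat_int_div)
  define x y where "x = a * d" and "y = c * b"
  have r': "r = of_int x / of_int (b * d)" and s': "s = of_int y / of_int (b * d)"
    using r s by (auto simp: x_def y_def)
  have rs: "r + s = of_int (x + y) / of_int (b * d)"
    unfolding r' s' by (simp add: add_divide_distrib)
  have nz: "x \<noteq> 0" "y \<noteq> 0" "x + y \<noteq> 0" "b * d \<noteq> 0" using False r' s' rs r s by auto
  have "min (multiplicity (int p) x) (multiplicity (int p) y) \<le> multiplicity (int p) (x + y)"
  proof (rule multiplicity_geI)
    show "\<not> is_unit (int p)" using prime_gt_1_nat[OF p] by simp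
    show "x + y \<noteq> 0" by fact
    show "int p ^ min (multiplicity (int p) x) (multiplicity (int p) y) dvd x + y"
      by (intro dvd_add) (auto intro: multiplicity_dvd')
  qed
  then have "int (multiplicity (int p) (b * d)) - int (multiplicity (int p) (x + y))
      \<le> int (multiplicity (int p) (b * d)) - int (multiplicity (int p) x) \<or>
    int (multiplicity (int p) (b * d)) - int (multiplicity (int p) (x + y))
      \<le> int (multiplicity (int p) (b * d)) - int (multiplicity (int p) y)"
    by linarith
  moreover have "1 \<le> real p" using prime_ge_1_nat[OF p] by simp
  ultimately show ?thesis
    unfolding rs unfolding r' s' padic_abs_of_int_div[OF p nz(1) nz(4)]
      padic_abs_of_int_div[OF p nz(2) nz(4)] padic_abs_of_int_div[OF p nz(3) nz(4)] le_max_iff_disj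
    by (blast intro: power_int_increasing)
qed

lemma padic_abs_diff:
  assumes p: "prime p" shows "padic_abs p (r - s) \<le> max (padic_abs p r) (padic_abs p s)"
  using padic_abs_add[OF p, of r "- s"] p by simp

lemma padic_abs_abs_diff:
  assumes p: "prime p" shows "\<bar>padic_abs p r - padic_abs p s\<bar> \<le> padic_abs p (r - s)"
proof -
  have "padic_abs p r \<le> max (padic_abs p (r - s)) (padic_abs p s)"
    using padic_abs_add[OF p, of "r - s" s] by simp
  moreover have "padic_abs p s \<le> max (padic_abs p (r - s)) (padic_abs p r)"
    using padic_abs_diff[OF p, of r "r - s"] by (simp add: max.commute)
  moreover have "padic_abs p r \<ge> 0" "padic_abs p s \<ge> 0" "padic_abs p (r - s) \<ge> 0" by auto
  ultimately show ?thesis by (simp only: abs_le_iff max_def split: if_splits; linarith)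
qed

lemma padic_Cauchy_const: "padic_Cauchy p (\<lambda>_. r)"
  by (auto simp: padic_Cauchy_def)

lemma padic_Cauchy_add:
  assumes p: "prime p" and "padic_Cauchy p X" "padic_Cauchy p Y"
  shows "padic_Cauchy p (\<lambda>n. X n + Y n)"
  unfolding padic_Cauchy_def
proof (intro allI impI)
  fix e :: real assume "e > 0"
  with assms obtain M N where
    M: "\<And>i k. i \<ge> M \<Longrightarrow> k \<ge> M \<Longrightarrow> padic_abs p (X i - X k) < e" and
    N: "\<And>i k. i \<ge> N \<Longrightarrow> k \<ge> N \<Longrightarrow> padic_abs p (Y i - Y k) < e"
    unfolding padic_Cauchy_def by metis
  have "padic_abs p (X i + Y i - (X k + Y k)) < e" if "i \<ge> max M N" "k \<ge> max M N" for i k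
  proof -
    have eq: "X i + Y i - (X k + Y k) = (X i - X k) + (Y i - Y k)" by simp
    show ?thesis unfolding eq using padic_abs_add[OF p, of "X i - X k" "Y i - Y k"] M[of i k] N[of i k] that
      by auto
  qed
  then show "\<exists>N. \<forall>i\<ge>N. \<forall>k\<ge>N. padic_abs p (X i + Y i - (X k + Y k)) < e" by blast
qed

lemma padic_Cauchy_uminus:
  assumes p: "prime p" and "padic_Cauchy p X"
  shows "padic_Cauchy p (\<lambda>n. - X n)"
proof -
  have "padic_abs p (- X i - - X k) = padic_abs p (X i - X k)" for i k
    using padic_abs_minus[OF p, of "X i - X k"] by (simp add: algebra_simps)
  then show ?thesis using assms(2) unfolding padic_Cauchy_def by presburger
qed

lemma padic_Cauchy_convergent:
  assumes p: "prime p" and "padic_Cauchy p X"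
  shows "convergent (\<lambda>n. padic_abs p (X n))"
proof (rule Cauchy_convergent, rule metric_CauchyI)
  fix e :: real assume "e > 0"
  then obtain N where "\<And>i k. i \<ge> N \<Longrightarrow> k \<ge> N \<Longrightarrow> padic_abs p (X i - X k) < e"
    using assms(2) unfolding padic_Cauchy_def by metis
  then show "\<exists>M. \<forall>m\<ge>M. \<forall>n\<ge>M. dist (padic_abs p (X m)) (padic_abs p (X n)) < e"
    using padic_abs_abs_diff[OF p] unfolding dist_real_def by (meson le_less_trans)
qed

lemma padic_Cauchy_bounded:
  assumes p: "prime p" and "padic_Cauchy p X"
  obtains B where "B > 0" "\<And>n. padic_abs p (X n) \<le> B"
proof -
  have "Bseq (\<lambda>n. padic_abs p (X n))"
    using padic_Cauchy_convergent[OF assms] by (rule convergent_imp_Bseq)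
  then obtain B where "B > 0" "\<forall>n. norm (padic_abs p (X n)) \<le> B" by (rule BseqE)
  then show ?thesis using that[of B] by simp
qed

lemma padic_Cauchy_mult:
  assumes p: "prime p" and X: "padic_Cauchy p X" and Y: "padic_Cauchy p Y"
  shows "padic_Cauchy p (\<lambda>n. X n * Y n)"
  unfolding padic_Cauchy_def
proof (intro allI impI)
  fix e :: real assume e: "e > 0"
  obtain B where B: "B > 0" "\<And>n. padic_abs p (X n) \<le> B" using padic_Cauchy_bounded[OF p X] by metis
  obtain C where C: "C > 0" "\<And>n. padic_abs p (Y n) \<le> C" using padic_Cauchy_bounded[OF p Y] by metis
  from e B C have "e / B > 0" "e / C > 0" by auto
  with X Y obtain M N where
    M: "\<And>i k. i \<ge> M \<Longrightarrow> k \<ge> M \<Longrightarrow> padic_abs p (X i - X k) < e / C" and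
    N: "\<And>i k. i \<ge> N \<Longrightarrow> k \<ge> N \<Longrightarrow> padic_abs p (Y i - Y k) < e / B"
    unfolding padic_Cauchy_def by metis
  have "padic_abs p (X i * Y i - X k * Y k) < e" if "i \<ge> max M N" "k \<ge> max M N" for i k
  proof -
    have eq: "X i * Y i - X k * Y k = X i * (Y i - Y k) + (X i - X k) * Y k"
      by (simp add: algebra_simps)
    have "padic_abs p (X i) * padic_abs p (Y i - Y k) \<le> B * padic_abs p (Y i - Y k)"
      by (intro mult_right_mono B) auto
    also have "\<dots> < e" using N[of i k] that B by (simp add: field_simps)
    finally have 1: "padic_abs p (X i * (Y i - Y k)) < e" by (simp add: padic_abs_mult[OF p])
    have "padic_abs p (X i - X k) * padic_abs p (Y k) \<le> padic_abs p (X i - X k) * C"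
      by (intro mult_left_mono C) auto
    also have "\<dots> < e" using M[of i k] that C by (simp add: field_simps)
    finally have 2: "padic_abs p ((X i - X k) * Y k) < e" by (simp add: padic_abs_mult[OF p])
    show ?thesis
      unfolding eq using padic_abs_add[OF p, of "X i * (Y i - Y k)" "(X i - X k) * Y k"] 1 2 by auto
  qed
  then show "\<exists>N. \<forall>i\<ge>N. \<forall>k\<ge>N. padic_abs p (X i * Y i - X k * Y k) < e" by blast
qed

lemma padic_Cauchy_ring_cring:
  assumes p: "prime p" shows "cring (padic_Cauchy_ring p)"
proof (rule cringI)
  show "abelian_group (padic_Cauchy_ring p)"
  proof (rule abelian_groupI)
    fix X assume "X \<in> carrier (padic_Cauchy_ring p)"
    then show "\<exists>Y\<in>carrier (padic_Cauchy_ring p).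
        Y \<oplus>\<^bsub>padic_Cauchy_ring p\<^esub> X = \<zero>\<^bsub>padic_Cauchy_ring p\<^esub>"
      using padic_Cauchy_uminus[OF p, of X]
      by (intro bexI[of _ "\<lambda>n. - X n"]) (simp_all add: padic_Cauchy_ring_def)
  qed (simp_all add: padic_Cauchy_ring_def padic_Cauchy_add[OF p] padic_Cauchy_const fun_eq_iff)
  show "comm_monoid (padic_Cauchy_ring p)"
    by (rule comm_monoidI)
      (simp_all add: padic_Cauchy_ring_def padic_Cauchy_mult[OF p] padic_Cauchy_const fun_eq_iff)
qed (simp add: padic_Cauchy_ring_def fun_eq_iff distrib_right)

lemma padic_null_Cauchy:
  assumes p: "prime p" and "X \<in> padic_null p" shows "padic_Cauchy p X"
  unfolding padic_Cauchy_def
proof (intro allI impI)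
  fix e :: real assume "e > 0"
  then obtain N where N: "\<And>n. n \<ge> N \<Longrightarrow> padic_abs p (X n) < e"
    using assms(2) unfolding padic_null_def by (auto simp: LIMSEQ_def dist_real_def)
  have "padic_abs p (X i - X k) < e" if "i \<ge> N" "k \<ge> N" for i k
    using padic_abs_diff[OF p, of "X i" "X k"] N[of i] N[of k] that by auto
  then show "\<exists>N. \<forall>i\<ge>N. \<forall>k\<ge>N. padic_abs p (X i - X k) < e" by blast
qed

lemma padic_null_mult:
  assumes p: "prime p" and X: "X \<in> padic_null p" and Y: "padic_Cauchy p Y"
  shows "(\<lambda>n. X n * Y n) \<in> padic_null p"
proof -
  obtain l where "(\<lambda>n. padic_abs p (Y n)) \<longlonglongrightarrow> l"
    using padic_Cauchy_convergent[OF p Y] by (auto simp: convergent_def)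
  then have "(\<lambda>n. padic_abs p (X n) * padic_abs p (Y n)) \<longlonglongrightarrow> 0 * l"
    using X by (intro tendsto_mult) (auto simp: padic_null_def)
  then show ?thesis by (simp add: padic_null_def padic_abs_mult[OF p])
qed

lemma padic_null_add:
  assumes p: "prime p" and X: "X \<in> padic_null p" and Y: "Y \<in> padic_null p"
  shows "(\<lambda>n. X n + Y n) \<in> padic_null p"
proof -
  have "(\<lambda>n. max (padic_abs p (X n)) (padic_abs p (Y n))) \<longlonglongrightarrow> max 0 0"
    using X Y by (intro tendsto_max) (auto simp: padic_null_def)
  then have lim: "(\<lambda>n. max (padic_abs p (X n)) (padic_abs p (Y n))) \<longlonglongrightarrow> 0" by simp
  have "(\<lambda>n. padic_abs p (X n + Y n)) \<longlonglongrightarrow> 0"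
    by (rule Lim_null_comparison[OF _ lim]) (simp add: padic_abs_add[OF p])
  then show ?thesis by (simp add: padic_null_def)
qed

lemma padic_null_uminus:
  assumes p: "prime p" and X: "X \<in> padic_null p"
  shows "(\<lambda>n. - X n) \<in> padic_null p"
  using X p by (simp add: padic_null_def)

lemma padic_Cauchy_ring_a_inv:
  assumes p: "prime p" and X: "padic_Cauchy p X"
  shows "\<ominus>\<^bsub>padic_Cauchy_ring p\<^esub> X = (\<lambda>n. - X n)"
proof -
  have 1: "X \<in> carrier (padic_Cauchy_ring p)" "(\<lambda>n. - X n) \<in> carrier (padic_Cauchy_ring p)"
    "(\<lambda>n. - X n) \<oplus>\<^bsub>padic_Cauchy_ring p\<^esub> X = \<zero>\<^bsub>padic_Cauchy_ring p\<^esub>"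
    using X padic_Cauchy_uminus[OF p X] by (simp_all add: padic_Cauchy_ring_def)
  interpret cring "padic_Cauchy_ring p" by (rule padic_Cauchy_ring_cring[OF p])
  show ?thesis using minus_equality[OF 1(3) 1(1) 1(2)] .
qed

lemma padic_null_ideal:
  assumes p: "prime p" shows "ideal (padic_null p) (padic_Cauchy_ring p)"
proof (rule idealI)
  interpret cring "padic_Cauchy_ring p" by (rule padic_Cauchy_ring_cring[OF p])
  show "ring (padic_Cauchy_ring p)" by (rule ring_axioms)
  show "subgroup (padic_null p) (add_monoid (padic_Cauchy_ring p))"
  proof (rule add.subgroupI)
    show "padic_null p \<subseteq> carrier (padic_Cauchy_ring p)"
      using padic_null_Cauchy[OF p] by (auto simp: padic_Cauchy_ring_def)
    have "(\<lambda>_. 0) \<in> padic_null p" by (simp add: padic_null_def)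
    then show "padic_null p \<noteq> {}" by blast
    fix X assume X: "X \<in> padic_null p"
    then show "\<ominus>\<^bsub>padic_Cauchy_ring p\<^esub> X \<in> padic_null p"
      by (simp add: padic_Cauchy_ring_a_inv[OF p] padic_null_Cauchy[OF p] padic_null_uminus[OF p])
    fix Y assume "Y \<in> padic_null p"
    with X show "X \<oplus>\<^bsub>padic_Cauchy_ring p\<^esub> Y \<in> padic_null p"
      by (simp add: padic_Cauchy_ring_def padic_null_add[OF p])
  qed
  fix X Y assume XY: "X \<in> padic_null p" "Y \<in> carrier (padic_Cauchy_ring p)"
  then have 1: "(\<lambda>n. X n * Y n) \<in> padic_null p"
    using padic_null_mult[OF p] by (simp add: padic_Cauchy_ring_def)
  then show "X \<otimes>\<^bsub>padic_Cauchy_ring p\<^esub> Y \<in> padic_null p"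
    by (simp add: padic_Cauchy_ring_def)
  from 1 show "Y \<otimes>\<^bsub>padic_Cauchy_ring p\<^esub> X \<in> padic_null p"
    by (simp add: padic_Cauchy_ring_def mult.commute)
qed

lemma Qp_cring: "prime p \<Longrightarrow> cring (Qp p)"
  unfolding Qp_def
  by (rule ideal.quotient_is_cring[OF padic_null_ideal padic_Cauchy_ring_cring])

abbreviation padic_class :: "nat \<Rightarrow> (nat \<Rightarrow> rat) \<Rightarrow> (nat \<Rightarrow> rat) set" where
  "padic_class p X \<equiv> padic_null p +>\<^bsub>padic_Cauchy_ring p\<^esub> X"

lemma Qp_cases:
  assumes p: "prime p" and "x \<in> carrier (Qp p)"
  obtains X where "padic_Cauchy p X" "x = padic_class p X"
  using assms unfolding Qp_def FactRing_simps by (auto simp: padic_Cauchy_ring_def)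

lemma padic_class_closed: "padic_Cauchy p X \<Longrightarrow> padic_class p X \<in> carrier (Qp p)"
  unfolding Qp_def FactRing_simps by (auto simp: padic_Cauchy_ring_def)

lemma padic_class_add:
  assumes p: "prime p" and "padic_Cauchy p X" "padic_Cauchy p Y"
  shows "padic_class p X \<oplus>\<^bsub>Qp p\<^esub> padic_class p Y = padic_class p (\<lambda>n. X n + Y n)"
proof -
  have "X \<in> carrier (padic_Cauchy_ring p)" "Y \<in> carrier (padic_Cauchy_ring p)"
    using assms by (auto simp: padic_Cauchy_ring_def)
  from ring_hom_add[OF ideal.rcos_ring_hom[OF padic_null_ideal[OF p]] this]
  show ?thesis by (simp add: Qp_def padic_Cauchy_ring_def)
qed

lemma padic_class_mult:
  assumes p: "prime p" and "padic_Cauchy p X" "padic_Cauchy p Y"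
  shows "padic_class p X \<otimes>\<^bsub>Qp p\<^esub> padic_class p Y = padic_class p (\<lambda>n. X n * Y n)"
proof -
  have "X \<in> carrier (padic_Cauchy_ring p)" "Y \<in> carrier (padic_Cauchy_ring p)"
    using assms by (auto simp: padic_Cauchy_ring_def)
  from ring_hom_mult[OF ideal.rcos_ring_hom[OF padic_null_ideal[OF p]] this]
  show ?thesis by (simp add: Qp_def padic_Cauchy_ring_def)
qed

lemma padic_class_0:
  assumes p: "prime p" shows "\<zero>\<^bsub>Qp p\<^esub> = padic_class p (\<lambda>_. 0)"
proof -
  interpret I: ideal "padic_null p" "padic_Cauchy_ring p" by (rule padic_null_ideal[OF p])
  have "padic_class p (\<lambda>_. 0) = padic_null p"
    by (rule I.a_rcos_const) (simp add: padic_null_def)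
  then show ?thesis by (simp add: Qp_def FactRing_def)
qed

lemma padic_class_1: "\<one>\<^bsub>Qp p\<^esub> = padic_class p (\<lambda>_. 1)"
  by (simp add: Qp_def FactRing_def padic_Cauchy_ring_def)

lemma padic_class_uminus:
  assumes p: "prime p" and X: "padic_Cauchy p X"
  shows "\<ominus>\<^bsub>Qp p\<^esub> padic_class p X = padic_class p (\<lambda>n. - X n)"
proof -
  note X' = padic_Cauchy_uminus[OF p X]
  have sum: "padic_class p (\<lambda>n. - X n) \<oplus>\<^bsub>Qp p\<^esub> padic_class p X = \<zero>\<^bsub>Qp p\<^esub>"
    unfolding padic_class_add[OF p X' X] padic_class_0[OF p] by simp
  interpret cring "Qp p" by (rule Qp_cring[OF p])
  show ?thesis
    using minus_equality[OF sum padic_class_closed[OF X] padic_class_closed[OF X']] .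
qed

lemma padic_norm_class:
  assumes p: "prime p" and X: "padic_Cauchy p X"
  shows "(\<lambda>n. padic_abs p (X n)) \<longlonglongrightarrow> padic_norm p (padic_class p X)"
proof -
  obtain l where l: "(\<lambda>n. padic_abs p (X n)) \<longlonglongrightarrow> l"
    using padic_Cauchy_convergent[OF p X] by (auto simp: convergent_def)
  have Y: "(\<lambda>n. padic_abs p (Y n)) \<longlonglongrightarrow> l" if "Y \<in> padic_class p X" for Y
  proof -
    from that obtain H where H: "H \<in> padic_null p" "Y = (\<lambda>n. H n + X n)"
      by (auto simp: a_r_coset_def r_coset_def padic_Cauchy_ring_def)
    have "(\<lambda>n. padic_abs p (Y n) - padic_abs p (X n)) \<longlonglongrightarrow> 0"
    proof (rule Lim_null_comparison)
      show "(\<lambda>n. padic_abs p (H n)) \<longlonglongrightarrow> 0" using H by (simp add: padic_null_def)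
      show "\<forall>\<^sub>F n in sequentially. norm (padic_abs p (Y n) - padic_abs p (X n)) \<le> padic_abs p (H n)"
        using padic_abs_abs_diff[OF p, of "Y _" "X _"] H by (intro always_eventually) (auto, metis add_diff_cancel_right')
    qed
    from tendsto_add[OF this l] show ?thesis by simp
  qed
  have "(\<lambda>n. 0 + X n) \<in> padic_class p X"
    unfolding a_r_coset_def r_coset_def padic_Cauchy_ring_def
    by (auto simp: padic_null_def intro!: exI[of _ "\<lambda>_. 0"])
  then have "padic_norm p (padic_class p X) = l"
    unfolding padic_norm_def using Y by (intro the_equality) (auto intro: LIMSEQ_unique l)
  with l show ?thesis by simp
qed

lemma padic_norm_of_rat: "prime p \<Longrightarrow> padic_norm p (padic_of_rat p r) = padic_abs p r"
  using padic_norm_class[OF _ padic_Cauchy_const, of p r]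
  by (auto simp: padic_of_rat_def dest: LIMSEQ_const_iff[THEN iffD1])

lemma padic_norm_nonneg:
  assumes p: "prime p" and x: "x \<in> carrier (Qp p)" shows "padic_norm p x \<ge> 0"
proof -
  obtain X where X: "padic_Cauchy p X" "x = padic_class p X" using Qp_cases[OF p x] by metis
  show ?thesis
    unfolding X by (rule LIMSEQ_le_const[OF padic_norm_class[OF p X(1)]]) auto
qed

lemma padic_norm_add:
  assumes p: "prime p" and x: "x \<in> carrier (Qp p)" and y: "y \<in> carrier (Qp p)"
  shows "padic_norm p (x \<oplus>\<^bsub>Qp p\<^esub> y) \<le> max (padic_norm p x) (padic_norm p y)"
proof -
  obtain X Y where X: "padic_Cauchy p X" "x = padic_class p X" and Y: "padic_Cauchy p Y" "y = padic_class p Y"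
    using Qp_cases[OF p x] Qp_cases[OF p y] by metis
  show ?thesis
    unfolding X Y padic_class_add[OF p X(1) Y(1)]
    by (rule LIMSEQ_le[OF padic_norm_class[OF p padic_Cauchy_add[OF p X(1) Y(1)]]
          tendsto_max[OF padic_norm_class[OF p X(1)] padic_norm_class[OF p Y(1)]]])
      (intro exI allI impI padic_abs_add[OF p])
qed

lemma padic_norm_mult:
  assumes p: "prime p" and x: "x \<in> carrier (Qp p)" and y: "y \<in> carrier (Qp p)"
  shows "padic_norm p (x \<otimes>\<^bsub>Qp p\<^esub> y) = padic_norm p x * padic_norm p y"
proof -
  obtain X Y where X: "padic_Cauchy p X" "x = padic_class p X" and Y: "padic_Cauchy p Y" "y = padic_class p Y"
    using Qp_cases[OF p x] Qp_cases[OF p y] by metis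
  show ?thesis
    unfolding X Y padic_class_mult[OF p X(1) Y(1)]
    by (rule LIMSEQ_unique[OF padic_norm_class[OF p padic_Cauchy_mult[OF p X(1) Y(1)]]],
        unfold padic_abs_mult[OF p])
      (intro tendsto_mult padic_norm_class[OF p] X(1) Y(1))
qed

lemma padic_norm_uminus:
  assumes p: "prime p" and x: "x \<in> carrier (Qp p)"
  shows "padic_norm p (\<ominus>\<^bsub>Qp p\<^esub> x) = padic_norm p x"
proof -
  obtain X where X: "padic_Cauchy p X" "x = padic_class p X" using Qp_cases[OF p x] by metis
  show ?thesis
    unfolding X padic_class_uminus[OF p X(1)]
    by (rule LIMSEQ_unique[OF padic_norm_class[OF p padic_Cauchy_uminus[OF p X(1)]]])
      (use padic_norm_class[OF p X(1)] p in simp)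
qed

lemma padic_norm_eq_0:
  assumes p: "prime p" and x: "x \<in> carrier (Qp p)"
  shows "padic_norm p x = 0 \<longleftrightarrow> x = \<zero>\<^bsub>Qp p\<^esub>"
proof
  interpret I: ideal "padic_null p" "padic_Cauchy_ring p" by (rule padic_null_ideal[OF p])
  obtain X where X: "padic_Cauchy p X" "x = padic_class p X" using Qp_cases[OF p x] by metis
  assume "padic_norm p x = 0"
  then have "X \<in> padic_null p" using padic_norm_class[OF p X(1)] X by (simp add: padic_null_def)
  then have "x = padic_null p" unfolding X by (rule I.a_rcos_const)
  then show "x = \<zero>\<^bsub>Qp p\<^esub>" by (simp add: Qp_def FactRing_def)
next
  assume "x = \<zero>\<^bsub>Qp p\<^esub>"
  then show "padic_norm p x = 0"
    using padic_norm_of_rat[OF p, of 0] by (simp add: padic_class_0[OF p] padic_of_rat_def)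
qed

lemma Metric_space_Qp:
  assumes p: "prime p" shows "Metric_space (carrier (Qp p)) (Qp_dist p)"
proof -
  interpret cring "Qp p" by (rule Qp_cring[OF p])
  have sym: "padic_norm p (x \<ominus>\<^bsub>Qp p\<^esub> y) = padic_norm p (y \<ominus>\<^bsub>Qp p\<^esub> x)"
    if "x \<in> carrier (Qp p)" "y \<in> carrier (Qp p)" for x y
  proof -
    have "x \<ominus>\<^bsub>Qp p\<^esub> y = \<ominus>\<^bsub>Qp p\<^esub> (y \<ominus>\<^bsub>Qp p\<^esub> x)" using that by algebra
    then show ?thesis using padic_norm_uminus[OF p, of "y \<ominus>\<^bsub>Qp p\<^esub> x"] that by simp
  qed
  show ?thesis
  proof
    show "0 \<le> Qp_dist p x y" for x y
      by (simp add: Qp_dist_def padic_norm_nonneg[OF p])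
    show "Qp_dist p x y = Qp_dist p y x" for x y
      using sym[of x y] by (auto simp: Qp_dist_def)
    show "Qp_dist p x y = 0 \<longleftrightarrow> x = y" if "x \<in> carrier (Qp p)" "y \<in> carrier (Qp p)" for x y
    proof -
      have "x = (x \<ominus>\<^bsub>Qp p\<^esub> y) \<oplus>\<^bsub>Qp p\<^esub> y" "x \<ominus>\<^bsub>Qp p\<^esub> x = \<zero>\<^bsub>Qp p\<^esub>"
        using that by algebra+
      then have "x \<ominus>\<^bsub>Qp p\<^esub> y = \<zero>\<^bsub>Qp p\<^esub> \<longleftrightarrow> x = y"
        using that by (metis l_zero)
      then show ?thesis using that by (simp add: Qp_dist_def padic_norm_eq_0[OF p])
    qed
    show "Qp_dist p x z \<le> Qp_dist p x y + Qp_dist p y z"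
      if "x \<in> carrier (Qp p)" "y \<in> carrier (Qp p)" "z \<in> carrier (Qp p)" for x y z
    proof -
      have eq: "x \<ominus>\<^bsub>Qp p\<^esub> z = (x \<ominus>\<^bsub>Qp p\<^esub> y) \<oplus>\<^bsub>Qp p\<^esub> (y \<ominus>\<^bsub>Qp p\<^esub> z)"
        using that by algebra
      have "padic_norm p (x \<ominus>\<^bsub>Qp p\<^esub> z)
          \<le> max (padic_norm p (x \<ominus>\<^bsub>Qp p\<^esub> y)) (padic_norm p (y \<ominus>\<^bsub>Qp p\<^esub> z))"
        unfolding eq using that by (intro padic_norm_add[OF p]) auto
      moreover have "padic_norm p (x \<ominus>\<^bsub>Qp p\<^esub> y) \<ge> 0" "padic_norm p (y \<ominus>\<^bsub>Qp p\<^esub> z) \<ge> 0"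
        using that by (auto intro!: padic_norm_nonneg[OF p])
      ultimately show ?thesis using that by (simp add: Qp_dist_def)
    qed
  qed
qed


section \<open>The ring of finite adeles\<close>

lemma Zp_0: "prime p \<Longrightarrow> \<zero>\<^bsub>Qp p\<^esub> \<in> Zp p"
  using padic_norm_of_rat[of p 0] padic_class_closed[OF padic_Cauchy_const, of p 0]
  by (simp add: Zp_def padic_class_0 padic_of_rat_def)

lemma Zp_1: "prime p \<Longrightarrow> \<one>\<^bsub>Qp p\<^esub> \<in> Zp p"
  using padic_norm_of_rat[of p 1] padic_class_closed[OF padic_Cauchy_const, of p 1]
  by (simp add: Zp_def padic_class_1 padic_of_rat_def)

lemma Zp_add: "prime p \<Longrightarrow> x \<in> Zp p \<Longrightarrow> y \<in> Zp p \<Longrightarrow> x \<oplus>\<^bsub>Qp p\<^esub> y \<in> Zp p"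
  using padic_norm_add[of p x y] cring.cring_simprules(1)[OF Qp_cring, of p x y]
  by (auto simp: Zp_def)

lemma Zp_mult: "prime p \<Longrightarrow> x \<in> Zp p \<Longrightarrow> y \<in> Zp p \<Longrightarrow> x \<otimes>\<^bsub>Qp p\<^esub> y \<in> Zp p"
  using padic_norm_mult[of p x y] cring.cring_simprules(5)[OF Qp_cring, of p x y]
    mult_mono[of "padic_norm p x" 1 "padic_norm p y" 1] padic_norm_nonneg[of p y]
  by (auto simp: Zp_def)

lemma Zp_uminus: "prime p \<Longrightarrow> x \<in> Zp p \<Longrightarrow> \<ominus>\<^bsub>Qp p\<^esub> x \<in> Zp p"
  using padic_norm_uminus[of p x] cring.cring_simprules(3)[OF Qp_cring, of p x]
  by (auto simp: Zp_def)

typedef fadele =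
  "{x \<in> \<Pi>\<^sub>E p\<in>{p. prime p}. carrier (Qp p). finite {p. prime p \<and> x p \<notin> Zp p}}"
  morphisms place Abs_fadele
proof
  have "{p. prime p \<and> restrict (\<lambda>p. \<zero>\<^bsub>Qp p\<^esub>) {p. prime p} p \<notin> Zp p} = {}"
    using Zp_0 by auto
  moreover have "\<zero>\<^bsub>Qp p\<^esub> \<in> carrier (Qp p)" if "prime p" for p
    using Zp_0[OF that] by (simp add: Zp_def)
  ultimately show "restrict (\<lambda>p. \<zero>\<^bsub>Qp p\<^esub>) {p. prime p} \<in>
    {x \<in> \<Pi>\<^sub>E p\<in>{p. prime p}. carrier (Qp p). finite {p. prime p \<and> x p \<notin> Zp p}}"
    by (simp only: mem_Collect_eq finite.emptyI) auto
qed

lemma place_closed: "prime p \<Longrightarrow> place x p \<in> carrier (Qp p)"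
  using place[of x] by auto

lemma place_finite: "finite {p. prime p \<and> place x p \<notin> Zp p}"
  using place[of x] by auto

lemma fadele_eqI: "(\<And>p. prime p \<Longrightarrow> place x p = place y p) \<Longrightarrow> x = y"
  using place[of x] place[of y] by (auto intro: PiE_ext simp flip: place_inject)

definition of_places :: "(nat \<Rightarrow> (nat \<Rightarrow> rat) set) \<Rightarrow> fadele" where
  "of_places f = Abs_fadele (restrict f {p. prime p})"

lemma place_of_places:
  assumes "\<And>p. prime p \<Longrightarrow> f p \<in> carrier (Qp p)"
    and "finite A" and "\<And>p. prime p \<Longrightarrow> p \<notin> A \<Longrightarrow> f p \<in> Zp p"
    and "prime q"
  shows "place (of_places f) q = f q"
proof -
  have "finite {p. prime p \<and> restrict f {p. prime p} p \<notin> Zp p}"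
    by (rule finite_subset[OF _ assms(2)]) (use assms(3) in auto)
  then show ?thesis using assms by (simp add: of_places_def Abs_fadele_inverse)
qed

instantiation fadele :: comm_ring_1
begin

definition zero_fadele :: fadele where "0 = of_places (\<lambda>p. \<zero>\<^bsub>Qp p\<^esub>)"
definition one_fadele :: fadele where "1 = of_places (\<lambda>p. \<one>\<^bsub>Qp p\<^esub>)"
definition plus_fadele :: "fadele \<Rightarrow> fadele \<Rightarrow> fadele" where
  "x + y = of_places (\<lambda>p. place x p \<oplus>\<^bsub>Qp p\<^esub> place y p)"
definition times_fadele :: "fadele \<Rightarrow> fadele \<Rightarrow> fadele" where
  "x * y = of_places (\<lambda>p. place x p \<otimes>\<^bsub>Qp p\<^esub> place y p)"
definition uminus_fadele :: "fadele \<Rightarrow> fadele" where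
  "- x = of_places (\<lambda>p. \<ominus>\<^bsub>Qp p\<^esub> place x p)"
definition minus_fadele :: "fadele \<Rightarrow> fadele \<Rightarrow> fadele" where
  "x - y = of_places (\<lambda>p. place x p \<ominus>\<^bsub>Qp p\<^esub> place y p)"

lemma place_zero: "prime p \<Longrightarrow> place 0 p = \<zero>\<^bsub>Qp p\<^esub>"
  unfolding zero_fadele_def
  by (rule place_of_places[where A = "{}"]) (use Zp_0 in \<open>auto simp: Zp_def\<close>)

lemma place_one: "prime p \<Longrightarrow> place 1 p = \<one>\<^bsub>Qp p\<^esub>"
  unfolding one_fadele_def
  by (rule place_of_places[where A = "{}"]) (use Zp_1 in \<open>auto simp: Zp_def\<close>)

lemma place_plus: "prime p \<Longrightarrow> place (x + y) p = place x p \<oplus>\<^bsub>Qp p\<^esub> place y p"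
  unfolding plus_fadele_def
  by (rule place_of_places[OF _ finite_UnI[OF place_finite[of x] place_finite[of y]]])
    (auto simp: Zp_add cring.cring_simprules(1)[OF Qp_cring] place_closed)

lemma place_times: "prime p \<Longrightarrow> place (x * y) p = place x p \<otimes>\<^bsub>Qp p\<^esub> place y p"
  unfolding times_fadele_def
  by (rule place_of_places[OF _ finite_UnI[OF place_finite[of x] place_finite[of y]]])
    (auto simp: Zp_mult cring.cring_simprules(5)[OF Qp_cring] place_closed)

lemma place_uminus: "prime p \<Longrightarrow> place (- x) p = \<ominus>\<^bsub>Qp p\<^esub> place x p"
  unfolding uminus_fadele_def
  by (rule place_of_places[OF _ place_finite[of x]])
    (auto simp: Zp_uminus cring.cring_simprules(3)[OF Qp_cring] place_closed)

lemma place_minus: "prime p \<Longrightarrow> place (x - y) p = place x p \<ominus>\<^bsub>Qp p\<^esub> place y p"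
  unfolding minus_fadele_def a_minus_def
  by (rule place_of_places[OF _ finite_UnI[OF place_finite[of x] place_finite[of y]]])
    (auto simp: Zp_add Zp_uminus cring.cring_simprules(1,3)[OF Qp_cring] place_closed)

instance
proof
  fix x y z :: fadele
  show "x * y * z = x * (y * z)"
  proof (rule fadele_eqI)
    fix p :: nat assume p: "prime p"
    interpret cring "Qp p" by (rule Qp_cring[OF p])
    show "place (x * y * z) p = place (x * (y * z)) p"
      using p by (simp add: place_closed place_times m_assoc)
  qed
  show "x * y = y * x"
  proof (rule fadele_eqI)
    fix p :: nat assume p: "prime p"
    interpret cring "Qp p" by (rule Qp_cring[OF p])
    show "place (x * y) p = place (y * x) p"
      using p by (simp add: place_closed place_times m_comm)
  qed
  show "1 * x = x"
  proof (rule fadele_eqI)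
    fix p :: nat assume p: "prime p"
    interpret cring "Qp p" by (rule Qp_cring[OF p])
    show "place (1 * x) p = place (x) p"
      using p by (simp add: place_closed place_times place_one)
  qed
  show "x + y + z = x + (y + z)"
  proof (rule fadele_eqI)
    fix p :: nat assume p: "prime p"
    interpret cring "Qp p" by (rule Qp_cring[OF p])
    show "place (x + y + z) p = place (x + (y + z)) p"
      using p by (simp add: place_closed place_plus a_assoc)
  qed
  show "x + y = y + x"
  proof (rule fadele_eqI)
    fix p :: nat assume p: "prime p"
    interpret cring "Qp p" by (rule Qp_cring[OF p])
    show "place (x + y) p = place (y + x) p"
      using p by (simp add: place_closed place_plus a_comm)
  qed
  show "0 + x = x"
  proof (rule fadele_eqI)
    fix p :: nat assume p: "prime p"
    interpret cring "Qp p" by (rule Qp_cring[OF p])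
    show "place (0 + x) p = place (x) p"
      using p by (simp add: place_closed place_plus place_zero)
  qed
  show "- x + x = 0"
  proof (rule fadele_eqI)
    fix p :: nat assume p: "prime p"
    interpret cring "Qp p" by (rule Qp_cring[OF p])
    show "place (- x + x) p = place (0) p"
      using p by (simp add: place_closed place_plus place_uminus place_zero l_neg)
  qed
  show "x - y = x + - y"
  proof (rule fadele_eqI)
    fix p :: nat assume p: "prime p"
    interpret cring "Qp p" by (rule Qp_cring[OF p])
    show "place (x - y) p = place (x + - y) p"
      using p by (simp add: place_closed place_plus place_uminus place_minus a_minus_def)
  qed
  show "(x + y) * z = x * z + y * z"
  proof (rule fadele_eqI)
    fix p :: nat assume p: "prime p"
    interpret cring "Qp p" by (rule Qp_cring[OF p])
    show "place ((x + y) * z) p = place (x * z + y * z) p"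
      using p by (simp add: place_closed place_plus place_times l_distr)
  qed
  show "(0::fadele) \<noteq> 1"
  proof
    assume "(0::fadele) = 1"
    then have "padic_of_rat 2 0 = padic_of_rat 2 1"
      using place_zero[of 2] place_one[of 2]
      by (simp add: padic_class_0 padic_class_1 padic_of_rat_def)
    then show False
      using padic_norm_of_rat[of 2 0] padic_norm_of_rat[of 2 1] by simp
  qed
qed

end

instantiation fadele :: topological_space
begin

definition open_fadele :: "fadele set \<Rightarrow> bool" where
  "open_fadele = generate_topology
     {{x. \<forall>p. prime p \<longrightarrow> place x p \<in> U p} | U.
        (\<forall>p. prime p \<longrightarrow> openin (Qp_topology p) (U p)) \<and> finite {p. prime p \<and> U p \<noteq> Zp p}}"

instance
  by standard (auto simp: open_fadele_def intro: generate_topology.intros)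

end

text \<open>
  The finite adeles are locally compact and second countable, so a translation invariant Borel
  measure with this normalisation is automatically finite on compact sets and regular.
\<close>

definition adelic_Haar :: "fadele measure \<Rightarrow> bool" where
  "adelic_Haar \<mu> \<longleftrightarrow> sets \<mu> = sets borel \<and>
     (\<forall>a. \<forall>B\<in>sets borel. emeasure \<mu> ((\<lambda>x. a + x) ` B) = emeasure \<mu> B) \<and>
     emeasure \<mu> {x. \<forall>p. prime p \<longrightarrow> place x p \<in> Zp p} = 1"


section \<open>Fourier transform and function spaces\<close>

text \<open>
  Products over all primes are written with \<^const>\<open>prodinf\<close>; in all uses below only finitely
  many factors differ from \<open>1\<close> at any given adele.
\<close>

definition fourier :: "fadele measure \<Rightarrow> (fadele \<Rightarrow> complex) \<Rightarrow> fadele \<Rightarrow> complex" where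
  "fourier \<mu> \<phi> \<xi> =
     (\<integral>x. (\<Prod>p. if prime p then padic_char p (place \<xi> p \<otimes>\<^bsub>Qp p\<^esub> place x p) else 1) * \<phi> x \<partial>\<mu>)"

definition padic_test_functions :: "nat \<Rightarrow> ((nat \<Rightarrow> rat) set \<Rightarrow> complex) set" where
  "padic_test_functions p = {\<eta>.
     (\<forall>x\<in>carrier (Qp p). \<exists>U. openin (Qp_topology p) U \<and> x \<in> U \<and> (\<forall>y\<in>U. \<eta> y = \<eta> x)) \<and>
     compactin (Qp_topology p) (Qp_topology p closure_of {x \<in> carrier (Qp p). \<eta> x \<noteq> 0})}"

definition linear_combinations :: "('a \<Rightarrow> complex) set \<Rightarrow> ('a \<Rightarrow> complex) set" where
  "linear_combinations B = {(\<lambda>x. \<Sum>f\<in>T. c f * f x) | T c. finite T \<and> T \<subseteq> B}"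

definition Psi :: "nat \<Rightarrow> (fadele \<Rightarrow> complex) set" where
  "Psi m =
     {\<psi> \<in> linear_combinations
        {(\<lambda>\<xi>. \<Prod>p. if prime p then \<eta> p (place \<xi> p) else 1) | \<eta>.
           (\<forall>p. prime p \<longrightarrow> \<eta> p \<in> padic_test_functions p) \<and>
           (\<forall>p t. prime p \<longrightarrow> m < p \<longrightarrow> t \<in> carrier (Qp p) \<longrightarrow> \<eta> p t = Omega (padic_norm p t))}.
      \<forall>\<xi> r. prime r \<longrightarrow> r \<le> m \<longrightarrow> place \<xi> r = \<zero>\<^bsub>Qp r\<^esub> \<longrightarrow> \<psi> \<xi> = 0}"

definition Phi_level :: "fadele measure \<Rightarrow> nat \<Rightarrow> (fadele \<Rightarrow> complex) set" where
  "Phi_level \<mu> m = fourier \<mu> ` Psi m"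

definition Phi :: "fadele measure \<Rightarrow> (fadele \<Rightarrow> complex) set" where
  "Phi \<mu> = linear_combinations (\<Union>m\<in>{m. prime m}. Phi_level \<mu> m)"


section \<open>The adelic fractional operator\<close>

text \<open>
  Note that \<open>0 powr \<gamma> = 0\<close> for every complex \<open>\<gamma>\<close>, including \<open>\<gamma> = 0\<close>, so the symbol vanishes where
  some \<open>\<xi>\<^sub>q = 0\<close> with \<open>q \<le> m\<close>.
\<close>

definition frac_symbol :: "(nat \<Rightarrow> complex) \<Rightarrow> nat \<Rightarrow> fadele \<Rightarrow> complex" where
  "frac_symbol \<gamma> m \<xi> =
     (\<Prod>q | prime q \<and> q \<le> m. complex_of_real (padic_norm q (place \<xi> q)) powr \<gamma> q) *
     (\<Prod>q. if prime q \<and> m < q then Omega (padic_norm q (place \<xi> q)) else 1)"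

text \<open>
  \<open>F\<^sup>-\<^sup>1\<close> is the inverse of the bijection \<open>F\<close> from \<open>\<Phi>\<^bsup>[m]\<^esup>\<close> to \<open>\<Psi>\<^bsup>[m]\<^esup>\<close>
  (surjectivity holds since \<open>F (F \<psi>)\<close> is the reflection of \<open>\<psi>\<close>).
\<close>

definition frac_op_level ::
    "fadele measure \<Rightarrow> (nat \<Rightarrow> complex) \<Rightarrow> nat \<Rightarrow> (fadele \<Rightarrow> complex) \<Rightarrow> fadele \<Rightarrow> complex" where
  "frac_op_level \<mu> \<gamma> m \<zeta> =
     the_inv_into (Phi_level \<mu> m) (fourier \<mu>) (\<lambda>\<xi>. frac_symbol \<gamma> m \<xi> * fourier \<mu> \<zeta> \<xi>)"

text \<open>
  The linear extension to \<open>\<Phi>\<close>: the value at \<open>f\<close> is computed from any decomposition of \<open>f\<close> into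
  finitely many elements of the spaces \<open>\<Phi>\<^bsup>[m]\<^esup>\<close>, whose sum is direct.
\<close>

definition frac_op ::
    "fadele measure \<Rightarrow> (nat \<Rightarrow> complex) \<Rightarrow> (fadele \<Rightarrow> complex) \<Rightarrow> fadele \<Rightarrow> complex" where
  "frac_op \<mu> \<gamma> f = (THE g. \<exists>S \<zeta>. finite S \<and> (\<forall>m\<in>S. prime m \<and> \<zeta> m \<in> Phi_level \<mu> m) \<and>
     f = (\<lambda>x. \<Sum>m\<in>S. \<zeta> m x) \<and> g = (\<lambda>x. \<Sum>m\<in>S. frac_op_level \<mu> \<gamma> m (\<zeta> m) x))"


section \<open>Adelic wavelets\<close>

definition adelic_wavelet ::
    "nat \<Rightarrow> (nat \<Rightarrow> nat) \<Rightarrow> (nat \<Rightarrow> nat) \<Rightarrow> (nat \<Rightarrow> (nat \<Rightarrow> rat) set) \<Rightarrow> fadele \<Rightarrow> complex" where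
  "adelic_wavelet m k j a x =
     (\<Prod>q | prime q \<and> q \<le> m.
        let y = padic_of_rat q (1 / of_nat q ^ j q) \<otimes>\<^bsub>Qp q\<^esub> place x q \<ominus>\<^bsub>Qp q\<^esub> a q
        in complex_of_real (real q powr (real (j q) / 2)) *
           padic_char q (padic_of_rat q (of_nat (k q) / of_nat q) \<otimes>\<^bsub>Qp q\<^esub> y) *
           Omega (padic_norm q y)) *
     (\<Prod>q. if prime q \<and> m < q then Omega (padic_norm q (place x q)) else 1)"

end

theory Submission
  imports Defs
begin

text \<open>
  Put \<open>W(b, c, v)(x) = \<chi>(b x) 1[v (x - c) integral]\<close> for an invertible adele \<open>v\<close> with inverse \<open>u\<close>.
  Translation invariance and the nontriviality of \<open>\<chi>\<close> off the integral adeles show that the Fourier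
  transform of \<open>W(b, c, v)\<close> is a nonzero multiple of \<open>W(c, - b, u)\<close>. The multiple involves the
  measure of \<open>u\<close> times the integral adeles, which only has to be positive and finite; this follows from
  commensurability, so its value is never computed. Every Schwartz-Bruhat function is a finite
  combination of functions \<open>W(0, c, v)\<close> with one fixed \<open>v\<close>, hence applying the transform twice gives a
  nonzero multiple of the reflection, and the transform is injective. The wavelet is itself a
  multiple of some \<open>W(b, c, v)\<close>; its transform lives where \<open>|\<xi>\<^sub>q|\<^sub>q = q^(j\<^sub>q + 1)\<close> for \<open>q \<le> m\<close>, and there the
  symbol of the operator is constant. The operator is well defined because the levels are
  linearly independent.
\<close>

section \<open>Rational approximation in the p-adic numbers\<close>

text \<open>The measure \<open>\<mu>\<close> is known only through translation invariance and its
  normalisation, not as a product measure, so transforms cannot be computed place by place;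
  integrals are global, and places enter through the algebra of the lattices u \<open>Zhat\<close>.
  The definitions shape the rest. Elements of \<open>Phi_level\<close> are themselves transforms, so
  inverting \<open>fourier\<close> there means injectivity of the double transform on
  \<open>Psi m\<close>. \<open>frac_op\<close> is a definite description over all decompositions, so
  besides the computation inside one level the decomposition of a nonzero element of that level must
  be shown unique. Membership of the wavelet in \<open>Phi_level\<close> needs an explicit preimage:
  by the swap of parameters under the transform, a multiple of W(-c, b, u) is one. The inequality
  |u|_q |b|_q = q > 1 for q <= m, which rests on q not dividing k_q, does double duty: it keeps zero
  coordinates out of the coset of that preimage, as \<open>Psi m\<close> demands, and it fixes
  |\<xi>|_q on the support of the transform of the wavelet.\<close>

lemma padic_of_rat_closed: "padic_of_rat p r \<in> carrier (Qp p)"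
  by (simp add: padic_of_rat_def padic_class_closed padic_Cauchy_const)

lemma padic_of_rat_add:
  "prime p \<Longrightarrow> padic_of_rat p r \<oplus>\<^bsub>Qp p\<^esub> padic_of_rat p s = padic_of_rat p (r + s)"
  by (simp add: padic_of_rat_def padic_class_add padic_Cauchy_const)

lemma padic_of_rat_mult:
  "prime p \<Longrightarrow> padic_of_rat p r \<otimes>\<^bsub>Qp p\<^esub> padic_of_rat p s = padic_of_rat p (r * s)"
  by (simp add: padic_of_rat_def padic_class_mult padic_Cauchy_const)

lemma padic_of_rat_uminus:
  "prime p \<Longrightarrow> \<ominus>\<^bsub>Qp p\<^esub> padic_of_rat p r = padic_of_rat p (- r)"
  by (simp add: padic_of_rat_def padic_class_uminus padic_Cauchy_const)

lemma padic_of_rat_diff: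
  "prime p \<Longrightarrow> padic_of_rat p r \<ominus>\<^bsub>Qp p\<^esub> padic_of_rat p s = padic_of_rat p (r - s)"
  by (simp add: a_minus_def padic_of_rat_uminus padic_of_rat_add)

lemma padic_of_rat_0: "prime p \<Longrightarrow> padic_of_rat p 0 = \<zero>\<^bsub>Qp p\<^esub>"
  by (simp add: padic_of_rat_def padic_class_0)

lemma padic_of_rat_1: "padic_of_rat p 1 = \<one>\<^bsub>Qp p\<^esub>"
  by (simp add: padic_of_rat_def padic_class_1)

lemma padic_of_rat_in_Zp: "prime p \<Longrightarrow> padic_of_rat p r \<in> Zp p \<longleftrightarrow> padic_abs p r \<le> 1"
  by (simp add: Zp_def padic_of_rat_closed padic_norm_of_rat)

lemma Zp_carrier: "x \<in> Zp p \<Longrightarrow> x \<in> carrier (Qp p)"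
  by (simp add: Zp_def)

lemma Zp_diff: "prime p \<Longrightarrow> x \<in> Zp p \<Longrightarrow> y \<in> Zp p \<Longrightarrow> x \<ominus>\<^bsub>Qp p\<^esub> y \<in> Zp p"
  by (simp add: a_minus_def Zp_add Zp_uminus)

lemma padic_norm_diff:
  assumes "prime p" "x \<in> carrier (Qp p)" "y \<in> carrier (Qp p)"
  shows "padic_norm p (x \<ominus>\<^bsub>Qp p\<^esub> y) \<le> max (padic_norm p x) (padic_norm p y)"
  using assms padic_norm_add[of p x "\<ominus>\<^bsub>Qp p\<^esub> y"] cring.cring_simprules(3)[OF Qp_cring, of p y]
  by (simp add: a_minus_def padic_norm_uminus)

lemma padic_norm_diff_triangle:
  assumes p: "prime p" and "x \<in> carrier (Qp p)" "y \<in> carrier (Qp p)" "z \<in> carrier (Qp p)"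
  shows "padic_norm p (x \<ominus>\<^bsub>Qp p\<^esub> z) \<le>
    max (padic_norm p (x \<ominus>\<^bsub>Qp p\<^esub> y)) (padic_norm p (y \<ominus>\<^bsub>Qp p\<^esub> z))"
proof -
  interpret cring "Qp p" by (rule Qp_cring[OF p])
  have "x \<ominus>\<^bsub>Qp p\<^esub> z = (x \<ominus>\<^bsub>Qp p\<^esub> y) \<oplus>\<^bsub>Qp p\<^esub> (y \<ominus>\<^bsub>Qp p\<^esub> z)" using assms by algebra
  then show ?thesis using assms padic_norm_add[OF p, of "x \<ominus>\<^bsub>Qp p\<^esub> y" "y \<ominus>\<^bsub>Qp p\<^esub> z"] by simp
qed

lemma padic_norm_diff_commute:
  assumes p: "prime p" and "x \<in> carrier (Qp p)" "y \<in> carrier (Qp p)"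
  shows "padic_norm p (x \<ominus>\<^bsub>Qp p\<^esub> y) = padic_norm p (y \<ominus>\<^bsub>Qp p\<^esub> x)"
proof -
  interpret cring "Qp p" by (rule Qp_cring[OF p])
  have "x \<ominus>\<^bsub>Qp p\<^esub> y = \<ominus>\<^bsub>Qp p\<^esub> (y \<ominus>\<^bsub>Qp p\<^esub> x)" using assms by algebra
  then show ?thesis using padic_norm_uminus[OF p, of "y \<ominus>\<^bsub>Qp p\<^esub> x"] assms by simp
qed

lemma padic_norm_eqI:
  assumes p: "prime p" and "x \<in> carrier (Qp p)" "y \<in> carrier (Qp p)"
    and "padic_norm p (x \<ominus>\<^bsub>Qp p\<^esub> y) < padic_norm p y"
  shows "padic_norm p x = padic_norm p y"
proof -
  interpret cring "Qp p" by (rule Qp_cring[OF p])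
  have "x = (x \<ominus>\<^bsub>Qp p\<^esub> y) \<oplus>\<^bsub>Qp p\<^esub> y" "y = x \<ominus>\<^bsub>Qp p\<^esub> (x \<ominus>\<^bsub>Qp p\<^esub> y)"
    using assms by algebra+
  then have "padic_norm p x \<le> max (padic_norm p (x \<ominus>\<^bsub>Qp p\<^esub> y)) (padic_norm p y)"
    "padic_norm p y \<le> max (padic_norm p x) (padic_norm p (x \<ominus>\<^bsub>Qp p\<^esub> y))"
    using padic_norm_add[OF p, of "x \<ominus>\<^bsub>Qp p\<^esub> y" y] padic_norm_diff[OF p, of x "x \<ominus>\<^bsub>Qp p\<^esub> y"] assms
    by simp_all
  then show ?thesis using assms(4) by linarith
qed

lemma padic_abs_of_int_le_iff:
  assumes p: "prime p"
  shows "padic_abs p (of_int a) \<le> 1 / real p ^ n \<longleftrightarrow> int p ^ n dvd a"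
proof (cases "a = 0")
  case False
  have p1: "real p > 1" using prime_gt_1_nat[OF p] by simp
  have "padic_abs p (of_int a) = real p powi (- int (multiplicity (int p) a))"
    using padic_abs_of_int_div[OF p False, of 1] by simp
  then have "padic_abs p (of_int a) = 1 / real p ^ multiplicity (int p) a"
    by (simp add: power_int_minus field_simps)
  then have "padic_abs p (of_int a) \<le> 1 / real p ^ n \<longleftrightarrow> n \<le> multiplicity (int p) a"
    using p1 by (simp add: divide_inverse)
  also have "\<dots> \<longleftrightarrow> int p ^ n dvd a"
    using False prime_gt_1_nat[OF p] by (intro power_dvd_iff_le_multiplicity[symmetric]) auto
  finally show ?thesis .
qed auto

lemma padic_abs_of_int_le_1: "prime p \<Longrightarrow> padic_abs p (of_int a) \<le> 1"
  using padic_abs_of_int_le_iff[of p a 0] by simp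

lemma padic_abs_of_nat_le_1: "prime p \<Longrightarrow> padic_abs p (of_nat a) \<le> 1"
  using padic_abs_of_int_le_1[of p "int a"] by simp

lemma padic_abs_of_int_eq_1:
  assumes "prime p" "\<not> int p dvd a" shows "padic_abs p (of_int a) = 1"
proof -
  have "a \<noteq> 0" using assms by auto
  then show ?thesis
    using padic_abs_of_int_div[OF assms(1), of a 1] assms by (simp add: not_dvd_imp_multiplicity_0)
qed

lemma padic_abs_of_nat_eq_1:
  "prime p \<Longrightarrow> \<not> p dvd n \<Longrightarrow> padic_abs p (of_nat n) = 1"
  using padic_abs_of_int_eq_1[of p "int n"] by simp

lemma padic_abs_inverse:
  assumes p: "prime p" shows "padic_abs p (1 / r) = 1 / padic_abs p r"
proof (cases "r = 0")
  case False
  then have "padic_abs p (1 / r) * padic_abs p r = 1"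
    using padic_abs_mult[OF p, of "1 / r" r] p by simp
  then show ?thesis using False p by (simp add: field_simps)
qed simp

lemma padic_abs_power: "prime p \<Longrightarrow> padic_abs p (r ^ n) = padic_abs p r ^ n"
  by (induction n) (simp_all add: padic_abs_mult)

lemma padic_abs_prime: assumes p: "prime p" shows "padic_abs p (of_nat p) = 1 / real p"
proof -
  have "int p \<noteq> 0" "\<not> is_unit (int p)" using prime_gt_1_nat[OF p] by auto
  then have "multiplicity (int p) (int p) = 1" by (rule multiplicity_self)
  then show ?thesis using padic_abs_of_int_div[OF p, of "int p" 1] \<open>int p \<noteq> 0\<close>
    by (simp add: power_int_minus field_simps)
qed

lemma padic_approx_rat:
  assumes p: "prime p" and x: "x \<in> carrier (Qp p)" and e: "e > 0"
  obtains r where "padic_norm p (x \<ominus>\<^bsub>Qp p\<^esub> padic_of_rat p r) < e"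
proof -
  obtain X where X: "padic_Cauchy p X" "x = padic_class p X" using Qp_cases[OF p x] by metis
  \<comment> \<open>Half of \<open>e\<close>, because passing to the limit of norms keeps only a
    weak inequality.\<close>
  obtain N where N: "\<And>i k. i \<ge> N \<Longrightarrow> k \<ge> N \<Longrightarrow> padic_abs p (X i - X k) < e / 2"
    using X(1) e unfolding padic_Cauchy_def by (meson half_gt_zero)
  have C: "padic_Cauchy p (\<lambda>n. - X N)" by (rule padic_Cauchy_const)
  have eq: "x \<ominus>\<^bsub>Qp p\<^esub> padic_of_rat p (X N) = padic_class p (\<lambda>n. X n + - X N)"
    unfolding a_minus_def X padic_of_rat_def padic_class_uminus[OF p padic_Cauchy_const]
    by (rule padic_class_add[OF p X(1) C])
  have "padic_norm p (padic_class p (\<lambda>n. X n + - X N)) \<le> e / 2"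
    by (rule LIMSEQ_le_const2[OF padic_norm_class[OF p padic_Cauchy_add[OF p X(1) C]]])
      (use N in \<open>auto intro!: exI[of _ N] less_imp_le\<close>)
  then show ?thesis using that[of "X N"] e eq by simp
qed

text \<open>A rational a/b close to \<open>x\<close> has norm at most 1, so \<open>p\<close> does
  not divide the reduced denominator; then \<open>b\<close> is invertible modulo p^n, and
  \<open>a\<close> times that inverse, reduced modulo p^n, is the required number. This supplies the
  digits for fractional parts, for compactness and for residues of integral adeles.\<close>

lemma padic_approx_nat:
  assumes p: "prime p" and x: "x \<in> Zp p"
  obtains A where "A < p ^ n"
    "padic_norm p (x \<ominus>\<^bsub>Qp p\<^esub> padic_of_rat p (of_nat A)) \<le> 1 / real p ^ n"
proof -
  interpret cring "Qp p" by (rule Qp_cring[OF p])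
  have p0: "p > 0" using prime_gt_0_nat[OF p] .
  have xc: "x \<in> carrier (Qp p)" using x by (rule Zp_carrier)
  obtain r where r: "padic_norm p (x \<ominus>\<^bsub>Qp p\<^esub> padic_of_rat p r) < 1 / real p ^ n"
    using padic_approx_rat[OF p xc, of "1 / real p ^ n"] p0 by auto
  have "padic_abs p r \<le> 1"
  proof -
    have "padic_of_rat p r = x \<ominus>\<^bsub>Qp p\<^esub> (x \<ominus>\<^bsub>Qp p\<^esub> padic_of_rat p r)"
      using xc padic_of_rat_closed[of p r] by algebra
    then have "padic_norm p (padic_of_rat p r)
        \<le> max (padic_norm p x) (padic_norm p (x \<ominus>\<^bsub>Qp p\<^esub> padic_of_rat p r))"
      using padic_norm_diff[OF p xc, of "x \<ominus>\<^bsub>Qp p\<^esub> padic_of_rat p r"] xc padic_of_rat_closed[of p r]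
      by simp
    moreover have "1 / real p ^ n \<le> 1" using p0 by (simp add: Suc_leI)
    ultimately show ?thesis using r x by (auto simp: padic_norm_of_rat[OF p] Zp_def le_max_iff_disj)
  qed
  obtain a b where ab: "quotient_of r = (a, b)" by force
  have b: "b > 0" "coprime a b" "r = of_int a / of_int b"
    using quotient_of_denom_pos[OF ab] quotient_of_coprime[OF ab] quotient_of_div[OF ab] by auto
  have nd: "\<not> int p dvd b"
  proof
    assume pb: "int p dvd b"
    then have na: "\<not> int p dvd a"
      using b(2) p by (metis coprime_common_divisor not_prime_unit prime_nat_int_transfer)
    have "padic_abs p (of_int a) = padic_abs p r * padic_abs p (of_int b)"
      using b by (simp flip: padic_abs_mult[OF p])
    also have "\<dots> \<le> 1 * (1 / real p ^ 1)"
      using \<open>padic_abs p r \<le> 1\<close> padic_abs_of_int_le_iff[OF p, of b 1] pb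
      by (intro mult_mono) auto
    finally show False using padic_abs_of_int_le_iff[OF p, of a 1] na by simp
  qed
  have "coprime b (int p ^ n)"
    using nd p by (metis coprime_commute coprime_power_left_iff prime_imp_coprime prime_nat_int_transfer)
  then obtain u v where uv: "u * b + v * int p ^ n = 1" using bezout_int[of b "int p ^ n"] by auto
  define A where "A = nat (a * u mod int p ^ n)"
  have pn: "int p ^ n > 0" using p0 by simp
  have intA: "int A = a * u mod int p ^ n" using pn by (simp add: A_def)
  then have "int A < int p ^ n" using pn by simp
  then have "A < p ^ n" by (simp flip: of_nat_power)
  have "int p ^ n dvd a - b * int A"
  proof -
    have "a - b * (a * u) = a * v * int p ^ n"
      using arg_cong[OF uv, of "\<lambda>t. a * t"] by (simp add: algebra_simps)
    moreover have "a * u - int A = int p ^ n * (a * u div int p ^ n)"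
      unfolding intA by (simp add: minus_mod_eq_mult_div)
    moreover have "a - b * int A = (a - b * (a * u)) + b * (a * u - int A)"
      by (simp add: algebra_simps)
    ultimately have "a - b * int A = int p ^ n * (a * v + b * (a * u div int p ^ n))"
      by (simp add: distrib_left mult_ac)
    then show ?thesis by simp
  qed
  then have "padic_abs p (of_int (a - b * int A)) \<le> 1 / real p ^ n"
    using padic_abs_of_int_le_iff[OF p] by blast
  \<comment> \<open>\<open>b\<close> has norm 1, so multiplying by it clears the denominator without
    changing the norm.\<close>
  moreover have "(r - of_nat A) * of_int b = of_int (a - b * int A)"
    using b by (simp add: field_simps)
  then have "padic_abs p (of_int (a - b * int A)) = padic_abs p (r - of_nat A)"
    using padic_abs_mult[OF p, of "r - of_nat A" "of_int b"] padic_abs_of_int_eq_1[OF p nd] by simp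
  ultimately have "padic_abs p (r - of_nat A) \<le> 1 / real p ^ n" by simp
  then have "padic_norm p (padic_of_rat p r \<ominus>\<^bsub>Qp p\<^esub> padic_of_rat p (of_nat A)) \<le> 1 / real p ^ n"
    by (simp add: padic_of_rat_diff[OF p] padic_norm_of_rat[OF p])
  then have "padic_norm p (x \<ominus>\<^bsub>Qp p\<^esub> padic_of_rat p (of_nat A)) \<le> 1 / real p ^ n"
    using padic_norm_diff_triangle[OF p xc padic_of_rat_closed[of p r] padic_of_rat_closed[of p "of_nat A"]] r
    by auto
  with \<open>A < p ^ n\<close> show ?thesis by (rule that)
qed

lemma padic_norm_le_power:
  assumes "prime p" obtains n where "padic_norm p x \<le> real p ^ n"
  using real_arch_pow[of "real p" "padic_norm p x"] prime_gt_1_nat[OF assms] less_imp_le by auto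

section \<open>Fractional parts and characters\<close>

text \<open>Base \<open>p\<close> expansion of the numerator. A single quotient A / p^n with A < p^n
  is easier to compare and to add than a digit sum.\<close>

lemma digit_fractions_eq:
  assumes p: "prime p"
  shows "digit_fractions p = {of_nat A / of_nat p ^ n | A n. A < p ^ n}"
proof -
  have p0: "p > 0" using prime_gt_0_nat[OF p] .
  have 1: "\<exists>A<p ^ n. (\<Sum>i=1..n. of_nat (d i) / of_nat p ^ i) = (of_nat A / of_nat p ^ n :: rat)"
    if d: "\<And>i. d i < p" for d :: "nat \<Rightarrow> nat" and n
  proof (induction n)
    case (Suc n)
    then obtain A where A: "A < p ^ n"
      "(\<Sum>i=1..n. of_nat (d i) / of_nat p ^ i) = (of_nat A / of_nat p ^ n :: rat)" by auto
    have "Suc A * p \<le> p ^ n * p" using A by (intro mult_right_mono) auto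
    then have "A * p + d (Suc n) < p ^ Suc n" using d[of "Suc n"] by (simp add: mult.commute)
    moreover have "(\<Sum>i=1..Suc n. of_nat (d i) / of_nat p ^ i)
        = (of_nat (A * p + d (Suc n)) / of_nat p ^ Suc n :: rat)"
      using A p0 by (simp add: field_simps)
    ultimately show ?case by metis
  qed simp
  have 2: "\<exists>d. (\<forall>i. d i < p) \<and> of_nat A / of_nat p ^ n = (\<Sum>i=1..n. of_nat (d i) / of_nat p ^ i :: rat)"
    if "A < p ^ n" for A n
    using that
  proof (induction n arbitrary: A)
    case 0
    then show ?case using p0 by (auto intro!: exI[of _ "\<lambda>_. 0"])
  next
    case (Suc n)
    have "A div p < p ^ n" using Suc.prems by (intro less_mult_imp_div_less) (simp add: mult.commute)
    then obtain d where d: "\<And>i. d i < p"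
      "of_nat (A div p) / of_nat p ^ n = (\<Sum>i=1..n. of_nat (d i) / of_nat p ^ i :: rat)"
      using Suc.IH by blast
    \<comment> \<open>The last digit is \<open>A mod p\<close>; the earlier ones expand
      \<open>A div p\<close>.\<close>
    let ?d = "d(Suc n := A mod p)"
    have "(\<Sum>i=1..n. of_nat (?d i) / of_nat p ^ i :: rat) = (\<Sum>i=1..n. of_nat (d i) / of_nat p ^ i)"
      by (intro sum.cong) auto
    then have "(\<Sum>i=1..Suc n. of_nat (?d i) / of_nat p ^ i :: rat)
        = of_nat (A div p) / of_nat p ^ n + of_nat (A mod p) / of_nat p ^ Suc n"
      using d(2) by simp
    also have "\<dots> = of_nat (A div p * p + A mod p) / of_nat p ^ Suc n"
      unfolding of_nat_add of_nat_mult using p0 by (simp add: field_simps)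
    finally show ?case using d(1) p0 by (intro exI[of _ ?d]) auto
  qed
  show ?thesis
  proof (intro equalityI subsetI)
    fix r assume "r \<in> digit_fractions p"
    then obtain d n where "r = (\<Sum>i=1..n. of_nat (d i) / of_nat p ^ i)" "\<And>i. d i < p"
      unfolding digit_fractions_def by blast
    then show "r \<in> {of_nat A / of_nat p ^ n | A n. A < p ^ n}" using 1[of d n] by blast
  next
    fix r :: rat assume "r \<in> {of_nat A / of_nat p ^ n | A n. A < p ^ n}"
    then obtain A n where "r = of_nat A / of_nat p ^ n" "A < p ^ n" by blast
    then show "r \<in> digit_fractions p" unfolding digit_fractions_def using 2[of A n] by blast
  qed
qed

text \<open>Only \<open>p\<close> can occur in the denominator, and integrality at \<open>p\<close>
  excludes it. This makes the fractional part unique and the character independent of the chosen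
  representative.\<close>

lemma prime_power_fraction_in_Ints:
  assumes p: "prime p" and "padic_abs p (of_int c / of_nat p ^ n) \<le> 1"
  shows "of_int c / of_nat p ^ n \<in> (\<int> :: rat set)"
proof -
  have p0: "p > 0" using prime_gt_0_nat[OF p] .
  have "padic_abs p (of_int c) = padic_abs p (of_int c / of_nat p ^ n) * padic_abs p (of_nat p ^ n)"
    using p0 by (simp flip: padic_abs_mult[OF p])
  also have "\<dots> \<le> 1 * (1 / real p ^ n)"
    using assms by (intro mult_mono) (auto simp: padic_abs_power padic_abs_prime power_one_over)
  finally have "int p ^ n dvd c" using padic_abs_of_int_le_iff[OF p, of c n] by simp
  then obtain k where "c = int p ^ n * k" by (rule dvdE)
  then show ?thesis using p0 by simp
qed

text \<open>Makes the definite description usable. Existence: scale \<open>x\<close> into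
  \<open>Zp p\<close> by p^n, approximate by some A < p^n, scale back. Uniqueness: two candidates
  differ by an integer, and both lie in [0,1).\<close>

lemma padic_frac:
  assumes p: "prime p" and x: "x \<in> carrier (Qp p)"
  shows "padic_frac p x \<in> digit_fractions p" "x \<ominus>\<^bsub>Qp p\<^esub> padic_of_rat p (padic_frac p x) \<in> Zp p"
proof -
  interpret cring "Qp p" by (rule Qp_cring[OF p])
  have p0: "p > 0" using prime_gt_0_nat[OF p] .
  obtain n where n: "padic_norm p x \<le> real p ^ n" using padic_norm_le_power[OF p] .
  let ?P = "padic_of_rat p (of_nat p ^ n)" and ?Q = "padic_of_rat p (1 / of_nat p ^ n)"
  have c: "?P \<in> carrier (Qp p)" "?Q \<in> carrier (Qp p)" by (rule padic_of_rat_closed)+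
  have nP: "padic_norm p ?P = 1 / real p ^ n" "padic_norm p ?Q = real p ^ n"
    by (simp_all add: padic_norm_of_rat[OF p] padic_abs_power[OF p] padic_abs_inverse[OF p]
        padic_abs_prime[OF p] power_one_over)
  have QP: "?Q \<otimes>\<^bsub>Qp p\<^esub> ?P = \<one>\<^bsub>Qp p\<^esub>"
    using p0 by (simp add: padic_of_rat_mult[OF p] padic_of_rat_1)
  have "?P \<otimes>\<^bsub>Qp p\<^esub> x \<in> Zp p"
    using n c x p0 by (simp add: Zp_def padic_norm_mult[OF p] nP field_simps)
  then obtain A where A: "A < p ^ n" "padic_norm p (?P \<otimes>\<^bsub>Qp p\<^esub> x \<ominus>\<^bsub>Qp p\<^esub> padic_of_rat p (of_nat A)) \<le> 1 / real p ^ n"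
    using padic_approx_nat[OF p] by metis
  let ?A = "padic_of_rat p (of_nat A)"
  have cA: "?A \<in> carrier (Qp p)" by (rule padic_of_rat_closed)
  have "padic_of_rat p (of_nat A / of_nat p ^ n) = ?Q \<otimes>\<^bsub>Qp p\<^esub> ?A"
    by (simp add: padic_of_rat_mult[OF p])
  moreover have "x = (?Q \<otimes>\<^bsub>Qp p\<^esub> ?P) \<otimes>\<^bsub>Qp p\<^esub> x" using x by (simp add: QP)
  then have "x \<ominus>\<^bsub>Qp p\<^esub> ?Q \<otimes>\<^bsub>Qp p\<^esub> ?A = ?Q \<otimes>\<^bsub>Qp p\<^esub> (?P \<otimes>\<^bsub>Qp p\<^esub> x \<ominus>\<^bsub>Qp p\<^esub> ?A)"
    using x c cA by algebra
  ultimately have "x \<ominus>\<^bsub>Qp p\<^esub> padic_of_rat p (of_nat A / of_nat p ^ n)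
      = ?Q \<otimes>\<^bsub>Qp p\<^esub> (?P \<otimes>\<^bsub>Qp p\<^esub> x \<ominus>\<^bsub>Qp p\<^esub> ?A)" by simp
  then have Z: "x \<ominus>\<^bsub>Qp p\<^esub> padic_of_rat p (of_nat A / of_nat p ^ n) \<in> Zp p"
    using A c cA x p0 by (simp add: Zp_def padic_norm_mult[OF p] nP field_simps)
  have uniq: "r = s" if r: "r \<in> digit_fractions p" "x \<ominus>\<^bsub>Qp p\<^esub> padic_of_rat p r \<in> Zp p"
    and s: "s \<in> digit_fractions p" "x \<ominus>\<^bsub>Qp p\<^esub> padic_of_rat p s \<in> Zp p" for r s
  proof -
    have "padic_of_rat p r \<ominus>\<^bsub>Qp p\<^esub> padic_of_rat p s
      = (x \<ominus>\<^bsub>Qp p\<^esub> padic_of_rat p s) \<ominus>\<^bsub>Qp p\<^esub> (x \<ominus>\<^bsub>Qp p\<^esub> padic_of_rat p r)"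
      using x padic_of_rat_closed[of p r] padic_of_rat_closed[of p s] by algebra
    then have rs: "padic_abs p (r - s) \<le> 1"
      using Zp_diff[OF p s(2) r(2)] padic_of_rat_diff[OF p] padic_of_rat_in_Zp[OF p] by metis
    obtain A k where Ak: "r = of_nat A / of_nat p ^ k" "A < p ^ k"
      using r(1) unfolding digit_fractions_eq[OF p] by blast
    obtain B l where Bl: "s = of_nat B / of_nat p ^ l" "B < p ^ l"
      using s(1) unfolding digit_fractions_eq[OF p] by blast
    have eq: "r - s = of_int (int A * int p ^ l - int B * int p ^ k) / of_nat p ^ (k + l)"
      unfolding Ak(1) Bl(1) using p0 by (simp add: field_simps power_add)
    have "r - s \<in> \<int>"
      using prime_power_fraction_in_Ints[OF p] rs unfolding eq by blast
    then obtain i where i: "r - s = of_int i" by (auto elim: Ints_cases)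
    have lt1: "of_nat C / of_nat p ^ h < (1 :: rat)" if "C < p ^ h" for C h
      using that p0 by (simp flip: of_nat_power)
    have "r \<ge> 0" "s \<ge> 0" using Ak Bl by auto
    then have "\<bar>of_int i :: rat\<bar> < 1" using lt1[OF Ak(2)] lt1[OF Bl(2)] Ak Bl i by linarith
    then have "i = 0" by linarith
    then show ?thesis using i by simp
  qed
  have "of_nat A / of_nat p ^ n \<in> digit_fractions p" using A unfolding digit_fractions_eq[OF p] by blast
  then have ex: "\<exists>!r. r \<in> digit_fractions p \<and> x \<ominus>\<^bsub>Qp p\<^esub> padic_of_rat p r \<in> Zp p"
    using Z uniq by blast
  from theI'[OF ex] show "padic_frac p x \<in> digit_fractions p"
    "x \<ominus>\<^bsub>Qp p\<^esub> padic_of_rat p (padic_frac p x) \<in> Zp p"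
    by (simp_all add: padic_frac_def)
qed

text \<open>Any \<open>p\<close>-power fraction congruent to \<open>x\<close> may replace the
  reduced one, since the two differ by an integer. Additivity needs this: the sum of two digit
  fractions may be 1 or more.\<close>

lemma padic_char_eq:
  assumes p: "prime p" and x: "x \<in> carrier (Qp p)"
    and Z: "x \<ominus>\<^bsub>Qp p\<^esub> padic_of_rat p r \<in> Zp p" and r: "r = of_int c / of_nat p ^ n"
  shows "padic_char p x = exp (2 * of_real pi * \<i> * of_rat r)"
proof -
  interpret cring "Qp p" by (rule Qp_cring[OF p])
  have p0: "p > 0" using prime_gt_0_nat[OF p] .
  let ?f = "padic_frac p x"
  note f = padic_frac[OF p x]
  obtain A k where Ak: "?f = of_nat A / of_nat p ^ k" "A < p ^ k"
    using f(1) unfolding digit_fractions_eq[OF p] by blast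
  have "padic_of_rat p ?f \<ominus>\<^bsub>Qp p\<^esub> padic_of_rat p r
      = (x \<ominus>\<^bsub>Qp p\<^esub> padic_of_rat p r) \<ominus>\<^bsub>Qp p\<^esub> (x \<ominus>\<^bsub>Qp p\<^esub> padic_of_rat p ?f)"
    using x padic_of_rat_closed[of p r] padic_of_rat_closed[of p ?f] by algebra
  then have le: "padic_abs p (?f - r) \<le> 1"
    using Zp_diff[OF p Z f(2)] padic_of_rat_diff[OF p] padic_of_rat_in_Zp[OF p] by metis
  have eq: "?f - r = of_int (int A * int p ^ n - c * int p ^ k) / of_nat p ^ (k + n)"
    using Ak p0 by (simp add: r field_simps power_add)
  have "?f - r \<in> \<int>"
    using prime_power_fraction_in_Ints[OF p] le unfolding eq by blast
  then obtain i where i: "?f = r + of_int i" by (metis Ints_cases add.commute diff_add_cancel)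
  have "exp (2 * of_real pi * \<i> * of_rat ?f)
      = exp (2 * of_real pi * \<i> * of_rat r) * exp (2 * of_real pi * \<i> * of_int i)"
    by (simp add: i of_rat_add distrib_left exp_add)
  also have "exp (2 * of_real pi * \<i> * of_int i) = 1"
    using exp_integer_2pi[of "of_int i"] by (simp add: mult_ac)
  finally show ?thesis by (simp add: padic_char_def)
qed

lemma padic_char_add:
  assumes p: "prime p" and x: "x \<in> carrier (Qp p)" and y: "y \<in> carrier (Qp p)"
  shows "padic_char p (x \<oplus>\<^bsub>Qp p\<^esub> y) = padic_char p x * padic_char p y"
proof -
  interpret cring "Qp p" by (rule Qp_cring[OF p])
  have p0: "p > 0" using prime_gt_0_nat[OF p] .
  let ?r = "padic_frac p x" and ?s = "padic_frac p y"
  obtain A k where Ak: "?r = of_nat A / of_nat p ^ k"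
    using padic_frac(1)[OF p x] unfolding digit_fractions_eq[OF p] by blast
  obtain B l where Bl: "?s = of_nat B / of_nat p ^ l"
    using padic_frac(1)[OF p y] unfolding digit_fractions_eq[OF p] by blast
  have rs: "?r + ?s = of_int (int A * int p ^ l + int B * int p ^ k) / of_nat p ^ (k + l)"
    using Ak Bl p0 by (simp add: field_simps power_add)
  have "(x \<oplus>\<^bsub>Qp p\<^esub> y) \<ominus>\<^bsub>Qp p\<^esub> (padic_of_rat p ?r \<oplus>\<^bsub>Qp p\<^esub> padic_of_rat p ?s)
     = (x \<ominus>\<^bsub>Qp p\<^esub> padic_of_rat p ?r) \<oplus>\<^bsub>Qp p\<^esub> (y \<ominus>\<^bsub>Qp p\<^esub> padic_of_rat p ?s)"
    using x y padic_of_rat_closed[of p ?r] padic_of_rat_closed[of p ?s] by algebra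
  then have "(x \<oplus>\<^bsub>Qp p\<^esub> y) \<ominus>\<^bsub>Qp p\<^esub> padic_of_rat p (?r + ?s) \<in> Zp p"
    using Zp_add[OF p padic_frac(2)[OF p x] padic_frac(2)[OF p y]] by (simp add: padic_of_rat_add[OF p])
  from padic_char_eq[OF p _ this rs] x y show ?thesis
    by (simp add: padic_char_def of_rat_add distrib_left exp_add)
qed

lemma padic_char_altdef:
  "padic_char p x = exp (\<i> * complex_of_real (2 * pi * real_of_rat (padic_frac p x)))"
proof -
  obtain a b where "padic_frac p x = of_int a / of_int b" "b \<noteq> 0" by (rule rat_int_div)
  then have "complex_of_rat (padic_frac p x) = complex_of_real (real_of_rat (padic_frac p x))"
    by (simp add: of_rat_divide)
  then show ?thesis by (simp add: padic_char_def mult_ac)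
qed

lemma padic_char_eq_1_iff:
  assumes p: "prime p" and x: "x \<in> carrier (Qp p)"
  shows "padic_char p x = 1 \<longleftrightarrow> padic_frac p x = 0"
proof
  assume "padic_char p x = 1"
  then obtain n :: int where "2 * pi * real_of_rat (padic_frac p x) = of_int (2 * n) * pi"
    unfolding padic_char_altdef exp_eq_1 by auto
  then have "real_of_rat (padic_frac p x) = of_rat (of_int n)" by simp
  then have n: "padic_frac p x = of_int n" by (simp only: of_rat_eq_iff)
  obtain A k where Ak: "padic_frac p x = of_nat A / of_nat p ^ k" "A < p ^ k"
    using padic_frac(1)[OF p x] unfolding digit_fractions_eq[OF p] by blast
  \<comment> \<open>The fractional part lies in [0,1), where 0 is the only integer.\<close>
  have "padic_frac p x < 1" "padic_frac p x \<ge> 0"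
    using Ak prime_gt_0_nat[OF p] by (simp_all flip: of_nat_power)
  with n show "padic_frac p x = 0" by simp
qed (simp add: padic_char_def)

lemma padic_char_Zp:
  assumes p: "prime p" and x: "x \<in> Zp p" shows "padic_char p x = 1"
proof -
  interpret cring "Qp p" by (rule Qp_cring[OF p])
  have c: "x \<in> carrier (Qp p)" using x by (rule Zp_carrier)
  then have "x \<ominus>\<^bsub>Qp p\<^esub> padic_of_rat p 0 = x" unfolding padic_of_rat_0[OF p] by algebra
  then show ?thesis using padic_char_eq[OF p c, of 0 0 0] x by simp
qed

lemma padic_char_not_Zp:
  assumes p: "prime p" and x: "x \<in> carrier (Qp p)" "x \<notin> Zp p" shows "padic_char p x \<noteq> 1"
proof
  interpret cring "Qp p" by (rule Qp_cring[OF p])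
  assume "padic_char p x = 1"
  then have "padic_frac p x = 0" using padic_char_eq_1_iff[OF p x(1)] by simp
  moreover have "x \<ominus>\<^bsub>Qp p\<^esub> padic_of_rat p 0 = x" using x(1) unfolding padic_of_rat_0[OF p] by algebra
  ultimately show False using padic_frac(2)[OF p x(1)] x(2) by simp
qed

lemma norm_padic_char [simp]: "norm (padic_char p x) = 1"
  by (simp add: padic_char_altdef)

section \<open>Test functions on the p-adic numbers\<close>

lemma topspace_Qp: "prime p \<Longrightarrow> topspace (Qp_topology p) = carrier (Qp p)"
  by (simp add: Qp_topology_def Metric_space.topspace_mtopology[OF Metric_space_Qp])

lemma openin_Qp_iff:
  assumes p: "prime p"
  shows "openin (Qp_topology p) U \<longleftrightarrow> U \<subseteq> carrier (Qp p) \<and>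
    (\<forall>x\<in>U. \<exists>e>0. \<forall>y\<in>carrier (Qp p). padic_norm p (x \<ominus>\<^bsub>Qp p\<^esub> y) < e \<longrightarrow> y \<in> U)"
proof -
  interpret Metric_space "carrier (Qp p)" "Qp_dist p" by (rule Metric_space_Qp[OF p])
  have "mball x e \<subseteq> U \<longleftrightarrow>
      (\<forall>y\<in>carrier (Qp p). padic_norm p (x \<ominus>\<^bsub>Qp p\<^esub> y) < e \<longrightarrow> y \<in> U)"
    if "x \<in> carrier (Qp p)" for x e
    using that by (auto simp: Qp_dist_def)
  then show ?thesis unfolding Qp_topology_def openin_mtopology by (meson subsetD)
qed

text \<open>Rescales a ball around \<open>c\<close> of radius |s| to the unit ball, so that choosing
  a subball becomes choosing a digit \<open>d\<close> of the rescaled point.\<close>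

lemma padic_norm_add_scaled:
  assumes p: "prime p" and y: "y \<in> carrier (Qp p)" and s: "s \<noteq> 0"
  shows "padic_norm p (y \<ominus>\<^bsub>Qp p\<^esub> padic_of_rat p (c + d * s)) = padic_abs p s *
    padic_norm p (padic_of_rat p (1 / s) \<otimes>\<^bsub>Qp p\<^esub> (y \<ominus>\<^bsub>Qp p\<^esub> padic_of_rat p c)
      \<ominus>\<^bsub>Qp p\<^esub> padic_of_rat p d)"
proof -
  interpret cring "Qp p" by (rule Qp_cring[OF p])
  let ?r = "padic_of_rat p"
  have c: "?r t \<in> carrier (Qp p)" for t by (rule padic_of_rat_closed)
  have eq: "?r (c + d * s) = ?r c \<oplus>\<^bsub>Qp p\<^esub> ?r d \<otimes>\<^bsub>Qp p\<^esub> ?r s"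
    by (simp add: padic_of_rat_add[OF p] padic_of_rat_mult[OF p])
  have one: "?r s \<otimes>\<^bsub>Qp p\<^esub> ?r (1 / s) = \<one>\<^bsub>Qp p\<^esub>"
    using s by (simp add: padic_of_rat_mult[OF p] padic_of_rat_1)
  have "y \<ominus>\<^bsub>Qp p\<^esub> (?r c \<oplus>\<^bsub>Qp p\<^esub> ?r d \<otimes>\<^bsub>Qp p\<^esub> ?r s)
      = \<one>\<^bsub>Qp p\<^esub> \<otimes>\<^bsub>Qp p\<^esub> (y \<ominus>\<^bsub>Qp p\<^esub> ?r c) \<ominus>\<^bsub>Qp p\<^esub> ?r d \<otimes>\<^bsub>Qp p\<^esub> ?r s"
    using y c[of c] c[of d] c[of s] by algebra
  also have "\<dots> = ?r s \<otimes>\<^bsub>Qp p\<^esub> (?r (1 / s) \<otimes>\<^bsub>Qp p\<^esub> (y \<ominus>\<^bsub>Qp p\<^esub> ?r c) \<ominus>\<^bsub>Qp p\<^esub> ?r d)"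
    unfolding one[symmetric] using y c[of c] c[of d] c[of s] c[of "1 / s"] by algebra
  finally show ?thesis
    unfolding eq using y c by (simp add: padic_norm_mult[OF p] padic_norm_of_rat[OF p])
qed

text \<open>
  If a cover of the ball had no finite subcover, then repeatedly choosing one of the \<open>p\<close> subballs
  would produce rational centres converging to a point that no member of the cover can contain.
\<close>

lemma compactin_padic_ball:
  assumes p: "prime p"
  shows "compactin (Qp_topology p) {x \<in> carrier (Qp p). padic_norm p x \<le> real p ^ n}"
  unfolding compactin_def topspace_Qp[OF p]
proof (intro conjI allI impI)
  interpret cring "Qp p" by (rule Qp_cring[OF p])
  have p1: "real p > 1" using prime_gt_1_nat[OF p] by simp
  fix \<U> assume cover: "(\<forall>U\<in>\<U>. openin (Qp_topology p) U) \<and>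
    {x \<in> carrier (Qp p). padic_norm p x \<le> real p ^ n} \<subseteq> \<Union>\<U>"
  \<comment> \<open>\<open>s k\<close> is p^(k-n), of norm p^(n-k): stage \<open>k\<close> uses
    balls of that radius, starting with the given ball at \<open>k = 0\<close>.\<close>
  define s :: "nat \<Rightarrow> rat" where "s k = of_nat p ^ k / of_nat p ^ n" for k
  have s0: "s k \<noteq> 0" for k using p1 by (simp add: s_def)
  have abs_s: "padic_abs p (s k) = real p ^ n / real p ^ k" for k
    using padic_abs_mult[OF p, of "of_nat p ^ k" "1 / of_nat p ^ n"]
    by (simp add: s_def padic_abs_power[OF p] padic_abs_inverse[OF p] padic_abs_prime[OF p] power_one_over)
  define B where "B k c = {y \<in> carrier (Qp p).
    padic_norm p (y \<ominus>\<^bsub>Qp p\<^esub> padic_of_rat p c) \<le> padic_abs p (s k)}" for k c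
  define bad where "bad k c \<longleftrightarrow> \<not> (\<exists>\<F>. finite \<F> \<and> \<F> \<subseteq> \<U> \<and> B k c \<subseteq> \<Union>\<F>)" for k c
  have B0: "B 0 0 = {x \<in> carrier (Qp p). padic_norm p x \<le> real p ^ n}"
    unfolding B_def abs_s padic_of_rat_0[OF p] by (auto simp: a_minus_def)
  show "\<exists>\<F>. finite \<F> \<and> \<F> \<subseteq> \<U> \<and> {x \<in> carrier (Qp p). padic_norm p x \<le> real p ^ n} \<subseteq> \<Union>\<F>"
  proof (rule ccontr)
    assume "\<not> ?thesis"
    then have bad0: "bad 0 0" by (simp add: bad_def B0)
    have step: "\<exists>d. bad (Suc k) (c + of_nat d * s k)" if "bad k c" for k c
    proof (rule ccontr)
      assume "\<nexists>d. bad (Suc k) (c + of_nat d * s k)"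
      then have "\<forall>d. \<exists>\<F>. finite \<F> \<and> \<F> \<subseteq> \<U> \<and> B (Suc k) (c + of_nat d * s k) \<subseteq> \<Union>\<F>"
        unfolding bad_def by blast
      then obtain \<F> where F: "\<And>d. finite (\<F> d)" "\<And>d. \<F> d \<subseteq> \<U>"
        "\<And>d::nat. B (Suc k) (c + of_nat d * s k) \<subseteq> \<Union>(\<F> d)"
        by metis
      \<comment> \<open>Rescaling by 1 / \<open>s k\<close> moves the ball into \<open>Zp p\<close>,
        where the residue of the point modulo \<open>p\<close> picks the subball.\<close>
      have "B k c \<subseteq> (\<Union>d<p. B (Suc k) (c + of_nat d * s k))"
      proof
        fix y assume y: "y \<in> B k c"
        then have yc: "y \<in> carrier (Qp p)" by (simp add: B_def)
        let ?z = "padic_of_rat p (1 / s k) \<otimes>\<^bsub>Qp p\<^esub> (y \<ominus>\<^bsub>Qp p\<^esub> padic_of_rat p c)"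
        have "?z \<in> Zp p"
          using y p1 by (simp add: Zp_def B_def padic_of_rat_closed padic_norm_mult[OF p]
              padic_norm_of_rat[OF p] padic_abs_inverse[OF p] abs_s field_simps)
        then obtain d where d: "d < p" "padic_norm p (?z \<ominus>\<^bsub>Qp p\<^esub> padic_of_rat p (of_nat d)) \<le> 1 / real p"
          using padic_approx_nat[OF p, of ?z 1] by auto
        have "padic_abs p (s k) * padic_norm p (?z \<ominus>\<^bsub>Qp p\<^esub> padic_of_rat p (of_nat d))
            \<le> padic_abs p (s k) * (1 / real p)"
          using d by (intro mult_left_mono) auto
        also have "\<dots> = padic_abs p (s (Suc k))" using p1 by (simp add: abs_s)
        finally have "y \<in> B (Suc k) (c + of_nat d * s k)"
          using yc by (simp add: B_def padic_norm_add_scaled[OF p yc s0])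
        with d(1) show "y \<in> (\<Union>d<p. B (Suc k) (c + of_nat d * s k))" by blast
      qed
      also have "\<dots> \<subseteq> \<Union>(\<Union>d<p. \<F> d)" using F(3) by blast
      finally have "\<not> bad k c" unfolding bad_def using F(1,2) by (auto intro!: exI[of _ "\<Union>d<p. \<F> d"])
      then show False using that by blast
    qed
    \<comment> \<open>The recursion is kept along with badness because it bounds the distance of all
      later centres from \<open>c k\<close>.\<close>
    obtain c where c: "\<And>k. bad k (c k)" "c 0 = 0" "\<And>k. \<exists>d. c (Suc k) = c k + of_nat d * s k"
    proof -
      have "\<exists>f. \<forall>k. (bad k (f k) \<and> (k = 0 \<longrightarrow> f k = 0)) \<and> (\<exists>d. f (Suc k) = f k + of_nat d * s k)"
        by (rule dependent_nat_choice) (use bad0 step in blast)+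
      then show ?thesis using that by blast
    qed
    have le: "padic_abs p (c (k + i) - c k) \<le> padic_abs p (s k)" for i k
    proof (induction i)
      case (Suc i)
      obtain d where "c (Suc (k + i)) = c (k + i) + of_nat d * s (k + i)" using c(3) by blast
      then have eq: "c (k + Suc i) - c k = (c (k + i) - c k) + of_nat d * s (k + i)" by simp
      have "padic_abs p (of_nat d * s (k + i)) \<le> 1 * padic_abs p (s (k + i))"
        unfolding padic_abs_mult[OF p] by (intro mult_right_mono padic_abs_of_nat_le_1[OF p]) simp
      moreover have "padic_abs p (s (k + i)) \<le> padic_abs p (s k)"
        unfolding abs_s using p1 by (intro divide_left_mono power_increasing) auto
      ultimately show ?case unfolding eq using Suc padic_abs_add[OF p, of "c (k + i) - c k" "of_nat d * s (k + i)"]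
        by linarith
    qed simp
    have small: "\<exists>k. padic_abs p (s k) < e" if "e > 0" for e
    proof -
      obtain k where "real p ^ n / e < real p ^ k" using real_arch_pow[OF p1] by blast
      then show ?thesis using that p1 by (auto simp: abs_s field_simps intro!: exI[of _ k])
    qed
    have Cauchy: "padic_Cauchy p c"
      unfolding padic_Cauchy_def
    proof (intro allI impI)
      fix e :: real assume "e > 0"
      then obtain k where k: "padic_abs p (s k) < e" using small by blast
      have "padic_abs p (c i - c j) < e" if "i \<ge> k" "j \<ge> k" for i j
        using padic_abs_diff[OF p, of "c i - c k" "c j - c k"] le[of k "i - k"] le[of k "j - k"] that k
        by simp
      then show "\<exists>N. \<forall>i\<ge>N. \<forall>j\<ge>N. padic_abs p (c i - c j) < e" by blast
    qed
    define x where "x = padic_class p c"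
    have x: "x \<in> carrier (Qp p)" unfolding x_def by (rule padic_class_closed[OF Cauchy])
    have xc: "padic_norm p (x \<ominus>\<^bsub>Qp p\<^esub> padic_of_rat p (c k)) \<le> padic_abs p (s k)" for k
    proof -
      have C: "padic_Cauchy p (\<lambda>i. - c k)" by (rule padic_Cauchy_const)
      have eq: "x \<ominus>\<^bsub>Qp p\<^esub> padic_of_rat p (c k) = padic_class p (\<lambda>i. c i + - c k)"
        unfolding a_minus_def x_def padic_of_rat_def padic_class_uminus[OF p padic_Cauchy_const]
        by (rule padic_class_add[OF p Cauchy C])
      show ?thesis unfolding eq
        by (rule LIMSEQ_le_const2[OF padic_norm_class[OF p padic_Cauchy_add[OF p Cauchy C]]])
          (use le[of k] in \<open>auto intro!: exI[of _ k] dest!: le_Suc_ex\<close>)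
    qed
    have "x \<in> B 0 0" using xc[of 0] x c(2) by (simp add: B_def)
    then obtain U where U: "U \<in> \<U>" "x \<in> U" using cover B0 by blast
    then obtain e where e: "e > 0"
      "\<And>y. y \<in> carrier (Qp p) \<Longrightarrow> padic_norm p (x \<ominus>\<^bsub>Qp p\<^esub> y) < e \<Longrightarrow> y \<in> U"
      using cover openin_Qp_iff[OF p] by meson
    obtain k where k: "padic_abs p (s k) < e" using small[OF e(1)] by blast
    have "B k (c k) \<subseteq> U"
    proof
      fix y assume y: "y \<in> B k (c k)"
      then have yc: "y \<in> carrier (Qp p)" by (simp add: B_def)
      have "padic_norm p (x \<ominus>\<^bsub>Qp p\<^esub> y) < e"
        using padic_norm_diff_triangle[OF p x padic_of_rat_closed yc, of "c k"] xc[of k] y k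
          padic_norm_diff_commute[OF p yc padic_of_rat_closed, of "c k"]
        by (auto simp: B_def)
      then show "y \<in> U" using e(2) yc by blast
    qed
    then have "\<not> bad k (c k)" using U unfolding bad_def by (auto intro!: exI[of _ "{U}"])
    then show False using c(1) by blast
  qed
qed auto

text \<open>Constancy at one scale and a bound on the support suffice: a closed ball is closed and
  compact, so it contains the closure of the support as a compact set.\<close>

lemma padic_test_functionI:
  assumes p: "prime p"
    and const: "\<And>x y. x \<in> carrier (Qp p) \<Longrightarrow> y \<in> carrier (Qp p) \<Longrightarrow>
        padic_norm p (x \<ominus>\<^bsub>Qp p\<^esub> y) < e \<Longrightarrow> \<eta> x = \<eta> y" and e: "e > 0"
    and bounded: "\<And>x. x \<in> carrier (Qp p) \<Longrightarrow> \<eta> x \<noteq> 0 \<Longrightarrow> padic_norm p x \<le> R"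
  shows "\<eta> \<in> padic_test_functions p"
proof -
  interpret cring "Qp p" by (rule Qp_cring[OF p])
  interpret M: Metric_space "carrier (Qp p)" "Qp_dist p" by (rule Metric_space_Qp[OF p])
  have "\<exists>U. openin (Qp_topology p) U \<and> x \<in> U \<and> (\<forall>y\<in>U. \<eta> y = \<eta> x)"
    if "x \<in> carrier (Qp p)" for x
  proof (intro exI conjI ballI)
    show "openin (Qp_topology p) (M.mball x e)" by (simp add: Qp_topology_def)
    show "x \<in> M.mball x e" using that e by simp
    show "\<eta> y = \<eta> x" if "y \<in> M.mball x e" for y
      using const[of x y] that by (auto simp: Qp_dist_def split: if_splits)
  qed
  moreover obtain n where n: "R \<le> real p ^ n"
    using real_arch_pow[of "real p" R] prime_gt_1_nat[OF p] less_imp_le by auto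
  let ?K = "{x \<in> carrier (Qp p). padic_norm p x \<le> real p ^ n}"
  have "?K = M.mcball \<zero>\<^bsub>Qp p\<^esub> (real p ^ n)"
    using padic_norm_uminus[OF p] by (auto simp: Qp_dist_def a_minus_def)
  then have "closedin (Qp_topology p) ?K" by (simp add: Qp_topology_def)
  then have "Qp_topology p closure_of {x \<in> carrier (Qp p). \<eta> x \<noteq> 0} \<subseteq> ?K"
    using bounded n by (intro closure_of_minimal) (auto intro: order_trans)
  then have "compactin (Qp_topology p) (Qp_topology p closure_of {x \<in> carrier (Qp p). \<eta> x \<noteq> 0})"
    by (rule closed_compactin[OF compactin_padic_ball[OF p] _ closedin_closure_of])
  ultimately show ?thesis by (simp add: padic_test_functions_def)
qed

text \<open>A Lebesgue number argument on the compact support. One exponent governs both the scale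
  of constancy and the size of the support, matching the single integer in
  \<open>schwartz\<close>.\<close>

lemma padic_test_function_uniform:
  assumes p: "prime p" and \<eta>: "\<eta> \<in> padic_test_functions p"
  obtains n where
    "\<And>x y. x \<in> carrier (Qp p) \<Longrightarrow> y \<in> carrier (Qp p) \<Longrightarrow>
        padic_norm p (x \<ominus>\<^bsub>Qp p\<^esub> y) \<le> 1 / real p ^ n \<Longrightarrow> \<eta> x = \<eta> y"
    "\<And>x. x \<in> carrier (Qp p) \<Longrightarrow> \<eta> x \<noteq> 0 \<Longrightarrow> padic_norm p x \<le> real p ^ n"
proof -
  interpret cring "Qp p" by (rule Qp_cring[OF p])
  interpret M: Metric_space "carrier (Qp p)" "Qp_dist p" by (rule Metric_space_Qp[OF p])
  have p1: "real p > 1" using prime_gt_1_nat[OF p] by simp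
  let ?S = "{x \<in> carrier (Qp p). \<eta> x \<noteq> 0}"
  let ?K = "Qp_topology p closure_of ?S"
  have K: "compactin (Qp_topology p) ?K" using \<eta> by (simp add: padic_test_functions_def)
  have SK: "?S \<subseteq> ?K" using topspace_Qp[OF p] by (intro closure_of_subset) auto
  have Kc: "?K \<subseteq> carrier (Qp p)" using closure_of_subset_topspace[of "Qp_topology p" ?S] topspace_Qp[OF p] by simp
  obtain k where k: "\<And>x. x \<in> ?S \<Longrightarrow> padic_norm p x \<le> real p ^ k"
  proof -
    have "M.mbounded ?S"
      using M.compactin_imp_mbounded K SK M.mbounded_subset unfolding Qp_topology_def by blast
    then obtain c b where cb: "?S \<subseteq> M.mcball c b" unfolding M.mbounded_def by blast
    obtain k where k: "max (padic_norm p c) b \<le> real p ^ k"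
      using real_arch_pow[OF p1] less_imp_le by meson
    have "padic_norm p x \<le> real p ^ k" if "x \<in> ?S" for x
    proof -
      have x: "x \<in> carrier (Qp p)" "c \<in> carrier (Qp p)" "padic_norm p (c \<ominus>\<^bsub>Qp p\<^esub> x) \<le> b"
        using subsetD[OF cb that] by (auto simp: Qp_dist_def split: if_splits)
      have "x = c \<ominus>\<^bsub>Qp p\<^esub> (c \<ominus>\<^bsub>Qp p\<^esub> x)" using x by algebra
      then have "padic_norm p x \<le> max (padic_norm p c) (padic_norm p (c \<ominus>\<^bsub>Qp p\<^esub> x))"
        using padic_norm_diff[OF p x(2), of "c \<ominus>\<^bsub>Qp p\<^esub> x"] x by simp
      then show ?thesis using x k by linarith
    qed
    then show ?thesis using that by blast
  qed
  have "\<exists>r>0. \<forall>y\<in>carrier (Qp p). padic_norm p (x \<ominus>\<^bsub>Qp p\<^esub> y) < r \<longrightarrow> \<eta> y = \<eta> x"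
    if x: "x \<in> carrier (Qp p)" for x
  proof -
    obtain U where "openin (Qp_topology p) U" "x \<in> U" "\<And>y. y \<in> U \<Longrightarrow> \<eta> y = \<eta> x"
      using \<eta> x unfolding padic_test_functions_def by blast
    then show ?thesis unfolding openin_Qp_iff[OF p] by meson
  qed
  then obtain r where r: "\<And>x. x \<in> carrier (Qp p) \<Longrightarrow> r x > 0"
    "\<And>x y. x \<in> carrier (Qp p) \<Longrightarrow> y \<in> carrier (Qp p) \<Longrightarrow>
       padic_norm p (x \<ominus>\<^bsub>Qp p\<^esub> y) < r x \<Longrightarrow> \<eta> y = \<eta> x"
    by metis
  define b where "b x = M.mball x (r x)" for x
  have b_op: "\<forall>U\<in>b ` ?K. openin (Qp_topology p) U" unfolding b_def Qp_topology_def by auto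
  have b_cov: "?K \<subseteq> \<Union>(b ` ?K)"
  proof
    fix x assume "x \<in> ?K"
    then show "x \<in> \<Union>(b ` ?K)" using Kc r(1) by (intro UnionI[of "b x"]) (auto simp: b_def)
  qed
  obtain F where F: "finite F" "F \<subseteq> b ` ?K" "?K \<subseteq> \<Union>F"
    using K b_op b_cov unfolding compactin_def by meson
  obtain C where C: "C \<subseteq> ?K" "finite C" "F = b ` C" using finite_subset_image[OF F(1,2)] by blast
  \<comment> \<open>The extra element 1 keeps the minimum meaningful when the support is
    empty.\<close>
  define \<epsilon> where "\<epsilon> = Min (insert 1 (r ` C))"
  have \<epsilon>: "\<epsilon> > 0" "\<And>z. z \<in> C \<Longrightarrow> \<epsilon> \<le> r z"
    using C Kc r(1) by (auto simp: \<epsilon>_def)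
  \<comment> \<open>The ultrametric inequality keeps \<open>y\<close> in the ball of
    \<open>z\<close> without halving radii, and only one of the two points has to lie in
    \<open>?K\<close>.\<close>
  have near: "\<eta> x = \<eta> y" if x: "x \<in> ?K" and y: "y \<in> carrier (Qp p)"
    and xy: "padic_norm p (x \<ominus>\<^bsub>Qp p\<^esub> y) < \<epsilon>" for x y
  proof -
    have xc: "x \<in> carrier (Qp p)" using x Kc by blast
    obtain z where z: "z \<in> C" "x \<in> b z" using x F C by blast
    then have zc: "z \<in> carrier (Qp p)" "padic_norm p (z \<ominus>\<^bsub>Qp p\<^esub> x) < r z"
      using C Kc xc by (auto simp: b_def Qp_dist_def)
    have "padic_norm p (z \<ominus>\<^bsub>Qp p\<^esub> y) < r z"
      using padic_norm_diff_triangle[OF p zc(1) xc y] zc(2) xy \<epsilon>(2)[OF z(1)] by linarith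
    then show ?thesis using r(2)[OF zc(1) y] r(2)[OF zc(1) xc zc(2)] by simp
  qed
  obtain l where l: "1 / \<epsilon> < real p ^ l" using real_arch_pow[OF p1] by blast
  have "1 / real p ^ max k l \<le> 1 / real p ^ l"
    using p1 by (intro divide_left_mono power_increasing) auto
  also have "\<dots> < \<epsilon>" using l \<epsilon>(1) p1 by (simp add: field_simps)
  finally have small: "1 / real p ^ max k l < \<epsilon>" .
  show ?thesis
  proof (rule that[of "max k l"])
    fix x y assume xy: "x \<in> carrier (Qp p)" "y \<in> carrier (Qp p)"
      "padic_norm p (x \<ominus>\<^bsub>Qp p\<^esub> y) \<le> 1 / real p ^ max k l"
    then have d: "padic_norm p (x \<ominus>\<^bsub>Qp p\<^esub> y) < \<epsilon>" "padic_norm p (y \<ominus>\<^bsub>Qp p\<^esub> x) < \<epsilon>"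
      using small padic_norm_diff_commute[OF p xy(1,2)] by auto
    show "\<eta> x = \<eta> y"
    proof (cases "x \<in> ?K \<or> y \<in> ?K")
      case True
      then show ?thesis using near[OF _ xy(2) d(1)] near[OF _ xy(1) d(2)] by auto
    next
      case False
      then have "\<eta> x = 0" "\<eta> y = 0" using SK xy by auto
      then show ?thesis by simp
    qed
  next
    fix x assume "x \<in> carrier (Qp p)" "\<eta> x \<noteq> 0"
    then have "padic_norm p x \<le> real p ^ k" using k by blast
    also have "\<dots> \<le> real p ^ max k l" using p1 by (intro power_increasing) auto
    finally show "padic_norm p x \<le> real p ^ max k l" .
  qed
qed

section \<open>Integral adeles and the adelic character\<close>

definition Zhat :: "fadele set" where
  "Zhat = {x. \<forall>p. prime p \<longrightarrow> place x p \<in> Zp p}"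

definition chi :: "fadele \<Rightarrow> complex" where
  "chi x = (\<Prod>p. if prime p then padic_char p (place x p) else 1)"

lemma Zhat_0: "0 \<in> Zhat" by (simp add: Zhat_def place_zero Zp_0)
lemma Zhat_add: "x \<in> Zhat \<Longrightarrow> y \<in> Zhat \<Longrightarrow> x + y \<in> Zhat"
  by (simp add: Zhat_def place_plus Zp_add)
lemma Zhat_mult: "x \<in> Zhat \<Longrightarrow> y \<in> Zhat \<Longrightarrow> x * y \<in> Zhat"
  by (simp add: Zhat_def place_times Zp_mult)
lemma Zhat_uminus: "x \<in> Zhat \<Longrightarrow> - x \<in> Zhat"
  by (simp add: Zhat_def place_uminus Zp_uminus)
lemma Zhat_diff: "x \<in> Zhat \<Longrightarrow> y \<in> Zhat \<Longrightarrow> x - y \<in> Zhat"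
  by (simp add: Zhat_def place_minus Zp_diff)

lemma place_of_nat: "prime p \<Longrightarrow> place (of_nat n) p = padic_of_rat p (of_nat n)"
  by (induction n) (simp_all add: place_zero place_plus place_one padic_of_rat_0 padic_of_rat_add
      flip: padic_of_rat_1)

lemma Zhat_of_nat: "of_nat n \<in> Zhat"
  by (simp add: Zhat_def place_of_nat padic_of_rat_in_Zp padic_abs_of_nat_le_1)

text \<open>The finite set is left free so that the products for different adeles can be taken over
  a common set.\<close>

lemma chi_eq_prod:
  assumes "finite A" "\<And>p. prime p \<Longrightarrow> p \<notin> A \<Longrightarrow> place x p \<in> Zp p"
  shows "chi x = (\<Prod>p\<in>A. if prime p then padic_char p (place x p) else 1)"
  unfolding chi_def by (rule prodinf_finite) (use assms padic_char_Zp in auto)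

lemma chi_add: "chi (x + y) = chi x * chi y"
proof -
  let ?A = "{p. prime p \<and> place x p \<notin> Zp p} \<union> {p. prime p \<and> place y p \<notin> Zp p}"
  have A: "finite ?A" using place_finite by blast
  have "chi (x + y) = (\<Prod>p\<in>?A. if prime p then padic_char p (place (x + y) p) else 1)"
    by (rule chi_eq_prod[OF A]) (auto simp: place_plus Zp_add)
  also have "\<dots> = (\<Prod>p\<in>?A. (if prime p then padic_char p (place x p) else 1) *
      (if prime p then padic_char p (place y p) else 1))"
    by (intro prod.cong) (auto simp: place_plus padic_char_add place_closed)
  also have "\<dots> = chi x * chi y"
    unfolding prod.distrib by (intro arg_cong2[where f = "(*)"] chi_eq_prod[OF A, symmetric]) auto
  finally show ?thesis .
qed

lemma chi_Zhat: "x \<in> Zhat \<Longrightarrow> chi x = 1"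
  using chi_eq_prod[of "{}" x] by (simp add: Zhat_def)

lemma norm_chi [simp]: "norm (chi x) = 1"
proof -
  have "chi x = (\<Prod>p\<in>{p. prime p \<and> place x p \<notin> Zp p}. if prime p then padic_char p (place x p) else 1)"
    by (rule chi_eq_prod[OF place_finite]) simp
  then show ?thesis by (simp flip: prod_norm add: if_distrib cong: if_cong)
qed

lemma chi_nonzero [simp]: "chi x \<noteq> 0"
  using norm_chi[of x] by (metis norm_zero zero_neq_one)

lemma chi_0 [simp]: "chi 0 = 1"
  by (rule chi_Zhat[OF Zhat_0])

lemma chi_nontrivial:
  assumes "z \<notin> Zhat" obtains y where "y \<in> Zhat" "chi (z * y) \<noteq> 1"
proof -
  obtain q where q: "prime q" "place z q \<notin> Zp q" using assms by (auto simp: Zhat_def)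
  \<comment> \<open>The test adele is the idempotent of the place \<open>q\<close>, which isolates
    one nontrivial local character.\<close>
  define f where "f p = (if p = q then \<one>\<^bsub>Qp p\<^esub> else \<zero>\<^bsub>Qp p\<^esub>)" for p
  have f: "f p \<in> Zp p" if "prime p" for p using Zp_0[OF that] Zp_1[OF that] by (cases "p = q") (auto simp: f_def)
  have pl: "place (of_places f) p = f p" if "prime p" for p
    by (rule place_of_places[where A = "{}"]) (use f Zp_carrier that in auto)
  have zero: "place (z * of_places f) p = \<zero>\<^bsub>Qp p\<^esub>" if "prime p" "p \<noteq> q" for p
  proof -
    interpret cring "Qp p" by (rule Qp_cring[OF that(1)])
    show ?thesis using that by (simp add: place_times pl f_def place_closed)
  qed
  interpret cring "Qp q" by (rule Qp_cring[OF q(1)])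
  have "place (z * of_places f) q = place z q"
    using q by (simp add: place_times pl f_def place_closed)
  moreover have "chi (z * of_places f)
      = (\<Prod>p\<in>{q}. if prime p then padic_char p (place (z * of_places f) p) else 1)"
    by (rule chi_eq_prod) (use zero Zp_0 in auto)
  ultimately have "chi (z * of_places f) \<noteq> 1"
    using padic_char_not_Zp[OF q(1) place_closed[OF q(1)] q(2)] q(1) by simp
  moreover have "of_places f \<in> Zhat" using pl f by (simp add: Zhat_def)
  ultimately show ?thesis using that by blast
qed

section \<open>Denominators and commensurable lattices\<close>

lemma of_nat_fadele_invertible:
  assumes "N > 0" obtains w :: fadele where "of_nat N * w = 1"
proof -
  let ?f = "\<lambda>p. padic_of_rat p (1 / of_nat N)"
  have "place (of_places ?f) p = ?f p" if "prime p" for p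
  proof (rule place_of_places[where A = "{p. p dvd N}"])
    show "finite {p. p dvd N}" using assms by simp
    show "?f p \<in> Zp p" if "prime p" "p \<notin> {p. p dvd N}" for p
      using that by (simp add: padic_of_rat_in_Zp padic_abs_inverse padic_abs_of_nat_eq_1)
  qed (simp_all add: padic_of_rat_closed that)
  then have "of_nat N * of_places ?f = 1"
    using assms by (intro fadele_eqI)
      (simp add: place_times place_of_nat padic_of_rat_mult place_one padic_of_rat_1)
  then show ?thesis by (rule that)
qed

lemma padic_abs_of_nat_le:
  assumes "prime p" "p ^ k dvd N" shows "padic_abs p (of_nat N) \<le> 1 / real p ^ k"
proof -
  have "int p ^ k dvd int N" using assms(2) by (simp flip: of_nat_power)
  then show ?thesis using padic_abs_of_int_le_iff[OF assms(1), of "int N" k] by simp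
qed

text \<open>\<open>N\<close> collects one power of \<open>p\<close> for each of the finitely many
  places where \<open>x\<close> is not integral.\<close>

lemma denominator_exists:
  obtains N where "N > 0" "of_nat N * x \<in> Zhat"
proof -
  let ?A = "{p. prime p \<and> place x p \<notin> Zp p}"
  have "\<exists>n. padic_norm p (place x p) \<le> real p ^ n" if "prime p" for p
    using padic_norm_le_power[OF that] by blast
  then obtain n where n: "\<And>p. prime p \<Longrightarrow> padic_norm p (place x p) \<le> real p ^ n p" by metis
  define N where "N = (\<Prod>p\<in>?A. p ^ n p)"
  have "N > 0" unfolding N_def by (intro prod_pos) (auto dest: prime_gt_0_nat)
  have "place (of_nat N * x) p \<in> Zp p" if p: "prime p" for p
  proof (cases "p \<in> ?A")
    case True
    then have "p ^ n p dvd N" unfolding N_def by (intro dvd_prodI place_finite)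
    then have "padic_abs p (of_nat N) * padic_norm p (place x p) \<le> 1 / real p ^ n p * real p ^ n p"
      using padic_abs_of_nat_le[OF p] n[OF p] padic_norm_nonneg[OF p place_closed[OF p]]
      by (intro mult_mono) auto
    then show ?thesis
      using prime_gt_0_nat[OF p] p
      by (simp add: Zp_def place_times place_of_nat padic_norm_mult place_closed padic_of_rat_closed padic_norm_of_rat
          cring.cring_simprules(5)[OF Qp_cring])
  next
    case False
    then show ?thesis using p Zhat_of_nat[of N] by (simp add: place_times Zhat_def Zp_mult)
  qed
  then have "of_nat N * x \<in> Zhat" by (simp add: Zhat_def)
  with \<open>N > 0\<close> show ?thesis by (rule that)
qed

text \<open>Finiteness of \<open>Zhat\<close> modulo \<open>N\<close>, by splitting off one prime
  factor at a time instead of using the Chinese remainder theorem. It is enough that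
  \<open>T\<close> meets every residue class.\<close>

lemma Zhat_mod_nat:
  assumes "N > 0"
  shows "\<exists>T. finite T \<and> (\<forall>x\<in>Zhat. \<exists>t\<in>T. \<exists>y\<in>Zhat. x = t + of_nat N * y)"
  using assms
proof (induction N rule: prime_divisors_induct)
  case (unit N)
  then show ?case by (intro exI[of _ "{0}"]) auto
next
  case (factor q N)
  then obtain T where T: "finite T" "\<And>x. x \<in> Zhat \<Longrightarrow> \<exists>t\<in>T. \<exists>y\<in>Zhat. x = t + of_nat N * y" by auto
  note q = \<open>prime q\<close>
  obtain w where w: "of_nat q * w = (1 :: fadele)"
    using of_nat_fadele_invertible[OF prime_gt_0_nat[OF q]] .
  \<comment> \<open>At \<open>q\<close> the residue \<open>i\<close> makes x - i divisible by
    \<open>q\<close>; at every other place \<open>q\<close> is a unit, so dividing by it keeps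
    integrality.\<close>
  have one: "\<exists>i<q. w * (x - of_nat i) \<in> Zhat" if x: "x \<in> Zhat" for x
  proof -
    obtain i where i: "i < q" "padic_norm q (place x q \<ominus>\<^bsub>Qp q\<^esub> padic_of_rat q (of_nat i)) \<le> 1 / real q"
      using padic_approx_nat[OF q, of "place x q" 1] x q by (auto simp: Zhat_def)
    have xi: "place (x - of_nat i) p \<in> Zp p" if "prime p" for p
      using Zhat_diff[OF x Zhat_of_nat[of i]] that by (simp add: Zhat_def)
    have "place (w * (x - of_nat i)) p \<in> Zp p" if p: "prime p" for p
    proof -
      interpret cring "Qp p" by (rule Qp_cring[OF p])
      have "padic_abs p (of_nat q) * padic_norm p (place w p) = padic_norm p (place (of_nat q * w) p)"
        using p by (simp add: place_times padic_norm_mult place_closed place_of_nat padic_of_rat_closed padic_norm_of_rat)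
      also have "\<dots> = 1" using p padic_norm_of_rat[OF p, of 1] by (simp add: w place_one padic_of_rat_1)
      finally have nw: "padic_abs p (of_nat q) * padic_norm p (place w p) = 1" .
      have "padic_norm p (place w p) * padic_norm p (place (x - of_nat i) p) \<le> 1"
      proof (cases "p = q")
        case True
        then have "padic_norm p (place w p) = real q"
          using nw prime_gt_0_nat[OF q] by (simp add: padic_abs_prime q field_simps)
        then show ?thesis using True i q prime_gt_0_nat[OF q]
          by (simp add: place_minus place_of_nat field_simps)
      next
        case False
        then have "\<not> p dvd q" using p q primes_dvd_imp_eq by blast
        then have "padic_norm p (place w p) = 1" using nw p by (simp add: padic_abs_of_nat_eq_1)
        then show ?thesis using xi[OF p] by (simp add: Zp_def)
      qed
      then show ?thesis using p by (simp add: Zp_def place_times padic_norm_mult place_closed)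
    qed
    then show ?thesis using i by (auto simp: Zhat_def)
  qed
  let ?T = "(\<lambda>(i, t). of_nat i + of_nat q * t) ` ({..<q} \<times> T)"
  have "\<exists>t\<in>?T. \<exists>y\<in>Zhat. x = t + of_nat (q * N) * y" if x: "x \<in> Zhat" for x
  proof -
    obtain i where i: "i < q" "w * (x - of_nat i) \<in> Zhat" using one[OF x] by blast
    obtain t y where ty: "t \<in> T" "y \<in> Zhat" "w * (x - of_nat i) = t + of_nat N * y" using T(2)[OF i(2)] by blast
    have "x = of_nat i + (of_nat q * w) * (x - of_nat i)" by (simp add: w)
    also have "\<dots> = of_nat i + of_nat q * (t + of_nat N * y)" using ty(3) by (simp add: mult.assoc)
    finally have "x = (of_nat i + of_nat q * t) + of_nat (q * N) * y" by (simp add: algebra_simps)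
    then show ?thesis using i ty by (intro bexI[of _ "of_nat i + of_nat q * t"] bexI[of _ y]) auto
  qed
  moreover have "finite ?T" using T by simp
  ultimately show ?case by blast
qed simp

text \<open>Finitely many translates of \<open>Zhat\<close> cover the lattice u \<open>Zhat\<close>.
  A denominator \<open>N\<close> of \<open>u\<close> reduces this to residues modulo
  \<open>N\<close>, which are then divided by \<open>N\<close>.\<close>

lemma Zhat_commensurable:
  "\<exists>T. finite T \<and> (\<forall>x\<in>Zhat. \<exists>t\<in>T. u * x - t \<in> Zhat)"
proof -
  obtain N where N: "N > 0" "of_nat N * u \<in> Zhat" by (rule denominator_exists)
  obtain w where w: "of_nat N * w = (1 :: fadele)" using of_nat_fadele_invertible[OF N(1)] .
  obtain T where T: "finite T" "\<And>x. x \<in> Zhat \<Longrightarrow> \<exists>t\<in>T. \<exists>y\<in>Zhat. x = t + of_nat N * y"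
    using Zhat_mod_nat[OF N(1)] by blast
  have "\<exists>t\<in>(*) w ` T. u * x - t \<in> Zhat" if x: "x \<in> Zhat" for x
  proof -
    obtain t y where ty: "t \<in> T" "y \<in> Zhat" "of_nat N * u * x = t + of_nat N * y"
      using T(2)[OF Zhat_mult[OF N(2) x]] by blast
    have "u * x = of_nat N * w * u * x" by (simp add: w)
    also have "\<dots> = w * (of_nat N * u * x)" by (simp add: mult_ac)
    also have "\<dots> = w * t + of_nat N * w * y" unfolding ty(3) by (simp add: algebra_simps)
    finally have "u * x - w * t = y" by (simp add: w)
    with ty show ?thesis by blast
  qed
  then show ?thesis using T(1) by (intro exI[of _ "(*) w ` T"]) simp
qed

section \<open>Topology of the finite adeles\<close>

text \<open>For \<open>v\<close> with inverse \<open>u\<close> this is the coset c + u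
  \<open>Zhat\<close>; phrasing membership with \<open>v\<close> avoids division.\<close>

definition coset :: "fadele \<Rightarrow> fadele \<Rightarrow> fadele set" where
  "coset c v = {x. v * (x - c) \<in> Zhat}"

lemma invertible_place_norm:
  assumes "u * v = 1" and p: "prime p"
  shows "padic_norm p (place u p) * padic_norm p (place v p) = 1"
proof -
  have "padic_norm p (place u p \<otimes>\<^bsub>Qp p\<^esub> place v p) = padic_norm p (place (u * v) p)"
    using p by (simp add: place_times)
  also have "\<dots> = 1" using p padic_norm_of_rat[OF p, of 1] by (simp add: assms(1) place_one padic_of_rat_1)
  finally show ?thesis using p by (simp add: padic_norm_mult place_closed)
qed

text \<open>Locally the condition cuts out a ball around c_p of radius |u_p|. At the almost all
  places where \<open>u\<close>, \<open>v\<close> and \<open>c\<close> are integral it is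
  \<open>Zp p\<close> itself, so the coset is a basic open box.\<close>

lemma open_coset:
  assumes uv: "u * v = 1" shows "open (coset c v)"
proof -
  define U where "U p = {y \<in> carrier (Qp p). place v p \<otimes>\<^bsub>Qp p\<^esub> (y \<ominus>\<^bsub>Qp p\<^esub> place c p) \<in> Zp p}" for p
  have "openin (Qp_topology p) (U p)" if p: "prime p" for p
    unfolding openin_Qp_iff[OF p]
  proof (intro conjI ballI)
    show "U p \<subseteq> carrier (Qp p)" by (auto simp: U_def)
    interpret cring "Qp p" by (rule Qp_cring[OF p])
    note inv = invertible_place_norm[OF uv p]
    have nu: "padic_norm p (place u p) > 0" "padic_norm p (place v p) \<ge> 0"
      using inv padic_norm_nonneg[OF p place_closed[OF p]] by (metis less_eq_real_def mult_zero_left zero_neq_one)+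
    fix x assume x: "x \<in> U p"
    have "y \<in> U p" if y: "y \<in> carrier (Qp p)" "padic_norm p (x \<ominus>\<^bsub>Qp p\<^esub> y) < padic_norm p (place u p)" for y
    proof -
      have xc: "x \<in> carrier (Qp p)" using x by (simp add: U_def)
      have "padic_norm p (place v p) * padic_norm p (x \<ominus>\<^bsub>Qp p\<^esub> y)
          \<le> padic_norm p (place v p) * padic_norm p (place u p)"
        using y nu by (intro mult_left_mono) auto
      also have "\<dots> = 1" using inv by (simp add: mult.commute)
      finally have "place v p \<otimes>\<^bsub>Qp p\<^esub> (x \<ominus>\<^bsub>Qp p\<^esub> y) \<in> Zp p"
        using xc y p by (simp add: Zp_def place_closed padic_norm_mult)
      moreover have "place v p \<otimes>\<^bsub>Qp p\<^esub> (x \<ominus>\<^bsub>Qp p\<^esub> place c p) \<in> Zp p" using x by (simp add: U_def)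
      ultimately have "place v p \<otimes>\<^bsub>Qp p\<^esub> (x \<ominus>\<^bsub>Qp p\<^esub> place c p) \<ominus>\<^bsub>Qp p\<^esub>
          place v p \<otimes>\<^bsub>Qp p\<^esub> (x \<ominus>\<^bsub>Qp p\<^esub> y) \<in> Zp p" using p by (simp add: Zp_diff)
      also have "place v p \<otimes>\<^bsub>Qp p\<^esub> (x \<ominus>\<^bsub>Qp p\<^esub> place c p) \<ominus>\<^bsub>Qp p\<^esub>
          place v p \<otimes>\<^bsub>Qp p\<^esub> (x \<ominus>\<^bsub>Qp p\<^esub> y) = place v p \<otimes>\<^bsub>Qp p\<^esub> (y \<ominus>\<^bsub>Qp p\<^esub> place c p)"
        using xc y(1) place_closed[OF p, of v] place_closed[OF p, of c] by algebra
      finally show ?thesis using y by (simp add: U_def)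
    qed
    then show "\<exists>e>0. \<forall>y\<in>carrier (Qp p). padic_norm p (x \<ominus>\<^bsub>Qp p\<^esub> y) < e \<longrightarrow> y \<in> U p"
      using nu by blast
  qed
  moreover have "finite {p. prime p \<and> U p \<noteq> Zp p}"
  proof (rule finite_subset[OF _ finite_UnI[OF place_finite[of u] finite_UnI[OF place_finite[of v] place_finite[of c]]]])
    have "U p = Zp p" if p: "prime p" and Z: "place u p \<in> Zp p" "place v p \<in> Zp p" "place c p \<in> Zp p" for p
    proof (intro equalityI subsetI)
      interpret cring "Qp p" by (rule Qp_cring[OF p])
      fix y assume y: "y \<in> U p"
      have "place u p \<otimes>\<^bsub>Qp p\<^esub> place v p = \<one>\<^bsub>Qp p\<^esub>"
        using uv p by (metis place_one place_times)
      then have "y = (place u p \<otimes>\<^bsub>Qp p\<^esub> place v p) \<otimes>\<^bsub>Qp p\<^esub> (y \<ominus>\<^bsub>Qp p\<^esub> place c p) \<oplus>\<^bsub>Qp p\<^esub> place c p"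
        using y place_closed[OF p, of c] by (simp add: U_def) algebra
      also have "\<dots> = place u p \<otimes>\<^bsub>Qp p\<^esub> (place v p \<otimes>\<^bsub>Qp p\<^esub> (y \<ominus>\<^bsub>Qp p\<^esub> place c p)) \<oplus>\<^bsub>Qp p\<^esub> place c p"
        using y place_closed[OF p] by (simp add: U_def m_assoc)
      also have "\<dots> \<in> Zp p" using y p Z by (auto simp: U_def intro!: Zp_add Zp_mult)
      finally show "y \<in> Zp p" .
    next
      fix y assume "y \<in> Zp p"
      then show "y \<in> U p" using p Z by (auto simp: U_def Zp_carrier intro!: Zp_mult Zp_diff)
    qed
    then show "{p. prime p \<and> U p \<noteq> Zp p} \<subseteq> {p. prime p \<and> place u p \<notin> Zp p} \<union>
      ({p. prime p \<and> place v p \<notin> Zp p} \<union> {p. prime p \<and> place c p \<notin> Zp p})" by blast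
  qed
  moreover have "coset c v = {x. \<forall>p. prime p \<longrightarrow> place x p \<in> U p}"
    by (auto simp: coset_def Zhat_def U_def place_times place_minus place_closed)
  ultimately show ?thesis
    unfolding open_fadele_def by (intro generate_topology.Basis) blast
qed

text \<open>The topology is given by generators, so it is enough to translate a box; as a_p is
  integral for almost all p, the translated box still equals \<open>Zp p\<close> almost
  everywhere.\<close>

lemma open_vimage_add_fadele:
  fixes S :: "fadele set" assumes "open S" shows "open ((\<lambda>x. a + x) -` S)"
  using assms unfolding open_fadele_def
proof (induction rule: generate_topology.induct)
  case UNIV
  then show ?case by (simp add: generate_topology.UNIV)
next
  case (Int S T)
  then show ?case by (simp add: generate_topology.Int)
next
  case (UN K)
  then show ?case unfolding vimage_Union by (intro generate_topology.UN) blast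
next
  case (Basis S)
  then obtain U where S: "S = {x. \<forall>p. prime p \<longrightarrow> place x p \<in> U p}"
    and U: "\<And>p. prime p \<Longrightarrow> openin (Qp_topology p) (U p)" and fin: "finite {p. prime p \<and> U p \<noteq> Zp p}"
    by blast
  define V where "V p = {y \<in> carrier (Qp p). place a p \<oplus>\<^bsub>Qp p\<^esub> y \<in> U p}" for p
  have "openin (Qp_topology p) (V p)" if p: "prime p" for p
    unfolding openin_Qp_iff[OF p]
  proof (intro conjI ballI)
    show "V p \<subseteq> carrier (Qp p)" by (auto simp: V_def)
    interpret cring "Qp p" by (rule Qp_cring[OF p])
    fix x assume "x \<in> V p"
    then have x: "x \<in> carrier (Qp p)" "place a p \<oplus>\<^bsub>Qp p\<^esub> x \<in> U p" by (auto simp: V_def)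
    then obtain e where e: "e > 0" "\<And>y. y \<in> carrier (Qp p) \<Longrightarrow>
        padic_norm p (place a p \<oplus>\<^bsub>Qp p\<^esub> x \<ominus>\<^bsub>Qp p\<^esub> y) < e \<Longrightarrow> y \<in> U p"
      using U[OF p] unfolding openin_Qp_iff[OF p] by meson
    have "y \<in> V p" if y: "y \<in> carrier (Qp p)" "padic_norm p (x \<ominus>\<^bsub>Qp p\<^esub> y) < e" for y
    proof -
      have "place a p \<oplus>\<^bsub>Qp p\<^esub> x \<ominus>\<^bsub>Qp p\<^esub> (place a p \<oplus>\<^bsub>Qp p\<^esub> y) = x \<ominus>\<^bsub>Qp p\<^esub> y"
        using x y(1) place_closed[OF p, of a] by algebra
      then show ?thesis using e(2)[of "place a p \<oplus>\<^bsub>Qp p\<^esub> y"] y p by (simp add: V_def place_closed)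
    qed
    then show "\<exists>e>0. \<forall>y\<in>carrier (Qp p). padic_norm p (x \<ominus>\<^bsub>Qp p\<^esub> y) < e \<longrightarrow> y \<in> V p"
      using e(1) by blast
  qed
  moreover have "finite {p. prime p \<and> V p \<noteq> Zp p}"
  proof (rule finite_subset[OF _ finite_UnI[OF fin place_finite[of a]]])
    have "V p = Zp p" if p: "prime p" and Z: "U p = Zp p" "place a p \<in> Zp p" for p
    proof (intro equalityI subsetI)
      interpret cring "Qp p" by (rule Qp_cring[OF p])
      fix y assume y: "y \<in> V p"
      then have "y = (place a p \<oplus>\<^bsub>Qp p\<^esub> y) \<ominus>\<^bsub>Qp p\<^esub> place a p"
        using place_closed[OF p, of a] by (simp add: V_def) algebra
      also have "\<dots> \<in> Zp p" using y p Z by (auto simp: V_def intro!: Zp_diff)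
      finally show "y \<in> Zp p" .
    next
      fix y assume "y \<in> Zp p"
      then show "y \<in> V p" using p Z by (auto simp: V_def Zp_carrier intro!: Zp_add)
    qed
    then show "{p. prime p \<and> V p \<noteq> Zp p} \<subseteq> {p. prime p \<and> U p \<noteq> Zp p} \<union> {p. prime p \<and> place a p \<notin> Zp p}"
      by blast
  qed
  moreover have "(\<lambda>x. a + x) -` S = {x. \<forall>p. prime p \<longrightarrow> place x p \<in> V p}"
    by (auto simp: S V_def place_plus place_closed)
  ultimately show ?case by (intro generate_topology.Basis) blast
qed

lemma measurable_add_fadele: "(\<lambda>x::fadele. a + x) \<in> borel \<rightarrow>\<^sub>M borel"
  by (rule borel_measurableI) (auto intro!: borel_open open_vimage_add_fadele)

text \<open>Invariance under the open lattice u \<open>Zhat\<close> makes \<open>f\<close> locally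
  constant, so the preimage of any set whatever is open.\<close>

lemma measurable_periodic:
  fixes f :: "fadele \<Rightarrow> complex"
  assumes uv: "u * v = 1" and per: "\<And>x y. y \<in> Zhat \<Longrightarrow> f (x + u * y) = f x"
  shows "f \<in> borel_measurable borel"
proof (rule borel_measurableI)
  fix S :: "complex set"
  have "open (f -` S)"
  proof (subst open_subopen, intro ballI exI conjI)
    fix x assume x: "x \<in> f -` S"
    show "open (coset x v)" by (rule open_coset[OF uv])
    show "x \<in> coset x v" by (simp add: coset_def Zhat_0)
    show "coset x v \<subseteq> f -` S"
    proof
      fix y assume "y \<in> coset x v"
      then have "f (x + u * (v * (y - x))) = f x" by (intro per) (simp add: coset_def)
      also have "x + u * (v * (y - x)) = y" using uv by (simp flip: mult.assoc)
      finally show "y \<in> f -` S" using x by simp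
    qed
  qed
  then show "f -` S \<inter> space borel \<in> sets borel" by simp
qed

lemma measurable_chi: "(\<lambda>x. chi (b * x)) \<in> borel_measurable borel"
proof -
  obtain N where N: "N > 0" "of_nat N * b \<in> Zhat" by (rule denominator_exists)
  obtain w where w: "of_nat N * w = (1 :: fadele)" using of_nat_fadele_invertible[OF N(1)] .
  have "chi (b * (x + of_nat N * y)) = chi (b * x)" if "y \<in> Zhat" for x y
  proof -
    have "b * (x + of_nat N * y) = b * x + of_nat N * b * y" by (simp add: algebra_simps)
    then show ?thesis using chi_Zhat[OF Zhat_mult[OF N(2) that]] by (simp add: chi_add)
  qed
  then show ?thesis by (rule measurable_periodic[OF w])
qed

section \<open>Fourier transform of modulated coset indicators\<close>

definition wave :: "fadele \<Rightarrow> fadele \<Rightarrow> fadele \<Rightarrow> fadele \<Rightarrow> complex" where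
  "wave b c v x = chi (b * x) * indicator (coset c v) x"

locale Haar_measure =
  fixes \<mu> :: "fadele measure"
  assumes Haar: "adelic_Haar \<mu>"
begin

lemma sets_mu [measurable_cong, simp]: "sets \<mu> = sets borel"
  using Haar by (simp add: adelic_Haar_def)

lemma space_mu [simp]: "space \<mu> = UNIV"
  using sets_eq_imp_space_eq[OF sets_mu] by simp

lemma emeasure_translate: "B \<in> sets borel \<Longrightarrow> emeasure \<mu> ((\<lambda>x. a + x) ` B) = emeasure \<mu> B"
  using Haar by (simp add: adelic_Haar_def)

lemma emeasure_Zhat: "emeasure \<mu> Zhat = 1"
  using Haar by (simp add: adelic_Haar_def Zhat_def)

lemma coset_borel: "u * v = 1 \<Longrightarrow> coset c v \<in> sets borel"
  by (rule borel_open[OF open_coset])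

lemma emeasure_coset: "u * v = 1 \<Longrightarrow> emeasure \<mu> (coset c v) = emeasure \<mu> (coset 0 v)"
proof -
  assume uv: "u * v = 1"
  have "coset c v = (\<lambda>x. c + x) ` coset 0 v"
    by (auto simp: coset_def image_iff intro!: exI[of _ "_ - c"])
  then show ?thesis using emeasure_translate[OF coset_borel[OF uv]] by simp
qed

lemma coset_1: "coset 0 1 = Zhat" by (simp add: coset_def)

text \<open>Finitely many translates of \<open>Zhat\<close>, each of measure 1, cover u
  \<open>Zhat\<close>.\<close>

lemma emeasure_coset_less_top:
  assumes uv: "u * v = 1" shows "emeasure \<mu> (coset c v) < \<infinity>"
proof -
  obtain T where T: "finite T" "\<And>x. x \<in> Zhat \<Longrightarrow> \<exists>t\<in>T. u * x - t \<in> Zhat"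
    using Zhat_commensurable[of u] by blast
  have "coset 0 v \<subseteq> (\<Union>t\<in>T. coset t 1)"
  proof
    fix x assume "x \<in> coset 0 v"
    then obtain t where "t \<in> T" "u * (v * x) - t \<in> Zhat" using T(2)[of "v * x"] by (auto simp: coset_def)
    then show "x \<in> (\<Union>t\<in>T. coset t 1)" using uv by (auto simp: coset_def simp flip: mult.assoc)
  qed
  then have "emeasure \<mu> (coset 0 v) \<le> emeasure \<mu> (\<Union>t\<in>T. coset t 1)"
    using T(1) coset_borel[of 1 1] by (intro emeasure_mono) auto
  also have "\<dots> \<le> (\<Sum>t\<in>T. emeasure \<mu> (coset t 1))"
    using T(1) coset_borel[of 1 1] by (intro emeasure_subadditive_finite) auto
  also have "\<dots> = of_nat (card T)"
  proof -
    have "emeasure \<mu> (coset t 1) = 1" for t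
      using emeasure_coset[of 1 1 t] by (simp add: coset_1 emeasure_Zhat)
    then show ?thesis by simp
  qed
  also have "\<dots> < \<infinity>" by (simp add: of_nat_less_top)
  finally show ?thesis using emeasure_coset[OF uv, of c] by simp
qed

text \<open>The opposite covering: finitely many translates of u \<open>Zhat\<close> cover
  \<open>Zhat\<close>, so they cannot be null sets. Finiteness enters too, since
  \<open>measure\<close> turns an infinite value into 0.\<close>

lemma measure_coset_pos:
  assumes uv: "u * v = 1" shows "measure \<mu> (coset 0 v) > 0"
proof -
  obtain T where T: "finite T" "\<And>x. x \<in> Zhat \<Longrightarrow> \<exists>t\<in>T. v * x - t \<in> Zhat"
    using Zhat_commensurable[of v] by blast
  have "Zhat \<subseteq> (\<Union>t\<in>T. coset (u * t) v)"
  proof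
    fix x assume "x \<in> Zhat"
    then obtain t where t: "t \<in> T" "v * x - t \<in> Zhat" using T(2) by blast
    have "v * (x - u * t) = v * x - u * v * t" by (simp add: algebra_simps)
    then show "x \<in> (\<Union>t\<in>T. coset (u * t) v)" using t uv by (auto simp: coset_def intro!: bexI[of _ t])
  qed
  then have "emeasure \<mu> Zhat \<le> emeasure \<mu> (\<Union>t\<in>T. coset (u * t) v)"
    using T(1) coset_borel[OF uv] by (intro emeasure_mono) auto
  also have "\<dots> \<le> (\<Sum>t\<in>T. emeasure \<mu> (coset (u * t) v))"
    using T(1) coset_borel[OF uv] by (intro emeasure_subadditive_finite) auto
  also have "\<dots> = of_nat (card T) * emeasure \<mu> (coset 0 v)"
  proof -
    have "emeasure \<mu> (coset (u * t) v) = emeasure \<mu> (coset 0 v)" for t by (rule emeasure_coset[OF uv])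
    then show ?thesis by simp
  qed
  finally have "emeasure \<mu> (coset 0 v) \<noteq> 0" by (auto simp: emeasure_Zhat)
  then show ?thesis
    using emeasure_coset_less_top[OF uv, of 0] by (simp add: measure_def enn2real_positive_iff zero_less_iff_neq_zero)
qed

lemma integral_translate:
  fixes f :: "fadele \<Rightarrow> complex"
  assumes "f \<in> borel_measurable borel"
  shows "(\<integral>x. f (a + x) \<partial>\<mu>) = (\<integral>x. f x \<partial>\<mu>)"
proof -
  have m: "(\<lambda>x. a + x) \<in> \<mu> \<rightarrow>\<^sub>M borel" using measurable_add_fadele by (simp cong: measurable_cong_sets)
  have "distr \<mu> borel (\<lambda>x. a + x) = \<mu>"
  proof (rule measure_eqI)
    fix B assume "B \<in> sets (distr \<mu> borel (\<lambda>x. a + x))"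
    then have B: "B \<in> sets borel" by simp
    \<comment> \<open>Invariance is given for images, so the preimage is rewritten as an image under
      the opposite translation.\<close>
    have "(\<lambda>x. a + x) -` B = (\<lambda>x. - a + x) ` B"
      by (auto simp: image_iff intro!: bexI[of _ "a + _"])
    then show "emeasure (distr \<mu> borel (\<lambda>x. a + x)) B = emeasure \<mu> B"
      using B emeasure_translate[OF B, of "- a"] by (simp add: emeasure_distr[OF m])
  qed simp
  then show ?thesis using integral_distr[OF m assms] by simp
qed

lemma measurable_wave: "u * v = 1 \<Longrightarrow> wave b c v \<in> borel_measurable borel"
  unfolding wave_def [abs_def] using measurable_chi coset_borel by (intro borel_measurable_times borel_measurable_indicator)

lemma integrable_wave: assumes uv: "u * v = 1" shows "integrable \<mu> (wave b c v)"
proof (rule Bochner_Integration.integrable_bound)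
  show "integrable \<mu> (indicator (coset c v) :: fadele \<Rightarrow> real)"
    using coset_borel[OF uv] emeasure_coset_less_top[OF uv] by (intro integrable_real_indicator) auto
  show "wave b c v \<in> borel_measurable \<mu>" using measurable_wave[OF uv] by (simp cong: measurable_cong_sets)
  show "AE x in \<mu>. norm (wave b c v x) \<le> norm (indicator (coset c v) x :: real)"
    by (auto simp: wave_def norm_mult split: split_indicator)
qed

lemma fourier_eq: "fourier \<mu> \<phi> \<xi> = (\<integral>x. chi (\<xi> * x) * \<phi> x \<partial>\<mu>)"
proof -
  have "(if prime p then padic_char p (place \<xi> p \<otimes>\<^bsub>Qp p\<^esub> place x p) else 1)
      = (if prime p then padic_char p (place (\<xi> * x) p) else 1)" for x p
    by (simp add: place_times)
  then show ?thesis by (simp add: fourier_def chi_def)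
qed

text \<open>Orthogonality of characters on the group u \<open>Zhat\<close>: the character of
  frequency \<open>z\<close> is trivial there when u z is integral; otherwise shifting by a suitable
  u y multiplies the integral by a number other than 1, so it vanishes.\<close>

lemma integral_wave_0:
  assumes uv: "u * v = 1"
  shows "(\<integral>x. wave z 0 v x \<partial>\<mu>) = of_real (measure \<mu> (coset 0 v)) * indicator Zhat (u * z)"
proof (cases "u * z \<in> Zhat")
  case True
  have "wave z 0 v x = complex_of_real (indicator (coset 0 v) x)" for x
  proof (cases "x \<in> coset 0 v")
    case in_coset: True
    have "z * x = u * v * z * x" using uv by simp
    also have "\<dots> = (u * z) * (v * x)" by (simp add: mult_ac)
    also have "\<dots> \<in> Zhat" using True in_coset using Zhat_mult[of "u * z" "v * x"] by (simp add: coset_def)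
    finally show ?thesis using in_coset by (simp add: wave_def chi_Zhat)
  qed (simp add: wave_def)
  then have "(\<integral>x. wave z 0 v x \<partial>\<mu>) = (\<integral>x. complex_of_real (indicator (coset 0 v) x) \<partial>\<mu>)" by simp
  also have "\<dots> = of_real (measure \<mu> (coset 0 v))"
    by (subst integral_complex_of_real) simp
  finally show ?thesis using True by simp
next
  case False
  then obtain y where y: "y \<in> Zhat" "chi (u * z * y) \<noteq> 1" using chi_nontrivial by blast
  have "wave z 0 v (u * y + x) = chi (u * z * y) * wave z 0 v x" for x
  proof -
    have vx: "v * (u * y + x) = y + v * x"
      using uv by (simp add: distrib_left mult.commute flip: mult.assoc)
    have "y + v * x \<in> Zhat \<longleftrightarrow> v * x \<in> Zhat"
      using Zhat_add[OF y(1), of "v * x"] Zhat_diff[OF _ y(1), of "y + v * x"] by auto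
    then have "u * y + x \<in> coset 0 v \<longleftrightarrow> x \<in> coset 0 v" by (simp add: coset_def vx)
    moreover have "z * (u * y + x) = u * z * y + z * x" by (simp add: algebra_simps)
    then have "chi (z * (u * y + x)) = chi (u * z * y) * chi (z * x)" by (simp add: chi_add)
    ultimately show ?thesis by (simp add: wave_def indicator_def)
  qed
  then have "(\<integral>x. wave z 0 v x \<partial>\<mu>) = chi (u * z * y) * (\<integral>x. wave z 0 v x \<partial>\<mu>)"
    using integral_translate[OF measurable_wave[OF uv], of z 0 "u * y"] by simp
  then have "(\<integral>x. wave z 0 v x \<partial>\<mu>) = 0" using y(2) by simp
  then show ?thesis using False by simp
qed

text \<open>Translating by \<open>c\<close> centres the coset and produces the phase at (\<xi> + b)
  c. The remaining condition, that u (\<xi> + b) be integral, is membership in a coset around -b.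
  Thus frequency and centre trade places up to sign, and so do \<open>u\<close> and
  \<open>v\<close>.\<close>

lemma fourier_wave:
  assumes uv: "u * v = 1"
  shows "fourier \<mu> (wave b c v) = (\<lambda>\<xi>. of_real (measure \<mu> (coset 0 v)) * chi (b * c) * wave c (- b) u \<xi>)"
proof
  fix \<xi>
  have "chi (\<xi> * x) * wave b c v x = wave (\<xi> + b) c v x" for x
    by (simp add: wave_def chi_add distrib_right)
  then have "fourier \<mu> (wave b c v) \<xi> = (\<integral>x. wave (\<xi> + b) c v x \<partial>\<mu>)" by (simp add: fourier_eq)
  also have "\<dots> = (\<integral>x. wave (\<xi> + b) c v (c + x) \<partial>\<mu>)"
    by (rule integral_translate[OF measurable_wave[OF uv], symmetric])
  also have "\<dots> = (\<integral>x. chi ((\<xi> + b) * c) * wave (\<xi> + b) 0 v x \<partial>\<mu>)"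
  proof (rule Bochner_Integration.integral_cong)
    show "wave (\<xi> + b) c v (c + x) = chi ((\<xi> + b) * c) * wave (\<xi> + b) 0 v x" for x
      by (simp add: wave_def coset_def indicator_def distrib_left chi_add)
  qed simp
  also have "(\<xi> + b) * c = b * c + c * \<xi>" by (simp add: algebra_simps)
  also have "(\<integral>x. chi (b * c + c * \<xi>) * wave (\<xi> + b) 0 v x \<partial>\<mu>) =
      of_real (measure \<mu> (coset 0 v)) * chi (b * c) * wave c (- b) u \<xi>"
    by (simp add: integral_wave_0[OF uv] chi_add) (simp add: wave_def coset_def indicator_def)
  finally show "fourier \<mu> (wave b c v) \<xi> = of_real (measure \<mu> (coset 0 v)) * chi (b * c) * wave c (- b) u \<xi>" .
qed

lemma integrable_chi_mult:
  assumes "integrable \<mu> f" shows "integrable \<mu> (\<lambda>x. chi (\<xi> * x) * f x)"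
proof (rule Bochner_Integration.integrable_bound[OF assms])
  have "(\<lambda>x. chi (\<xi> * x)) \<in> borel_measurable \<mu>" using measurable_chi by (simp cong: measurable_cong_sets)
  then show "(\<lambda>x. chi (\<xi> * x) * f x) \<in> borel_measurable \<mu>" using assms by measurable
qed (simp add: norm_mult)

lemma fourier_sum:
  assumes "\<And>i. i \<in> I \<Longrightarrow> integrable \<mu> (f i)"
  shows "fourier \<mu> (\<lambda>x. \<Sum>i\<in>I. c i * f i x) = (\<lambda>\<xi>. \<Sum>i\<in>I. c i * fourier \<mu> (f i) \<xi>)"
proof
  fix \<xi>
  have "fourier \<mu> (\<lambda>x. \<Sum>i\<in>I. c i * f i x) \<xi> = (\<integral>x. (\<Sum>i\<in>I. c i * (chi (\<xi> * x) * f i x)) \<partial>\<mu>)"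
    by (simp add: fourier_eq sum_distrib_left mult_ac)
  also have "\<dots> = (\<Sum>i\<in>I. \<integral>x. c i * (chi (\<xi> * x) * f i x) \<partial>\<mu>)"
    using assms by (intro Bochner_Integration.integral_sum integrable_mult_right integrable_chi_mult)
  finally show "fourier \<mu> (\<lambda>x. \<Sum>i\<in>I. c i * f i x) \<xi> = (\<Sum>i\<in>I. c i * fourier \<mu> (f i) \<xi>)"
    by (simp add: fourier_eq)
qed

end

section \<open>Fourier inversion for Schwartz-Bruhat functions\<close>

text \<open>One integer gives both the period lattice N \<open>Zhat\<close> and the lattice N^-1
  \<open>Zhat\<close> containing the support, so passing to a multiple of \<open>N\<close> relaxes
  both conditions.\<close>

definition schwartz :: "nat \<Rightarrow> (fadele \<Rightarrow> complex) set" where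
  "schwartz N = {f. (\<forall>x. \<forall>y\<in>Zhat. f (x + of_nat N * y) = f x) \<and>
     (\<forall>x. f x \<noteq> 0 \<longrightarrow> of_nat N * x \<in> Zhat)}"

definition schwartz_bruhat :: "(fadele \<Rightarrow> complex) set" where
  "schwartz_bruhat = (\<Union>N\<in>{0<..}. schwartz N)"

lemma schwartz_mult:
  assumes "f \<in> schwartz N" shows "f \<in> schwartz (N * M)"
proof -
  have "f (x + of_nat (N * M) * y) = f x" if "y \<in> Zhat" for x y
    using assms Zhat_mult[OF Zhat_of_nat[of M] that] by (simp add: schwartz_def mult.assoc)
  moreover have "of_nat (N * M) * x \<in> Zhat" if "f x \<noteq> 0" for x
    using assms that Zhat_mult[OF Zhat_of_nat[of M], of "of_nat N * x"] by (simp add: schwartz_def mult_ac)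
  ultimately show ?thesis by (simp add: schwartz_def)
qed

lemma schwartz_sum:
  assumes "\<And>i. i \<in> I \<Longrightarrow> f i \<in> schwartz N"
  shows "(\<lambda>x. \<Sum>i\<in>I. c i * f i x) \<in> schwartz N"
proof -
  have "of_nat N * x \<in> Zhat" if nz: "(\<Sum>i\<in>I. c i * f i x) \<noteq> 0" for x
  proof -
    obtain i where "i \<in> I" "c i * f i x \<noteq> 0" using sum.not_neutral_contains_not_neutral[OF nz] by blast
    then show ?thesis using assms[of i] by (auto simp: schwartz_def)
  qed
  moreover have "(\<Sum>i\<in>I. c i * f i (x + of_nat N * y)) = (\<Sum>i\<in>I. c i * f i x)" if "y \<in> Zhat" for x y
    using assms that by (intro sum.cong) (auto simp: schwartz_def)
  ultimately show ?thesis by (simp add: schwartz_def)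
qed

text \<open>Functions are brought to a common \<open>N\<close> before they are compared, because the
  constant in the double transform formula is chosen for a given \<open>N\<close>.\<close>

lemma schwartz_bruhat_common:
  assumes "finite F" "F \<subseteq> schwartz_bruhat"
  obtains N where "N > 0" "F \<subseteq> schwartz N"
proof -
  have "\<exists>N>0. F \<subseteq> schwartz N" using assms
  proof (induction F rule: finite_induct)
    case (insert f F)
    then obtain N M where "N > 0" "F \<subseteq> schwartz N" "M > 0" "f \<in> schwartz M"
      by (auto simp: schwartz_bruhat_def)
    then show ?case using schwartz_mult[of _ N M] schwartz_mult[of f M N]
      by (intro exI[of _ "N * M"]) (auto simp: mult.commute)
  qed auto
  then show ?thesis using that by blast
qed

lemma schwartz_bruhat_sum:
  assumes "finite I" "\<And>i. i \<in> I \<Longrightarrow> f i \<in> schwartz_bruhat"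
  shows "(\<lambda>x. \<Sum>i\<in>I. c i * f i x) \<in> schwartz_bruhat"
proof -
  obtain N where N: "N > 0" "f ` I \<subseteq> schwartz N"
    using schwartz_bruhat_common[of "f ` I"] assms by blast
  then have "(\<lambda>x. \<Sum>i\<in>I. c i * f i x) \<in> schwartz N" by (intro schwartz_sum) blast
  then show ?thesis using N(1) by (auto simp: schwartz_bruhat_def)
qed

text \<open>\<open>f\<close> is constant on cosets of N \<open>Zhat\<close>, and finitely many of
  these cover the support. Exactly one centre per coset must be used, or a value would be counted
  repeatedly.\<close>

lemma schwartz_decomposition:
  assumes w: "of_nat N * w = 1" and f: "f \<in> schwartz N"
  shows "\<exists>T. finite T \<and> (\<forall>x. f x = (\<Sum>t\<in>T. f t * wave 0 t w x))"
proof -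
  define R where "R x y \<longleftrightarrow> w * (x - y) \<in> Zhat" for x y
  have refl: "R x x" for x by (simp add: R_def Zhat_0)
  have sym: "R y x" if "R x y" for x y
    using Zhat_uminus[of "w * (x - y)"] that by (simp add: R_def algebra_simps)
  have trans: "R x z" if "R x y" "R y z" for x y z
    using Zhat_add[of "w * (x - y)" "w * (y - z)"] that by (simp add: R_def algebra_simps)
  have f_R: "f x = f y" if "R x y" for x y
  proof -
    have "f (y + of_nat N * (w * (x - y))) = f y" using f that by (simp add: schwartz_def R_def)
    then show ?thesis using w by (simp flip: mult.assoc)
  qed
  \<comment> \<open>A point x = w z with \<open>z\<close> integral is congruent to N t modulo N
    \<open>Zhat\<close> exactly when w w z - t is integral; hence the factor
    \<open>w * w\<close>.\<close>
  obtain T0 where T0: "finite T0" "\<And>z. z \<in> Zhat \<Longrightarrow> \<exists>t\<in>T0. w * w * z - t \<in> Zhat"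
    using Zhat_commensurable[of "w * w"] by blast
  define T1 where "T1 = (*) (of_nat N) ` T0"
  have T1: "\<exists>s\<in>T1. R x s" if Nx: "of_nat N * x \<in> Zhat" for x
  proof -
    obtain t where t: "t \<in> T0" "w * w * (of_nat N * x) - t \<in> Zhat" using T0(2)[OF Nx] by blast
    have "w * w * (of_nat N * x) = w * ((of_nat N * w) * x)" by (simp only: mult_ac)
    moreover have "w * (x - of_nat N * t) = w * x - (of_nat N * w) * t" by (simp add: algebra_simps)
    ultimately have "R x (of_nat N * t)" using t(2) by (simp add: R_def w)
    then show ?thesis using t(1) by (auto simp: T1_def)
  qed
  \<comment> \<open>\<open>T1\<close> may hold several points of one class; \<open>g\<close> selects
    the same one for all of them, since the selecting predicate depends only on the class.\<close>
  define g where "g s = (SOME t. t \<in> T1 \<and> R s t)" for s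
  have g: "g s \<in> T1" "R s (g s)" if "s \<in> T1" for s
    using someI[of "\<lambda>t. t \<in> T1 \<and> R s t" s] refl that unfolding g_def by blast+
  have g_eq: "g s = g t" if "R s t" for s t
  proof -
    have "(\<lambda>r. r \<in> T1 \<and> R s r) = (\<lambda>r. r \<in> T1 \<and> R t r)" using sym trans that by blast
    then show ?thesis by (simp add: g_def)
  qed
  define T where "T = g ` T1"
  have fin: "finite T" using T0(1) by (simp add: T_def T1_def)
  have wave_R: "wave 0 t w x = (if R x t then 1 else 0)" for t x
    by (simp add: wave_def coset_def R_def)
  have "f x = (\<Sum>t\<in>T. f t * wave 0 t w x)" for x
  proof (cases "f x = 0")
    case True
    \<comment> \<open>\<open>f\<close> vanishes on the whole class of \<open>x\<close>, so a summand
      whose coset contains \<open>x\<close> has coefficient 0.\<close>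
    then have "f t * wave 0 t w x = 0" for t using f_R[of x t] by (simp add: wave_R)
    then have "(\<Sum>t\<in>T. f t * wave 0 t w x) = 0" by (intro sum.neutral ballI)
    then show ?thesis using True by simp
  next
    case False
    then have "of_nat N * x \<in> Zhat" using f by (simp add: schwartz_def)
    then obtain s where s: "s \<in> T1" "R x s" using T1 by blast
    have uniq: "t = g s" if t: "t \<in> T" "R x t" for t
    proof -
      obtain r where r: "r \<in> T1" "t = g r" using t by (auto simp: T_def)
      have "R s r" using sym[OF s(2)] trans t(2) sym[OF g(2)[OF r(1)]] unfolding r(2) by blast
      then show ?thesis using g_eq r(2) by metis
    qed
    have gs: "g s \<in> T" "R x (g s)" using s(1) trans[OF s(2) g(2)[OF s(1)]] by (simp_all add: T_def)
    have "f t * wave 0 t w x = 0" if "t \<in> T - {g s}" for t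
      using that uniq[of t] by (auto simp: wave_R)
    then have "(\<Sum>t\<in>T. f t * wave 0 t w x) = (\<Sum>t\<in>{g s}. f t * wave 0 t w x)"
      using gs(1) fin by (intro sum.mono_neutral_right) auto
    then show ?thesis using gs(2) f_R[of x "g s"] by (simp add: wave_R)
  qed
  then show ?thesis using fin by blast
qed

context Haar_measure begin

lemma fourier_scale:
  assumes "integrable \<mu> f" shows "fourier \<mu> (\<lambda>x. c * f x) = (\<lambda>\<xi>. c * fourier \<mu> f \<xi>)"
  using fourier_sum[of "{()}" "\<lambda>_. f" "\<lambda>_. c"] assms by simp

lemma fourier_0: "fourier \<mu> (\<lambda>_. 0) = (\<lambda>_. 0)"
  by (simp add: fourier_eq fun_eq_iff)

text \<open>The order of quantifiers matters: \<open>K\<close> is fixed by \<open>N\<close> before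
  \<open>f\<close> is chosen, which turns the formula into injectivity. Each summand W(0, t, w) goes
  to K1 W(t, 0, N) and then to K1 K2 W(0, -t, w); the phases are 1 because frequency or centre is
  always 0.\<close>

lemma fourier_fourier_schwartz:
  assumes N: "N > 0"
  shows "\<exists>K. K \<noteq> 0 \<and> (\<forall>f\<in>schwartz N. integrable \<mu> f \<and> fourier \<mu> (fourier \<mu> f) = (\<lambda>x. K * f (- x)))"
proof -
  obtain w :: fadele where w: "of_nat N * w = 1" using of_nat_fadele_invertible[OF N] .
  have w': "w * of_nat N = 1" using w by (simp add: mult.commute)
  define K1 where "K1 = complex_of_real (measure \<mu> (coset 0 w))"
  define K2 where "K2 = complex_of_real (measure \<mu> (coset 0 (of_nat N)))"
  have "K1 * K2 \<noteq> 0"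
    using measure_coset_pos[OF w] measure_coset_pos[OF w'] by (simp add: K1_def K2_def)
  moreover have "integrable \<mu> f \<and> fourier \<mu> (fourier \<mu> f) = (\<lambda>x. K1 * K2 * f (- x))"
    if f: "f \<in> schwartz N" for f
  proof -
    obtain T where T: "finite T" "\<And>x. f x = (\<Sum>t\<in>T. f t * wave 0 t w x)"
      using schwartz_decomposition[OF w f] by blast
    then have fT: "f = (\<lambda>x. \<Sum>t\<in>T. f t * wave 0 t w x)" by blast
    have "integrable \<mu> (\<lambda>x. \<Sum>t\<in>T. f t * wave 0 t w x)"
      by (intro Bochner_Integration.integrable_sum integrable_mult_right integrable_wave[OF w])
    then have int: "integrable \<mu> f" using fT by simp
    have "fourier \<mu> f = fourier \<mu> (\<lambda>x. \<Sum>t\<in>T. f t * wave 0 t w x)" using fT by simp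
    also have "\<dots> = (\<lambda>\<xi>. \<Sum>t\<in>T. (f t * K1) * wave t 0 (of_nat N) \<xi>)"
      by (subst fourier_sum) (simp_all add: integrable_wave[OF w] fourier_wave[OF w] K1_def mult.assoc)
    finally have "fourier \<mu> (fourier \<mu> f) = fourier \<mu> (\<lambda>\<xi>. \<Sum>t\<in>T. (f t * K1) * wave t 0 (of_nat N) \<xi>)" by simp
    also have "\<dots> = (\<lambda>x. \<Sum>t\<in>T. (f t * K1) * (K2 * wave 0 (- t) w x))"
      by (subst fourier_sum) (simp_all add: integrable_wave[OF w'] fourier_wave[OF w'] K2_def)
    also have "\<dots> = (\<lambda>x. K1 * K2 * f (- x))"
    proof
      fix x
      have refl: "wave 0 (- t) w x = wave 0 t w (- x)" for t
      proof -
        have "w * (x - - t) = - (w * (- x - t))" by (simp add: algebra_simps)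
        then have "w * (x - - t) \<in> Zhat \<longleftrightarrow> w * (- x - t) \<in> Zhat"
          using Zhat_uminus[of "w * (x - - t)"] Zhat_uminus[of "w * (- x - t)"] by auto
        then show ?thesis unfolding wave_def coset_def indicator_def by simp
      qed
      show "(\<Sum>t\<in>T. (f t * K1) * (K2 * wave 0 (- t) w x)) = K1 * K2 * f (- x)"
        unfolding refl by (subst T(2)[of "- x"]) (simp add: sum_distrib_left mult_ac)
    qed
    finally show ?thesis using int by blast
  qed
  ultimately show ?thesis by blast
qed

lemma integrable_schwartz_bruhat: "f \<in> schwartz_bruhat \<Longrightarrow> integrable \<mu> f"
  using fourier_fourier_schwartz by (auto simp: schwartz_bruhat_def)

lemma fourier_fourier_inject:
  assumes "f \<in> schwartz_bruhat" "g \<in> schwartz_bruhat"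
    and eq: "fourier \<mu> (fourier \<mu> f) = fourier \<mu> (fourier \<mu> g)"
  shows "f = g"
proof -
  obtain N where N: "N > 0" "{f, g} \<subseteq> schwartz N"
    using schwartz_bruhat_common[of "{f, g}"] assms by blast
  obtain K where K: "K \<noteq> 0" "fourier \<mu> (fourier \<mu> f) = (\<lambda>x. K * f (- x))"
    "fourier \<mu> (fourier \<mu> g) = (\<lambda>x. K * g (- x))"
    using fourier_fourier_schwartz[OF N(1)] N(2) by auto
  have "f x = g x" for x
    using fun_cong[OF eq, of "- x"] K by simp
  then show ?thesis by blast
qed

end

section \<open>The spaces of the adelic operator\<close>

definition integral_above :: "nat \<Rightarrow> fadele set" where
  "integral_above m = {x. \<forall>p. prime p \<longrightarrow> m < p \<longrightarrow> place x p \<in> Zp p}"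

lemma Omega_padic_norm:
  "prime p \<Longrightarrow> x \<in> carrier (Qp p) \<Longrightarrow> Omega (padic_norm p x) = (if x \<in> Zp p then 1 else 0)"
  by (simp add: Omega_def Zp_def padic_norm_nonneg)

text \<open>If all places above \<open>m\<close> are integral, the tail factors are 1; otherwise one
  of them is 0. In both cases only finitely many factors differ from 1, so the infinite product is a
  finite one.\<close>

lemma prodinf_Omega_above:
  assumes "\<And>p. prime p \<Longrightarrow> m < p \<Longrightarrow> h p = Omega (padic_norm p (place x p))"
  shows "(\<Prod>p. if prime p then h p else 1) =
    (\<Prod>p | prime p \<and> p \<le> m. h p) * indicator (integral_above m) x"
proof (cases "x \<in> integral_above m")
  case True
  have "(\<Prod>p. if prime p then h p else 1) = (\<Prod>p | prime p \<and> p \<le> m. if prime p then h p else 1)"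
    by (rule prodinf_finite)
      (use True assms in \<open>auto simp: integral_above_def Omega_padic_norm place_closed not_le\<close>)
  also have "\<dots> = (\<Prod>p | prime p \<and> p \<le> m. h p)" by (rule prod.cong) auto
  finally show ?thesis using True by simp
next
  case False
  let ?A = "{p. prime p \<and> place x p \<notin> Zp p} \<union> {p. prime p \<and> p \<le> m}"
  have fin: "finite ?A" using place_finite by simp
  obtain q where q: "prime q" "m < q" "place x q \<notin> Zp q" using False by (auto simp: integral_above_def)
  have "(\<Prod>p. if prime p then h p else 1) = (\<Prod>p\<in>?A. if prime p then h p else 1)"
    by (rule prodinf_finite[OF fin]) (use assms in \<open>auto simp: Omega_padic_norm place_closed not_le\<close>)
  also have "\<dots> = 0"
    using q assms by (intro prod_zero[OF fin]) (auto simp: Omega_padic_norm place_closed intro!: bexI[of _ q])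
  finally show ?thesis using False by simp
qed

lemma prodinf_Omega:
  "(\<Prod>p. if prime p \<and> m < p then Omega (padic_norm p (place x p)) else 1) = indicator (integral_above m) x"
proof -
  have "(\<lambda>p. if prime p \<and> m < p then Omega (padic_norm p (place x p)) else 1)
      = (\<lambda>p. if prime p then if m < p then Omega (padic_norm p (place x p)) else 1 else 1)" by auto
  moreover have "(\<Prod>p | prime p \<and> p \<le> m. if m < p then Omega (padic_norm p (place x p)) else 1) = 1"
    by (rule prod.neutral) auto
  ultimately show ?thesis
    using prodinf_Omega_above[of m "\<lambda>p. if m < p then Omega (padic_norm p (place x p)) else 1" x] by simp
qed

definition elementary :: "nat \<Rightarrow> (nat \<Rightarrow> (nat \<Rightarrow> rat) set \<Rightarrow> complex) \<Rightarrow> bool" where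
  "elementary m \<eta> \<longleftrightarrow> (\<forall>p. prime p \<longrightarrow> \<eta> p \<in> padic_test_functions p) \<and>
     (\<forall>p t. prime p \<longrightarrow> m < p \<longrightarrow> t \<in> carrier (Qp p) \<longrightarrow> \<eta> p t = Omega (padic_norm p t))"

definition tensor :: "(nat \<Rightarrow> (nat \<Rightarrow> rat) set \<Rightarrow> complex) \<Rightarrow> fadele \<Rightarrow> complex" where
  "tensor \<eta> \<xi> = (\<Prod>p. if prime p then \<eta> p (place \<xi> p) else 1)"

lemma Psi_eq:
  "Psi m = {\<psi> \<in> linear_combinations {tensor \<eta> | \<eta>. elementary m \<eta>}.
     \<forall>\<xi> r. prime r \<longrightarrow> r \<le> m \<longrightarrow> place \<xi> r = \<zero>\<^bsub>Qp r\<^esub> \<longrightarrow> \<psi> \<xi> = 0}"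
  unfolding Psi_def elementary_def tensor_def [abs_def] by simp

lemma tensor_elementary:
  "elementary m \<eta> \<Longrightarrow> tensor \<eta> x =
     (\<Prod>p | prime p \<and> p \<le> m. \<eta> p (place x p)) * indicator (integral_above m) x"
  unfolding tensor_def by (rule prodinf_Omega_above) (simp add: elementary_def place_closed)

text \<open>\<open>N\<close> combines the exponents of the finitely many factors at p <= m. Above
  \<open>m\<close> the factor is the indicator of \<open>Zp p\<close>, which is stable under
  integral translations and whose support stays integral after multiplication by
  \<open>N\<close>.\<close>

lemma tensor_schwartz_bruhat:
  assumes \<eta>: "elementary m \<eta>" shows "tensor \<eta> \<in> schwartz_bruhat"
proof -
  have "\<exists>n. (\<forall>x\<in>carrier (Qp p). \<forall>y\<in>carrier (Qp p).
        padic_norm p (x \<ominus>\<^bsub>Qp p\<^esub> y) \<le> 1 / real p ^ n \<longrightarrow> \<eta> p x = \<eta> p y) \<and>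
      (\<forall>x\<in>carrier (Qp p). \<eta> p x \<noteq> 0 \<longrightarrow> padic_norm p x \<le> real p ^ n)" if p: "prime p" for p
  proof -
    have "\<eta> p \<in> padic_test_functions p" using \<eta> p by (simp add: elementary_def)
    from padic_test_function_uniform[OF p this] show ?thesis by metis
  qed
  then obtain n where
    n: "\<And>p x y. prime p \<Longrightarrow> x \<in> carrier (Qp p) \<Longrightarrow> y \<in> carrier (Qp p) \<Longrightarrow>
        padic_norm p (x \<ominus>\<^bsub>Qp p\<^esub> y) \<le> 1 / real p ^ n p \<Longrightarrow> \<eta> p x = \<eta> p y"
      "\<And>p x. prime p \<Longrightarrow> x \<in> carrier (Qp p) \<Longrightarrow> \<eta> p x \<noteq> 0 \<Longrightarrow> padic_norm p x \<le> real p ^ n p"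
    by metis
  define N where "N = (\<Prod>p | prime p \<and> p \<le> m. p ^ n p)"
  have N0: "N > 0" unfolding N_def by (intro prod_pos) (auto dest: prime_gt_0_nat)
  have N: "padic_abs p (of_nat N) \<le> 1 / real p ^ n p" if "prime p" "p \<le> m" for p
    using that unfolding N_def by (intro padic_abs_of_nat_le dvd_prodI) auto
  have "tensor \<eta> (x + of_nat N * y) = tensor \<eta> x" if y: "y \<in> Zhat" for x y
  proof -
    have Zy: "place (of_nat N * y) p \<in> Zp p" if "prime p" for p
      using Zhat_mult[OF Zhat_of_nat y] that by (simp add: Zhat_def)
    have x_eq: "place x p = place (x + of_nat N * y) p \<ominus>\<^bsub>Qp p\<^esub> place (of_nat N * y) p" if "prime p" for p
      using that place_minus[OF that, of "x + of_nat N * y" "of_nat N * y"] by simp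
    have local: "\<eta> p (place (x + of_nat N * y) p) = \<eta> p (place x p)" if p: "prime p" "p \<le> m" for p
    proof (rule n(1)[OF p(1) place_closed[OF p(1)] place_closed[OF p(1)]])
      have "place (x + of_nat N * y) p \<ominus>\<^bsub>Qp p\<^esub> place x p = place (of_nat N * y) p"
        using place_minus[OF p(1), of "x + of_nat N * y" x] by simp
      also have "padic_norm p \<dots> = padic_abs p (of_nat N) * padic_norm p (place y p)"
        using p by (simp add: place_times padic_norm_mult place_of_nat place_closed padic_of_rat_closed padic_norm_of_rat)
      also have "\<dots> \<le> 1 / real p ^ n p * 1"
        using N[OF p] y p by (intro mult_mono) (auto simp: Zhat_def Zp_def padic_norm_nonneg place_closed)
      finally show "padic_norm p (place (x + of_nat N * y) p \<ominus>\<^bsub>Qp p\<^esub> place x p) \<le> 1 / real p ^ n p" by simp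
    qed
    have "place (x + of_nat N * y) p \<in> Zp p \<longleftrightarrow> place x p \<in> Zp p" if "prime p" for p
      using Zy[OF that] x_eq[OF that] Zp_diff[OF that] Zp_add[OF that] place_plus[OF that] by metis
    then have "x + of_nat N * y \<in> integral_above m \<longleftrightarrow> x \<in> integral_above m"
      by (auto simp: integral_above_def)
    moreover have "(\<Prod>p | prime p \<and> p \<le> m. \<eta> p (place (x + of_nat N * y) p)) =
        (\<Prod>p | prime p \<and> p \<le> m. \<eta> p (place x p))"
      by (rule prod.cong) (use local in auto)
    ultimately show ?thesis by (simp add: tensor_elementary[OF \<eta>] indicator_def)
  qed
  moreover have "of_nat N * x \<in> Zhat" if nz: "tensor \<eta> x \<noteq> 0" for x
  proof -
    have x: "x \<in> integral_above m" "\<And>p. prime p \<Longrightarrow> p \<le> m \<Longrightarrow> \<eta> p (place x p) \<noteq> 0"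
      using nz by (auto simp: tensor_elementary[OF \<eta>] split: split_indicator_asm)
    have "place (of_nat N * x) p \<in> Zp p" if p: "prime p" for p
    proof (cases "p \<le> m")
      case True
      have "padic_abs p (of_nat N) * padic_norm p (place x p) \<le> 1 / real p ^ n p * real p ^ n p"
        using N[OF p True] n(2)[OF p place_closed[OF p] x(2)[OF p True]] p
        by (intro mult_mono) (auto simp: padic_norm_nonneg place_closed)
      then show ?thesis using p prime_gt_0_nat[OF p]
        by (simp add: Zp_def place_times padic_norm_mult place_of_nat place_closed padic_of_rat_closed
            padic_norm_of_rat cring.cring_simprules(5)[OF Qp_cring])
    next
      case False
      then show ?thesis using x(1) p Zhat_of_nat[of N]
        by (auto simp: integral_above_def Zhat_def place_times intro!: Zp_mult)
    qed
    then show ?thesis by (simp add: Zhat_def)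
  qed
  ultimately have "tensor \<eta> \<in> schwartz N" by (simp add: schwartz_def)
  then show ?thesis using N0 by (auto simp: schwartz_bruhat_def)
qed

lemma Psi_schwartz_bruhat: "Psi m \<subseteq> schwartz_bruhat"
proof
  fix \<psi> assume "\<psi> \<in> Psi m"
  then obtain T c where T: "finite T" "T \<subseteq> {tensor \<eta> | \<eta>. elementary m \<eta>}" "\<psi> = (\<lambda>x. \<Sum>f\<in>T. c f * f x)"
    unfolding Psi_eq linear_combinations_def by blast
  show "\<psi> \<in> schwartz_bruhat"
    unfolding T(3) by (rule schwartz_bruhat_sum[OF T(1)]) (use T(2) tensor_schwartz_bruhat in blast)
qed

section \<open>Linear independence of the levels\<close>

definition of_level :: "nat \<Rightarrow> (fadele \<Rightarrow> complex) \<Rightarrow> bool" where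
  "of_level m \<psi> \<longleftrightarrow>
     (\<forall>\<xi> r. prime r \<longrightarrow> r \<le> m \<longrightarrow> place \<xi> r = \<zero>\<^bsub>Qp r\<^esub> \<longrightarrow> \<psi> \<xi> = 0) \<and>
     (\<forall>\<xi>. \<xi> \<notin> integral_above m \<longrightarrow> \<psi> \<xi> = 0) \<and>
     (\<forall>\<xi> \<xi>'. \<xi> \<in> integral_above m \<longrightarrow> \<xi>' \<in> integral_above m \<longrightarrow>
        (\<forall>p. prime p \<longrightarrow> p \<le> m \<longrightarrow> place \<xi> p = place \<xi>' p) \<longrightarrow> \<psi> \<xi> = \<psi> \<xi>')"

text \<open>Extracts from membership in \<open>Psi m\<close> the consequences on which independence
  of the levels rests, in a form that passes to differences.\<close>

lemma of_level_Psi: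
  assumes "\<psi> \<in> Psi m" shows "of_level m \<psi>"
proof -
  from assms obtain T c where T: "T \<subseteq> {tensor \<eta> | \<eta>. elementary m \<eta>}" "\<psi> = (\<lambda>x. \<Sum>f\<in>T. c f * f x)"
    and van: "\<And>\<xi> r. prime r \<Longrightarrow> r \<le> m \<Longrightarrow> place \<xi> r = \<zero>\<^bsub>Qp r\<^esub> \<Longrightarrow> \<psi> \<xi> = 0"
    unfolding Psi_eq linear_combinations_def by blast
  have "\<psi> \<xi> = 0" if "\<xi> \<notin> integral_above m" for \<xi>
    unfolding T(2) using T(1) that by (intro sum.neutral) (auto simp: tensor_elementary)
  moreover have "\<psi> \<xi> = \<psi> \<xi>'" if in_above: "\<xi> \<in> integral_above m" "\<xi>' \<in> integral_above m"
    and agree: "\<forall>p. prime p \<longrightarrow> p \<le> m \<longrightarrow> place \<xi> p = place \<xi>' p" for \<xi> \<xi>'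
  proof -
    have "tensor \<eta> \<xi> = tensor \<eta> \<xi>'" if "elementary m \<eta>" for \<eta>
    proof -
      have "(\<Prod>p | prime p \<and> p \<le> m. \<eta> p (place \<xi> p)) = (\<Prod>p | prime p \<and> p \<le> m. \<eta> p (place \<xi>' p))"
        by (rule prod.cong) (use agree in auto)
      then show ?thesis using in_above by (simp add: tensor_elementary[OF that])
    qed
    then show ?thesis unfolding T(2) using T(1) by (intro sum.cong) auto
  qed
  ultimately show ?thesis using van unfolding of_level_def by blast
qed

lemma of_levelD:
  assumes "of_level m \<psi>"
  shows "prime r \<Longrightarrow> r \<le> m \<Longrightarrow> place \<xi> r = \<zero>\<^bsub>Qp r\<^esub> \<Longrightarrow> \<psi> \<xi> = 0"
    and "\<xi> \<notin> integral_above m \<Longrightarrow> \<psi> \<xi> = 0"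
    and "\<xi> \<in> integral_above m \<Longrightarrow> \<xi>' \<in> integral_above m \<Longrightarrow>
      (\<And>p. prime p \<Longrightarrow> p \<le> m \<Longrightarrow> place \<xi> p = place \<xi>' p) \<Longrightarrow> \<psi> \<xi> = \<psi> \<xi>'"
  using assms unfolding of_level_def by blast+

lemma of_level_diff:
  assumes "of_level m f" "of_level m g" shows "of_level m (\<lambda>x. f x - g x)"
  unfolding of_level_def
proof (intro conjI allI impI)
  show "f \<xi> - g \<xi> = f \<xi>' - g \<xi>'" if "\<xi> \<in> integral_above m" "\<xi>' \<in> integral_above m"
    "\<forall>p. prime p \<longrightarrow> p \<le> m \<longrightarrow> place \<xi> p = place \<xi>' p" for \<xi> \<xi>'
    using of_levelD(3)[OF assms(1), of \<xi> \<xi>'] of_levelD(3)[OF assms(2), of \<xi> \<xi>'] that by simp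
qed (use of_levelD(1,2)[OF assms(1)] of_levelD(1,2)[OF assms(2)] in auto)

lemma of_level_0: "of_level m (\<lambda>_. 0)"
  by (simp add: of_level_def)

lemma adele_with_places:
  assumes "\<And>p. prime p \<Longrightarrow> f p \<in> carrier (Qp p)" "\<And>p. prime p \<Longrightarrow> m < p \<Longrightarrow> f p \<in> Zp p"
  obtains x where "\<And>p. prime p \<Longrightarrow> place x p = f p"
proof
  show "place (of_places f) p = f p" if "prime p" for p
    by (rule place_of_places[of f "{..m}"]) (use assms that in \<open>auto simp: not_le\<close>)
qed

text \<open>
  Replacing the coordinates above the least level \<open>n\<close> with \<open>\<phi> n \<noteq> 0\<close> by \<open>0\<close> kills all higher levels.
\<close>

lemma of_level_independent:
  assumes T: "finite T" "\<And>n. n \<in> T \<Longrightarrow> prime n"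
    and lev: "\<And>n. n \<in> T \<Longrightarrow> of_level n (\<phi> n)" and sum: "\<And>\<xi>. (\<Sum>n\<in>T. \<phi> n \<xi>) = 0"
    and n: "n \<in> T"
  shows "\<phi> n = (\<lambda>_. 0)"
proof (rule ccontr)
  assume "\<phi> n \<noteq> (\<lambda>_. 0)"
  define k where "k = (LEAST n. n \<in> T \<and> \<phi> n \<noteq> (\<lambda>_. 0))"
  have k: "k \<in> T" "\<phi> k \<noteq> (\<lambda>_. 0)"
    using LeastI[of "\<lambda>n. n \<in> T \<and> \<phi> n \<noteq> (\<lambda>_. 0)" n] n \<open>\<phi> n \<noteq> _\<close> unfolding k_def by auto
  have below: "\<phi> n = (\<lambda>_. 0)" if "n \<in> T" "n < k" for n
    using not_less_Least[OF that(2)[unfolded k_def]] that(1) by blast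
  obtain \<xi> where \<xi>: "\<phi> k \<xi> \<noteq> 0" using k(2) by auto
  then have \<xi>_above: "\<xi> \<in> integral_above k" using of_levelD(2)[OF lev[OF k(1)]] by blast
  obtain \<xi>' where \<xi>': "\<And>p. prime p \<Longrightarrow> place \<xi>' p = (if p \<le> k then place \<xi> p else \<zero>\<^bsub>Qp p\<^esub>)"
    by (rule adele_with_places[of "\<lambda>p. if p \<le> k then place \<xi> p else \<zero>\<^bsub>Qp p\<^esub>" k])
      (auto simp: place_closed Zp_0 Zp_carrier)
  have "\<xi>' \<in> integral_above k" using \<xi>' Zp_0 by (auto simp: integral_above_def)
  then have eq: "\<phi> k \<xi>' = \<phi> k \<xi>" by (rule of_levelD(3)[OF lev[OF k(1)] _ \<xi>_above]) (simp add: \<xi>')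
  have "\<phi> n \<xi>' = 0" if n: "n \<in> T - {k}" for n
  proof (cases "n < k")
    case True
    then show ?thesis using below n by simp
  next
    case False
    \<comment> \<open>The level \<open>n\<close> is itself a prime, here above \<open>k\<close>, so
      the vanishing condition of level \<open>n\<close> applies at the place
      \<open>n\<close>.\<close>
    then have "place \<xi>' n = \<zero>\<^bsub>Qp n\<^esub>" using n T(2) \<xi>' by auto
    then show ?thesis using of_levelD(1)[OF lev, of n n] n T(2) by auto
  qed
  then have "(\<Sum>n\<in>T. \<phi> n \<xi>') = \<phi> k \<xi>'"
    using sum.remove[OF T(1) k(1), of "\<lambda>n. \<phi> n \<xi>'"] by simp
  then show False using sum eq \<xi> by simp
qed

section \<open>Waves as elementary functions\<close>

lemma wave_factorization:
  assumes b: "\<And>p. prime p \<Longrightarrow> m < p \<Longrightarrow> place b p = \<zero>\<^bsub>Qp p\<^esub>"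
    and c: "\<And>p. prime p \<Longrightarrow> m < p \<Longrightarrow> place c p = \<zero>\<^bsub>Qp p\<^esub>"
    and v: "\<And>p. prime p \<Longrightarrow> m < p \<Longrightarrow> place v p = \<one>\<^bsub>Qp p\<^esub>"
  shows "wave b c v x = (\<Prod>p | prime p \<and> p \<le> m. padic_char p (place b p \<otimes>\<^bsub>Qp p\<^esub> place x p) *
      (if place v p \<otimes>\<^bsub>Qp p\<^esub> (place x p \<ominus>\<^bsub>Qp p\<^esub> place c p) \<in> Zp p then 1 else 0)) *
    indicator (integral_above m) x"
proof -
  \<comment> \<open>Above \<open>m\<close> the modulation is trivial and the coset condition is bare
    integrality, which is the tail of an elementary function.\<close>
  have above: "place (b * x) p = \<zero>\<^bsub>Qp p\<^esub>" "place (v * (x - c)) p = place x p" if "prime p" "m < p" for p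
  proof -
    interpret cring "Qp p" by (rule Qp_cring[OF that(1)])
    show "place (b * x) p = \<zero>\<^bsub>Qp p\<^esub>" "place (v * (x - c)) p = place x p"
      using that b c v by (simp_all add: place_times place_minus place_closed a_minus_def)
  qed
  have "chi (b * x) = (\<Prod>p | prime p \<and> p \<le> m. if prime p then padic_char p (place (b * x) p) else 1)"
    by (rule chi_eq_prod) (use above Zp_0 in \<open>auto simp: not_le\<close>)
  also have "\<dots> = (\<Prod>p | prime p \<and> p \<le> m. padic_char p (place b p \<otimes>\<^bsub>Qp p\<^esub> place x p))"
    by (rule prod.cong) (auto simp: place_times)
  finally have chi: "chi (b * x) = (\<Prod>p | prime p \<and> p \<le> m. padic_char p (place b p \<otimes>\<^bsub>Qp p\<^esub> place x p))" .
  define L where "L p \<longleftrightarrow> place v p \<otimes>\<^bsub>Qp p\<^esub> (place x p \<ominus>\<^bsub>Qp p\<^esub> place c p) \<in> Zp p" for p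
  have L: "place (v * (x - c)) p \<in> Zp p \<longleftrightarrow> (if m < p then place x p \<in> Zp p else L p)" if "prime p" for p
    using above(2)[OF that] that by (simp add: L_def place_times place_minus)
  have coset: "x \<in> coset c v \<longleftrightarrow> x \<in> integral_above m \<and> (\<forall>p. prime p \<and> p \<le> m \<longrightarrow> L p)"
    unfolding coset_def Zhat_def integral_above_def mem_Collect_eq using L by (meson not_le)
  have local: "(\<Prod>p | prime p \<and> p \<le> m. if L p then 1 else 0 :: complex) =
      (if \<forall>p. prime p \<and> p \<le> m \<longrightarrow> L p then 1 else 0)"
  proof (cases "\<forall>p. prime p \<and> p \<le> m \<longrightarrow> L p")
    case False
    then show ?thesis by (simp only: if_False) (rule prod_zero, auto)
  qed (auto intro!: prod.neutral)
  show ?thesis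
    unfolding wave_def chi prod.distrib L_def[symmetric] local by (simp add: coset indicator_def)
qed

lemma padic_wave_test_function:
  assumes p: "prime p" and c: "c \<in> carrier (Qp p)" and b: "b \<in> carrier (Qp p)"
    and u: "u \<in> carrier (Qp p)" "padic_norm p u > 0"
  shows "(\<lambda>t. padic_char p (c \<otimes>\<^bsub>Qp p\<^esub> t) * (if u \<otimes>\<^bsub>Qp p\<^esub> (t \<ominus>\<^bsub>Qp p\<^esub> b) \<in> Zp p then 1 else 0))
    \<in> padic_test_functions p"
proof -
  interpret cring "Qp p" by (rule Qp_cring[OF p])
  \<comment> \<open>Below this distance both c (x - y) and u (x - y) are integral, so neither the
    character nor the coset condition can change.\<close>
  let ?e = "1 / (padic_norm p c + padic_norm p u)"
  have nn: "padic_norm p c \<ge> 0" by (rule padic_norm_nonneg[OF p c])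
  have e: "?e > 0" using nn u by simp
  have small: "z \<otimes>\<^bsub>Qp p\<^esub> (x \<ominus>\<^bsub>Qp p\<^esub> y) \<in> Zp p"
    if "z \<in> {c, u}" and xy: "x \<in> carrier (Qp p)" "y \<in> carrier (Qp p)" "padic_norm p (x \<ominus>\<^bsub>Qp p\<^esub> y) < ?e" for z x y
  proof -
    have z: "z \<in> carrier (Qp p)" "padic_norm p z \<le> padic_norm p c + padic_norm p u"
      using that c u nn by auto
    have "padic_norm p z * padic_norm p (x \<ominus>\<^bsub>Qp p\<^esub> y) \<le> (padic_norm p c + padic_norm p u) * ?e"
      using z xy nn u by (intro mult_mono) (auto simp: padic_norm_nonneg[OF p])
    also have "\<dots> = 1" using nn u by simp
    finally show ?thesis using z xy by (simp add: Zp_def padic_norm_mult[OF p])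
  qed
  show ?thesis
  proof (rule padic_test_functionI[OF p _ e])
    fix x y assume xy: "x \<in> carrier (Qp p)" "y \<in> carrier (Qp p)" "padic_norm p (x \<ominus>\<^bsub>Qp p\<^esub> y) < ?e"
    have "c \<otimes>\<^bsub>Qp p\<^esub> x = c \<otimes>\<^bsub>Qp p\<^esub> y \<oplus>\<^bsub>Qp p\<^esub> c \<otimes>\<^bsub>Qp p\<^esub> (x \<ominus>\<^bsub>Qp p\<^esub> y)" using xy c by algebra
    then have "padic_char p (c \<otimes>\<^bsub>Qp p\<^esub> x) = padic_char p (c \<otimes>\<^bsub>Qp p\<^esub> y)"
      using xy c small[of c x y] by (simp add: padic_char_add[OF p] padic_char_Zp[OF p])
    moreover have "u \<otimes>\<^bsub>Qp p\<^esub> (x \<ominus>\<^bsub>Qp p\<^esub> b) = u \<otimes>\<^bsub>Qp p\<^esub> (y \<ominus>\<^bsub>Qp p\<^esub> b) \<oplus>\<^bsub>Qp p\<^esub> u \<otimes>\<^bsub>Qp p\<^esub> (x \<ominus>\<^bsub>Qp p\<^esub> y)"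
      "u \<otimes>\<^bsub>Qp p\<^esub> (y \<ominus>\<^bsub>Qp p\<^esub> b) = u \<otimes>\<^bsub>Qp p\<^esub> (x \<ominus>\<^bsub>Qp p\<^esub> b) \<ominus>\<^bsub>Qp p\<^esub> u \<otimes>\<^bsub>Qp p\<^esub> (x \<ominus>\<^bsub>Qp p\<^esub> y)"
      using xy u b by algebra+
    then have "u \<otimes>\<^bsub>Qp p\<^esub> (x \<ominus>\<^bsub>Qp p\<^esub> b) \<in> Zp p \<longleftrightarrow> u \<otimes>\<^bsub>Qp p\<^esub> (y \<ominus>\<^bsub>Qp p\<^esub> b) \<in> Zp p"
      using small[of u x y] xy Zp_add[OF p] Zp_diff[OF p] by (metis insertCI)
    ultimately show "padic_char p (c \<otimes>\<^bsub>Qp p\<^esub> x) * (if u \<otimes>\<^bsub>Qp p\<^esub> (x \<ominus>\<^bsub>Qp p\<^esub> b) \<in> Zp p then 1 else 0) =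
      padic_char p (c \<otimes>\<^bsub>Qp p\<^esub> y) * (if u \<otimes>\<^bsub>Qp p\<^esub> (y \<ominus>\<^bsub>Qp p\<^esub> b) \<in> Zp p then 1 else 0)" by simp
  next
    fix t assume t: "t \<in> carrier (Qp p)"
      "padic_char p (c \<otimes>\<^bsub>Qp p\<^esub> t) * (if u \<otimes>\<^bsub>Qp p\<^esub> (t \<ominus>\<^bsub>Qp p\<^esub> b) \<in> Zp p then 1 else 0) \<noteq> 0"
    then have "padic_norm p u * padic_norm p (t \<ominus>\<^bsub>Qp p\<^esub> b) \<le> 1"
      using u b by (auto simp: Zp_def padic_norm_mult[OF p] split: if_splits)
    then have "padic_norm p (t \<ominus>\<^bsub>Qp p\<^esub> b) \<le> 1 / padic_norm p u" using u by (simp add: field_simps)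
    moreover have "t = (t \<ominus>\<^bsub>Qp p\<^esub> b) \<oplus>\<^bsub>Qp p\<^esub> b" using t b by algebra
    then have "padic_norm p t \<le> max (padic_norm p (t \<ominus>\<^bsub>Qp p\<^esub> b)) (padic_norm p b)"
      using padic_norm_add[OF p, of "t \<ominus>\<^bsub>Qp p\<^esub> b" b] t b by simp
    ultimately show "padic_norm p t \<le> max (1 / padic_norm p u) (padic_norm p b)" by linarith
  qed
qed

text \<open>\<open>off\<close> says that 0 violates the coset condition at each p <= m, which yields
  the vanishing demanded by \<open>Psi m\<close>; the conditions above \<open>m\<close> yield the
  standard tail.\<close>

lemma wave_in_Psi:
  assumes b: "\<And>p. prime p \<Longrightarrow> m < p \<Longrightarrow> place b p = \<zero>\<^bsub>Qp p\<^esub>"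
    and c: "\<And>p. prime p \<Longrightarrow> m < p \<Longrightarrow> place c p = \<zero>\<^bsub>Qp p\<^esub>"
    and v: "\<And>p. prime p \<Longrightarrow> m < p \<Longrightarrow> place v p = \<one>\<^bsub>Qp p\<^esub>"
    and uv: "u * v = 1"
    and off: "\<And>p. prime p \<Longrightarrow> p \<le> m \<Longrightarrow> padic_norm p (place v p) * padic_norm p (place c p) > 1"
  shows "(\<lambda>x. C * wave b c v x) \<in> Psi m"
proof -
  define \<eta> where "\<eta> p t = padic_char p (place b p \<otimes>\<^bsub>Qp p\<^esub> t) *
    (if place v p \<otimes>\<^bsub>Qp p\<^esub> (t \<ominus>\<^bsub>Qp p\<^esub> place c p) \<in> Zp p then 1 else 0)" for p t
  have "elementary m \<eta>"
    unfolding elementary_def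
  proof (intro conjI allI impI)
    fix p :: nat assume p: "prime p"
    have "padic_norm p (place v p) > 0"
      using invertible_place_norm[OF uv p] padic_norm_nonneg[OF p place_closed[OF p], of v]
      by (metis less_eq_real_def mult_zero_right zero_neq_one)
    then show "\<eta> p \<in> padic_test_functions p"
      unfolding \<eta>_def [abs_def] by (intro padic_wave_test_function p place_closed)
    fix t assume t: "m < p" "t \<in> carrier (Qp p)"
    interpret cring "Qp p" by (rule Qp_cring[OF p])
    show "\<eta> p t = Omega (padic_norm p t)"
      using t p by (simp add: \<eta>_def b c v a_minus_def Omega_padic_norm padic_char_Zp Zp_0)
  qed
  moreover from this have "wave b c v = tensor \<eta>"
    by (simp add: fun_eq_iff tensor_elementary wave_factorization[OF b c v] \<eta>_def)
  ultimately have "wave b c v \<in> {tensor \<eta> | \<eta>. elementary m \<eta>}" by blast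
  then have "(\<lambda>x. C * wave b c v x) \<in> linear_combinations {tensor \<eta> | \<eta>. elementary m \<eta>}"
    unfolding linear_combinations_def
    by (intro CollectI exI[of _ "{wave b c v}"] exI[of _ "\<lambda>_. C"]) simp
  moreover have "wave b c v x = 0" if r: "prime r" "r \<le> m" "place x r = \<zero>\<^bsub>Qp r\<^esub>" for x r
  proof -
    interpret cring "Qp r" by (rule Qp_cring[OF r(1)])
    have "padic_norm r (place (v * (x - c)) r) > 1"
      using off[OF r(1,2)] r
      by (simp add: place_times place_minus place_closed a_minus_def padic_norm_mult padic_norm_uminus)
    then have "x \<notin> coset c v" using r by (auto simp: coset_def Zhat_def Zp_def)
    then show ?thesis by (simp add: wave_def)
  qed
  ultimately show ?thesis unfolding Psi_eq by auto
qed

section \<open>Adelic wavelets as eigenfunctions\<close>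

text \<open>On the support |u|_p |\<xi> + b|_p <= 1 < |u|_p |b|_p, so \<xi> is closer to -b than -b
  is to 0, and the ultrametric inequality forces equal norms.\<close>

lemma wave_support_norm:
  assumes uv: "u * v = 1" and p: "prime p"
    and off: "padic_norm p (place u p) * padic_norm p (place b p) > 1"
    and nz: "wave c (- b) u \<xi> \<noteq> 0"
  shows "padic_norm p (place \<xi> p) = padic_norm p (place b p)"
proof -
  interpret cring "Qp p" by (rule Qp_cring[OF p])
  have inv: "padic_norm p (place u p) * padic_norm p (place v p) = 1"
    by (rule invertible_place_norm[OF uv p])
  then have u: "padic_norm p (place u p) > 0"
    using padic_norm_nonneg[OF p place_closed[OF p], of u] by (metis less_eq_real_def mult_zero_left zero_neq_one)
  have minus_b: "padic_norm p (place (- b) p) = padic_norm p (place b p)"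
    using p by (simp add: place_uminus padic_norm_uminus place_closed)
  have "place (u * (\<xi> - - b)) p \<in> Zp p"
    using nz p by (auto simp: wave_def coset_def Zhat_def split: split_indicator_asm)
  then have "padic_norm p (place u p) * padic_norm p (place \<xi> p \<ominus>\<^bsub>Qp p\<^esub> place (- b) p) \<le> 1"
    unfolding place_times[OF p] place_minus[OF p] using p by (simp add: Zp_def padic_norm_mult place_closed)
  then have "padic_norm p (place u p) * padic_norm p (place \<xi> p \<ominus>\<^bsub>Qp p\<^esub> place (- b) p) <
      padic_norm p (place u p) * padic_norm p (place (- b) p)"
    using off minus_b by simp
  then have "padic_norm p (place \<xi> p \<ominus>\<^bsub>Qp p\<^esub> place (- b) p) < padic_norm p (place (- b) p)"
    using u by simp
  from padic_norm_eqI[OF p place_closed[OF p] place_closed[OF p] this] show ?thesis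
    unfolding minus_b .
qed

text \<open>At q <= m, writing q^-j x - a = q^-j (x - q^j a) gives v = q^-j, u = q^j, c = q^j a, and
  expanding (k/q)(q^-j x - a) gives b = k / q^(j+1) with a constant phase at -k a / q. That phase
  and q^(j/2) go into \<open>A\<close>. The product of the norms of \<open>u\<close> and
  \<open>b\<close> is q^-j q^(j+1) = q.\<close>

lemma adelic_wavelet_eq_wave:
  assumes a: "\<And>q. prime q \<Longrightarrow> q \<le> m \<Longrightarrow> a q \<in> padic_I q"
    and k: "\<And>q. prime q \<Longrightarrow> q \<le> m \<Longrightarrow> k q \<in> {1..q - 1}"
  obtains A u v b c where
    "A \<noteq> 0" "u * v = 1" "adelic_wavelet m k j a = (\<lambda>x. A * wave b c v x)"
    "\<And>q. prime q \<Longrightarrow> m < q \<Longrightarrow> place b q = \<zero>\<^bsub>Qp q\<^esub>"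
    "\<And>q. prime q \<Longrightarrow> m < q \<Longrightarrow> place c q = \<zero>\<^bsub>Qp q\<^esub>"
    "\<And>q. prime q \<Longrightarrow> m < q \<Longrightarrow> place u q = \<one>\<^bsub>Qp q\<^esub>"
    "\<And>q. prime q \<Longrightarrow> q \<le> m \<Longrightarrow> padic_norm q (place u q) * padic_norm q (place b q) > 1"
    "\<And>q. prime q \<Longrightarrow> q \<le> m \<Longrightarrow> padic_norm q (place b q) = real q ^ (j q + 1)"
proof -
  let ?r = padic_of_rat
  have r: "?r q t \<in> carrier (Qp q)" for q t by (rule padic_of_rat_closed)
  have ac: "a q \<in> carrier (Qp q)" if "prime q" "q \<le> m" for q
    using a[OF that] by (auto simp: padic_I_def padic_of_rat_closed)
  have Z: "\<one>\<^bsub>Qp q\<^esub> \<in> Zp q" "\<one>\<^bsub>Qp q\<^esub> \<in> carrier (Qp q)" "\<zero>\<^bsub>Qp q\<^esub> \<in> Zp q" "\<zero>\<^bsub>Qp q\<^esub> \<in> carrier (Qp q)"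
    if "prime q" for q using that by (auto simp: Zp_0 Zp_1 Zp_carrier)
  obtain u where u: "\<And>q. prime q \<Longrightarrow> place u q = (if q \<le> m then ?r q (of_nat q ^ j q) else \<one>\<^bsub>Qp q\<^esub>)"
    by (rule adele_with_places[of "\<lambda>q. if q \<le> m then ?r q (of_nat q ^ j q) else \<one>\<^bsub>Qp q\<^esub>" m])
      (auto simp: r Z)
  obtain v where v: "\<And>q. prime q \<Longrightarrow> place v q = (if q \<le> m then ?r q (1 / of_nat q ^ j q) else \<one>\<^bsub>Qp q\<^esub>)"
    by (rule adele_with_places[of "\<lambda>q. if q \<le> m then ?r q (1 / of_nat q ^ j q) else \<one>\<^bsub>Qp q\<^esub>" m])
      (auto simp: r Z)
  obtain b where b: "\<And>q. prime q \<Longrightarrow> place b q = (if q \<le> m then ?r q (of_nat (k q) / of_nat q ^ (j q + 1)) else \<zero>\<^bsub>Qp q\<^esub>)"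
    by (rule adele_with_places[of "\<lambda>q. if q \<le> m then ?r q (of_nat (k q) / of_nat q ^ (j q + 1)) else \<zero>\<^bsub>Qp q\<^esub>" m])
      (auto simp: r Z)
  obtain c where c: "\<And>q. prime q \<Longrightarrow> place c q = (if q \<le> m then ?r q (of_nat q ^ j q) \<otimes>\<^bsub>Qp q\<^esub> a q else \<zero>\<^bsub>Qp q\<^esub>)"
    by (rule adele_with_places[of "\<lambda>q. if q \<le> m then ?r q (of_nat q ^ j q) \<otimes>\<^bsub>Qp q\<^esub> a q else \<zero>\<^bsub>Qp q\<^esub>" m])
      (auto simp: r Z ac cring.cring_simprules(5)[OF Qp_cring])
  have q0: "of_nat q \<noteq> (0 :: rat)" "q > 0" if "prime q" for q using prime_gt_0_nat[OF that] by auto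
  have uv: "u * v = 1"
  proof (rule fadele_eqI)
    fix q :: nat assume q: "prime q"
    interpret cring "Qp q" by (rule Qp_cring[OF q])
    show "place (u * v) q = place 1 q"
      using q q0[OF q] by (simp add: place_times u v place_one padic_of_rat_mult padic_of_rat_1)
  qed
  have norm_u: "padic_norm q (place u q) = 1 / real q ^ j q" if "prime q" "q \<le> m" for q
    using that by (simp add: u padic_norm_of_rat padic_abs_power padic_abs_prime power_one_over)
  have norm_b: "padic_norm q (place b q) = real q ^ (j q + 1)" if q: "prime q" "q \<le> m" for q
  proof -
    \<comment> \<open>0 < k_q < q makes k_q a unit at \<open>q\<close>, so the norm of b_q comes
      from its denominator alone.\<close>
    have "\<not> q dvd k q" using k[OF q] q by (auto dest: dvd_imp_le)
    then have "padic_abs q (of_nat (k q)) = 1" using q by (simp add: padic_abs_of_nat_eq_1)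
    then have "padic_abs q (of_nat (k q) * (1 / of_nat q ^ (j q + 1))) = real q ^ (j q + 1)"
      unfolding padic_abs_mult[OF q(1)] padic_abs_inverse[OF q(1)] padic_abs_power[OF q(1)] padic_abs_prime[OF q(1)]
      by (simp add: power_one_over)
    then show ?thesis using q by (simp add: b padic_norm_of_rat)
  qed
  define A where "A = (\<Prod>q | prime q \<and> q \<le> m. complex_of_real (real q powr (real (j q) / 2)) *
    padic_char q (\<ominus>\<^bsub>Qp q\<^esub> (?r q (of_nat (k q) / of_nat q) \<otimes>\<^bsub>Qp q\<^esub> a q)))"
  have "adelic_wavelet m k j a x = A * wave b c v x" for x
  proof -
    have "(let y = ?r q (1 / of_nat q ^ j q) \<otimes>\<^bsub>Qp q\<^esub> place x q \<ominus>\<^bsub>Qp q\<^esub> a q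
        in complex_of_real (real q powr (real (j q) / 2)) *
           padic_char q (?r q (of_nat (k q) / of_nat q) \<otimes>\<^bsub>Qp q\<^esub> y) * Omega (padic_norm q y)) =
      (complex_of_real (real q powr (real (j q) / 2)) *
        padic_char q (\<ominus>\<^bsub>Qp q\<^esub> (?r q (of_nat (k q) / of_nat q) \<otimes>\<^bsub>Qp q\<^esub> a q))) *
      (padic_char q (place b q \<otimes>\<^bsub>Qp q\<^esub> place x q) *
       (if place v q \<otimes>\<^bsub>Qp q\<^esub> (place x q \<ominus>\<^bsub>Qp q\<^esub> place c q) \<in> Zp q then 1 else 0))"
      if q: "prime q" "q \<le> m" for q
    proof -
      interpret cring "Qp q" by (rule Qp_cring[OF q(1)])
      let ?v = "?r q (1 / of_nat q ^ j q)" and ?u = "?r q (of_nat q ^ j q)" and ?k = "?r q (of_nat (k q) / of_nat q)"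
      define y where "y = ?v \<otimes>\<^bsub>Qp q\<^esub> place x q \<ominus>\<^bsub>Qp q\<^esub> a q"
      have xq: "place x q \<in> carrier (Qp q)" and aq: "a q \<in> carrier (Qp q)"
        using q ac by (simp_all add: place_closed)
      have yq: "y \<in> carrier (Qp q)" using xq aq r by (simp add: y_def)
      have one: "?v \<otimes>\<^bsub>Qp q\<^esub> ?u = \<one>\<^bsub>Qp q\<^esub>"
        using q0[OF q(1)] by (simp add: padic_of_rat_mult[OF q(1)] padic_of_rat_1)
      have "?v \<otimes>\<^bsub>Qp q\<^esub> (place x q \<ominus>\<^bsub>Qp q\<^esub> ?u \<otimes>\<^bsub>Qp q\<^esub> a q) = ?v \<otimes>\<^bsub>Qp q\<^esub> place x q \<ominus>\<^bsub>Qp q\<^esub> (?v \<otimes>\<^bsub>Qp q\<^esub> ?u) \<otimes>\<^bsub>Qp q\<^esub> a q"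
        using xq aq r[of q "1 / of_nat q ^ j q"] r[of q "of_nat q ^ j q"] by algebra
      then have v_eq: "place v q \<otimes>\<^bsub>Qp q\<^esub> (place x q \<ominus>\<^bsub>Qp q\<^esub> place c q) = y"
        using q aq by (simp add: one v c y_def)
      have "?k \<otimes>\<^bsub>Qp q\<^esub> y = (?k \<otimes>\<^bsub>Qp q\<^esub> ?v) \<otimes>\<^bsub>Qp q\<^esub> place x q \<oplus>\<^bsub>Qp q\<^esub> \<ominus>\<^bsub>Qp q\<^esub> (?k \<otimes>\<^bsub>Qp q\<^esub> a q)"
        unfolding y_def using xq aq r[of q "1 / of_nat q ^ j q"] r[of q "of_nat (k q) / of_nat q"] by algebra
      also have "?k \<otimes>\<^bsub>Qp q\<^esub> ?v = place b q"
        using q by (simp add: padic_of_rat_mult b)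
      finally have "padic_char q (?k \<otimes>\<^bsub>Qp q\<^esub> y) =
          padic_char q (place b q \<otimes>\<^bsub>Qp q\<^esub> place x q) * padic_char q (\<ominus>\<^bsub>Qp q\<^esub> (?k \<otimes>\<^bsub>Qp q\<^esub> a q))"
        using q xq aq r by (simp add: padic_char_add place_closed)
      then show ?thesis
        unfolding Let_def v_eq y_def[symmetric] using yq q by (simp add: Omega_padic_norm)
    qed
    then have "(\<Prod>q | prime q \<and> q \<le> m. let y = ?r q (1 / of_nat q ^ j q) \<otimes>\<^bsub>Qp q\<^esub> place x q \<ominus>\<^bsub>Qp q\<^esub> a q
        in complex_of_real (real q powr (real (j q) / 2)) *
           padic_char q (?r q (of_nat (k q) / of_nat q) \<otimes>\<^bsub>Qp q\<^esub> y) * Omega (padic_norm q y)) =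
      A * (\<Prod>q | prime q \<and> q \<le> m. padic_char q (place b q \<otimes>\<^bsub>Qp q\<^esub> place x q) *
       (if place v q \<otimes>\<^bsub>Qp q\<^esub> (place x q \<ominus>\<^bsub>Qp q\<^esub> place c q) \<in> Zp q then 1 else 0))"
      unfolding A_def prod.distrib[symmetric] by (intro prod.cong) auto
    moreover have "wave b c v x = (\<Prod>q | prime q \<and> q \<le> m. padic_char q (place b q \<otimes>\<^bsub>Qp q\<^esub> place x q) *
       (if place v q \<otimes>\<^bsub>Qp q\<^esub> (place x q \<ominus>\<^bsub>Qp q\<^esub> place c q) \<in> Zp q then 1 else 0)) * indicator (integral_above m) x"
      by (rule wave_factorization) (simp_all add: b c v)
    ultimately show ?thesis
      unfolding adelic_wavelet_def prodinf_Omega by (simp add: mult.assoc)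
  qed
  moreover have "A \<noteq> 0"
  proof -
    have "padic_char q t \<noteq> 0" for q t by (simp add: padic_char_def)
    then show ?thesis by (auto simp: A_def dest: prime_gt_0_nat)
  qed
  moreover have "padic_norm q (place u q) * padic_norm q (place b q) > 1" if "prime q" "q \<le> m" for q
    using norm_u[OF that] norm_b[OF that] prime_gt_1_nat[OF that(1)] by simp
  ultimately show ?thesis
    using that[OF _ uv, of A b c] norm_b b c u by auto
qed

section \<open>The operator on a single level\<close>

context Haar_measure begin

lemma fourier_wave_multiple:
  assumes uv: "u * v = 1"
  shows "fourier \<mu> (\<lambda>x. C * wave b c v x) =
    (\<lambda>\<xi>. C * (of_real (measure \<mu> (coset 0 v)) * chi (b * c)) * wave c (- b) u \<xi>)"
  unfolding fourier_scale[OF integrable_wave[OF uv]] fourier_wave[OF uv] by (simp add: mult.assoc)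

lemma inj_on_fourier_Phi_level: "inj_on (fourier \<mu>) (Phi_level \<mu> m)"
proof (rule inj_onI)
  fix f g assume fg: "f \<in> Phi_level \<mu> m" "g \<in> Phi_level \<mu> m" "fourier \<mu> f = fourier \<mu> g"
  then obtain \<phi> \<psi> where "\<phi> \<in> Psi m" "\<psi> \<in> Psi m" "f = fourier \<mu> \<phi>" "g = fourier \<mu> \<psi>"
    by (auto simp: Phi_level_def)
  then show "f = g" using fourier_fourier_inject[of \<phi> \<psi>] fg(3) Psi_schwartz_bruhat by auto
qed

text \<open>Reduces the inverse transform to exhibiting a candidate: by injectivity, any element of
  the level with the right transform is the value.\<close>

lemma frac_op_level_eq:
  assumes "g \<in> Phi_level \<mu> m" "fourier \<mu> g = (\<lambda>\<xi>. frac_symbol \<gamma> m \<xi> * fourier \<mu> f \<xi>)"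
  shows "frac_op_level \<mu> \<gamma> m f = g"
  unfolding frac_op_level_def assms(2)[symmetric] by (rule the_inv_into_f_f[OF inj_on_fourier_Phi_level assms(1)])

lemma zero_in_Phi_level: "(\<lambda>_. 0) \<in> Phi_level \<mu> m"
proof -
  have "(\<lambda>_. 0) \<in> Psi m"
    unfolding Psi_def linear_combinations_def by (auto intro!: exI[of _ "{}"])
  then show ?thesis unfolding Phi_level_def using fourier_0 by (metis image_eqI)
qed

lemma frac_op_level_0: "frac_op_level \<mu> \<gamma> m (\<lambda>_. 0) = (\<lambda>_. 0)"
  by (rule frac_op_level_eq[OF zero_in_Phi_level]) (simp add: fourier_0)

text \<open>Injectivity of the double transform carries the identity back to functions in the spaces
  \<open>Psi n\<close>, where the levels are independent. As \<open>f\<close> is nonzero, its own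
  level has to occur in \<open>S\<close>.\<close>

lemma Phi_level_decomposition_unique:
  assumes f: "f \<in> Phi_level \<mu> m" "f \<noteq> (\<lambda>_. 0)" and m: "prime m"
    and S: "finite S" "\<And>n. n \<in> S \<Longrightarrow> prime n \<and> \<zeta> n \<in> Phi_level \<mu> n"
    and sum: "f = (\<lambda>x. \<Sum>n\<in>S. \<zeta> n x)"
  shows "m \<in> S" "\<zeta> m = f" "\<And>n. n \<in> S \<Longrightarrow> n \<noteq> m \<Longrightarrow> \<zeta> n = (\<lambda>_. 0)"
proof -
  obtain \<psi> where \<psi>: "\<psi> \<in> Psi m" "f = fourier \<mu> \<psi>" using f(1) by (auto simp: Phi_level_def)
  have "\<forall>n\<in>S. \<exists>\<phi>. \<phi> \<in> Psi n \<and> \<zeta> n = fourier \<mu> \<phi>" using S(2) unfolding Phi_level_def by blast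
  then obtain \<phi> where \<phi>: "\<And>n. n \<in> S \<Longrightarrow> \<phi> n \<in> Psi n" "\<And>n. n \<in> S \<Longrightarrow> \<zeta> n = fourier \<mu> (\<phi> n)"
    by metis
  have sb: "\<psi> \<in> schwartz_bruhat" "\<And>n. n \<in> S \<Longrightarrow> \<phi> n \<in> schwartz_bruhat"
    using \<psi>(1) \<phi>(1) Psi_schwartz_bruhat by blast+
  have "fourier \<mu> (\<lambda>x. \<Sum>n\<in>S. 1 * \<phi> n x) = (\<lambda>x. \<Sum>n\<in>S. 1 * fourier \<mu> (\<phi> n) x)"
    by (rule fourier_sum) (use sb integrable_schwartz_bruhat in blast)
  also have "\<dots> = fourier \<mu> \<psi>" unfolding \<psi>(2)[symmetric] sum using \<phi>(2) by simp
  finally have eq: "fourier \<mu> (\<lambda>x. \<Sum>n\<in>S. 1 * \<phi> n x) = fourier \<mu> \<psi>" .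
  have "(\<lambda>x. \<Sum>n\<in>S. 1 * \<phi> n x) = \<psi>"
    by (rule fourier_fourier_inject[OF schwartz_bruhat_sum[OF S(1) sb(2)] sb(1)]) (simp_all only: eq)
  from fun_cong[OF this] have sum_\<phi>: "(\<Sum>n\<in>S. \<phi> n x) = \<psi> x" for x by simp
  \<comment> \<open>Subtracting \<open>\<psi>\<close> at index \<open>m\<close> gives a family with
    sum 0. It is indexed by \<open>insert m S\<close> because \<open>m\<close> is not yet known to
    lie in \<open>S\<close>.\<close>
  let ?\<theta> = "\<lambda>n x. (if n \<in> S then \<phi> n else (\<lambda>_. 0)) x - (if n = m then \<psi> else (\<lambda>_. 0)) x"
  have \<theta>: "?\<theta> n = (\<lambda>_. 0)" if "n \<in> insert m S" for n
  proof (rule of_level_independent[of "insert m S" ?\<theta>])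
    show "finite (insert m S)" using S(1) by simp
    show "prime n" if "n \<in> insert m S" for n using that m S(2) by blast
    show "of_level n (?\<theta> n)" if "n \<in> insert m S" for n
      using \<phi>(1) \<psi>(1) by (intro of_level_diff) (auto simp: of_level_Psi of_level_0)
    show "(\<Sum>n\<in>insert m S. ?\<theta> n \<xi>) = 0" for \<xi>
    proof -
      have "(\<Sum>n\<in>insert m S. (if n \<in> S then \<phi> n else (\<lambda>_. 0)) \<xi>) = (\<Sum>n\<in>S. \<phi> n \<xi>)"
        using S(1) by (intro sum.mono_neutral_cong_right) auto
      moreover have "(\<Sum>n\<in>insert m S. (if n = m then \<psi> else (\<lambda>_. 0)) \<xi>) = (\<Sum>n\<in>{m}. \<psi> \<xi>)"
        using S(1) by (intro sum.mono_neutral_cong_right) auto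
      ultimately show ?thesis by (simp only: sum_subtractf sum_\<phi>) simp
    qed
  qed (rule that)
  have other: "\<phi> n = (\<lambda>_. 0)" if "n \<in> S" "n \<noteq> m" for n using \<theta>[of n] that by simp
  show mS: "m \<in> S"
  proof (rule ccontr)
    assume "m \<notin> S"
    then have "\<psi> = (\<lambda>_. 0)" using \<theta>[of m] by (simp add: fun_eq_iff)
    then show False using \<psi>(2) f(2) fourier_0 by simp
  qed
  have "\<phi> m = \<psi>" using \<theta>[of m] mS by (simp add: fun_eq_iff)
  then show "\<zeta> m = f" using \<phi>(2)[OF mS] \<psi>(2) by simp
  show "\<zeta> n = (\<lambda>_. 0)" if "n \<in> S" "n \<noteq> m" for n
    using other[OF that] \<phi>(2)[OF that(1)] fourier_0 by simp
qed

text \<open>The one-term decomposition is a witness; any other one only adds terms equal to 0, whose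
  images are 0, so the described value is unique.\<close>

lemma frac_op_Phi_level:
  assumes f: "f \<in> Phi_level \<mu> m" "f \<noteq> (\<lambda>_. 0)" and m: "prime m"
  shows "frac_op \<mu> \<gamma> f = frac_op_level \<mu> \<gamma> m f"
  unfolding frac_op_def
proof (rule the_equality)
  show "\<exists>S \<zeta>. finite S \<and> (\<forall>m\<in>S. prime m \<and> \<zeta> m \<in> Phi_level \<mu> m) \<and> f = (\<lambda>x. \<Sum>m\<in>S. \<zeta> m x) \<and>
     frac_op_level \<mu> \<gamma> m f = (\<lambda>x. \<Sum>m\<in>S. frac_op_level \<mu> \<gamma> m (\<zeta> m) x)"
    using f(1) m by (intro exI[of _ "{m}"] exI[of _ "\<lambda>_. f"]) simp
next
  fix g assume "\<exists>S \<zeta>. finite S \<and> (\<forall>m\<in>S. prime m \<and> \<zeta> m \<in> Phi_level \<mu> m) \<and> f = (\<lambda>x. \<Sum>m\<in>S. \<zeta> m x) \<and>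
     g = (\<lambda>x. \<Sum>m\<in>S. frac_op_level \<mu> \<gamma> m (\<zeta> m) x)"
  then obtain S \<zeta> where S: "finite S" "\<And>n. n \<in> S \<Longrightarrow> prime n \<and> \<zeta> n \<in> Phi_level \<mu> n"
    "f = (\<lambda>x. \<Sum>n\<in>S. \<zeta> n x)" and g: "g = (\<lambda>x. \<Sum>n\<in>S. frac_op_level \<mu> \<gamma> n (\<zeta> n) x)" by blast
  note unique = Phi_level_decomposition_unique[OF f m S]
  have "(\<Sum>n\<in>S. frac_op_level \<mu> \<gamma> n (\<zeta> n) x) = (\<Sum>n\<in>{m}. frac_op_level \<mu> \<gamma> n (\<zeta> n) x)" for x
    using unique by (intro sum.mono_neutral_right S(1)) (auto simp: frac_op_level_0)
  then show "g = frac_op_level \<mu> \<gamma> m f" using unique(2) g by simp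
qed

end

theorem corollary9p1:
  fixes \<mu> :: "fadele measure"
    and \<gamma> :: "nat \<Rightarrow> complex"
    and m :: nat
    and k j :: "nat \<Rightarrow> nat"
    and a :: "nat \<Rightarrow> (nat \<Rightarrow> rat) set"
  assumes "adelic_Haar \<mu>"
    and "prime m"
    and "\<And>q. prime q \<Longrightarrow> q \<le> m \<Longrightarrow> k q \<in> {1..q - 1}"
    and "\<And>q. prime q \<Longrightarrow> q \<le> m \<Longrightarrow> a q \<in> padic_I q"
  shows "adelic_wavelet m k j a \<in> Phi \<mu> \<and>
         adelic_wavelet m k j a \<noteq> (\<lambda>_. 0) \<and>
         frac_op \<mu> \<gamma> (adelic_wavelet m k j a) =
           (\<lambda>x. (\<Prod>q | prime q \<and> q \<le> m. of_nat q powr (\<gamma> q * of_nat (j q + 1))) *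
                 adelic_wavelet m k j a x)"
proof -
  interpret Haar_measure \<mu> by unfold_locales (rule assms(1))
  show ?thesis
  proof (rule adelic_wavelet_eq_wave[where m = m and k = k and a = a and j = j])
    show "a q \<in> padic_I q" "k q \<in> {1..q - 1}" if "prime q" "q \<le> m" for q
      using assms(3,4)[OF that] by blast+
  next
    fix A u v b c assume A: "A \<noteq> 0" and uv: "u * v = 1"
      and f: "adelic_wavelet m k j a = (\<lambda>x. A * wave b c v x)"
      and above: "\<And>q. prime q \<Longrightarrow> m < q \<Longrightarrow> place b q = \<zero>\<^bsub>Qp q\<^esub>"
        "\<And>q. prime q \<Longrightarrow> m < q \<Longrightarrow> place c q = \<zero>\<^bsub>Qp q\<^esub>"
        "\<And>q. prime q \<Longrightarrow> m < q \<Longrightarrow> place u q = \<one>\<^bsub>Qp q\<^esub>"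
      and off: "\<And>q. prime q \<Longrightarrow> q \<le> m \<Longrightarrow> padic_norm q (place u q) * padic_norm q (place b q) > 1"
      and norm_b: "\<And>q. prime q \<Longrightarrow> q \<le> m \<Longrightarrow> padic_norm q (place b q) = real q ^ (j q + 1)"
    have vu: "v * u = 1" using uv by (simp add: mult.commute)
    \<comment> \<open>By \<open>fourier_wave\<close> with the roles of \<open>u\<close> and
      \<open>v\<close> exchanged, W(-c, b, u) transforms to K W(b, c, v); dividing by
      \<open>K\<close> gives preimages.\<close>
    define K where "K = of_real (measure \<mu> (coset 0 u)) * chi (- c * b)"
    have K: "K \<noteq> 0" using measure_coset_pos[OF vu] by (simp add: K_def)
    \<comment> \<open>Stated for every \<open>C\<close>, as both the wavelet and its multiple by the
      eigenvalue must lie in the level.\<close>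
    have level: "(\<lambda>x. C * wave b c v x) \<in> Phi_level \<mu> m" for C
    proof -
      have "place (- c) q = \<zero>\<^bsub>Qp q\<^esub>" if "prime q" "m < q" for q
      proof -
        interpret cring "Qp q" by (rule Qp_cring[OF that(1)])
        show ?thesis using that above(2) by (simp add: place_uminus)
      qed
      then have "(\<lambda>x. C / K * wave (- c) b u x) \<in> Psi m"
        using wave_in_Psi[of m "- c" b u v "C / K"] above vu off by simp
      moreover have "fourier \<mu> (\<lambda>x. C / K * wave (- c) b u x) = (\<lambda>x. C * wave b c v x)"
        unfolding fourier_wave_multiple[OF vu] K_def[symmetric] using K by simp
      ultimately show ?thesis unfolding Phi_level_def by (metis image_eqI)
    qed
    let ?f = "\<lambda>x. A * wave b c v x" and ?\<Lambda> = "\<Prod>q | prime q \<and> q \<le> m. of_nat q powr (\<gamma> q * of_nat (j q + 1)) :: complex"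
    have "?f \<in> Phi \<mu>"
      unfolding Phi_def linear_combinations_def
      using level[of A] assms(2) by (auto intro!: exI[of _ "{?f}"] exI[of _ "\<lambda>_. 1"])
    \<comment> \<open>At its centre a wave has modulus 1.\<close>
    moreover have "?f c \<noteq> 0" using A by (simp add: wave_def coset_def Zhat_0)
    then have nz: "?f \<noteq> (\<lambda>_. 0)" by metis
    moreover have "frac_op_level \<mu> \<gamma> m ?f = (\<lambda>x. ?\<Lambda> * ?f x)"
    proof (rule frac_op_level_eq)
      show "(\<lambda>x. ?\<Lambda> * ?f x) \<in> Phi_level \<mu> m" using level[of "?\<Lambda> * A"] by (simp add: mult.assoc)
      have symbol: "frac_symbol \<gamma> m \<xi> = ?\<Lambda>" if w: "wave c (- b) u \<xi> \<noteq> 0" for \<xi>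
      proof -
        have "complex_of_real (padic_norm q (place \<xi> q)) powr \<gamma> q = of_nat q powr (\<gamma> q * of_nat (j q + 1))"
          if q: "prime q" "q \<le> m" for q
        proof -
          have "padic_norm q (place \<xi> q) = real q ^ (j q + 1)"
            using wave_support_norm[OF uv q(1) off[OF q] w] norm_b[OF q] by simp
          \<comment> \<open>The base is a positive real, so the principal logarithm is the real one,
            and the exponent j + 1 can be moved inside without a branch problem.\<close>
          moreover have "complex_of_real (real q ^ (j q + 1)) powr \<gamma> q = exp (\<gamma> q * of_real (ln (real q ^ (j q + 1))))"
            using prime_gt_0_nat[OF q(1)] by (simp add: powr_def Ln_of_real del: of_real_power power_Suc)
          moreover have "ln (real q ^ (j q + 1)) = real (j q + 1) * ln (real q)"
            using prime_gt_0_nat[OF q(1)] by (simp add: ln_realpow del: power_Suc)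
          moreover have "(of_nat q :: complex) powr (\<gamma> q * of_nat (j q + 1)) = exp (\<gamma> q * of_nat (j q + 1) * of_real (ln (real q)))"
            using prime_gt_0_nat[OF q(1)] Ln_of_real[of "real q"] by (simp add: powr_def)
          ultimately show ?thesis by (simp add: mult_ac)
        qed
        then have "(\<Prod>q | prime q \<and> q \<le> m. complex_of_real (padic_norm q (place \<xi> q)) powr \<gamma> q) = ?\<Lambda>"
          by (intro prod.cong) auto
        moreover have "\<xi> \<in> integral_above m"
        proof -
          have "place \<xi> q \<in> Zp q" if q: "prime q" "m < q" for q
          proof -
            interpret cring "Qp q" by (rule Qp_cring[OF q(1)])
            \<comment> \<open>Above \<open>m\<close> one has u = 1 and b = 0, so this condition is
              integrality of \<xi> itself.\<close>
            have "place (u * (\<xi> - - b)) q \<in> Zp q"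
              using w q by (auto simp: wave_def coset_def Zhat_def split: split_indicator_asm)
            then show ?thesis
              using q above unfolding place_times[OF q(1)] place_minus[OF q(1)] place_uminus[OF q(1)]
              by (simp add: place_closed a_minus_def)
          qed
          then show ?thesis by (simp add: integral_above_def)
        qed
        ultimately show ?thesis unfolding frac_symbol_def prodinf_Omega by simp
      qed
      have "integrable \<mu> ?f" by (intro integrable_mult_right integrable_wave[OF uv])
      then have "fourier \<mu> (\<lambda>x. ?\<Lambda> * ?f x) = (\<lambda>\<xi>. ?\<Lambda> * fourier \<mu> ?f \<xi>)" by (rule fourier_scale)
      also have "\<dots> = (\<lambda>\<xi>. frac_symbol \<gamma> m \<xi> * fourier \<mu> ?f \<xi>)"
      proof
        \<comment> \<open>Off the support of the transform both sides are 0; on it the symbol is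
          constant.\<close>
        show "?\<Lambda> * fourier \<mu> ?f \<xi> = frac_symbol \<gamma> m \<xi> * fourier \<mu> ?f \<xi>" for \<xi>
          unfolding fourier_wave_multiple[OF uv]
          by (cases "wave c (- b) u \<xi> = 0") (use symbol[of \<xi>] in simp_all)
      qed
      finally show "fourier \<mu> (\<lambda>x. ?\<Lambda> * ?f x) = (\<lambda>\<xi>. frac_symbol \<gamma> m \<xi> * fourier \<mu> ?f \<xi>)" .
    qed
    ultimately show ?thesis
      unfolding f using frac_op_Phi_level[OF level nz assms(2)] by simp
  qed
qed

end
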